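(* Assume the process $\{F_j\}_{j\in\mathbb Z_+}$ is i.i.d. under $\mathbb P$ and satisfies the tail assumptions $$\int_0^\infty\bigl\{1-\mathbb E(F_0(x))\bigr\}^{1/2}dx<\infty,\qquad \int_0^\infty\operatorname*{ess\,sup}_{\mathbb P}(1-F_0(x))\,dx<\infty,$$ $$\int_{-\infty}^0\bigl(\mathbb E[F_0(x)]\bigr)^{1/2}dx<\infty,\qquad \int_{-\infty}^0\operatorname*{ess\,sup}_{\mathbb P}F_0(x)\,dx<\infty.$$ In addition, assume the uniform bound: there is a constant $M<\infty$ with $\mathbb P\{F_0(-M)=0\text{ and }F_0(M)=1\}=1$. Then for any $\varepsilon>0$, as $\alpha\searrow0$, $$\Psi_F(\alpha,1)=\mu_F+2\sigma_F\sqrt\alpha+o(\alpha^{\frac35-\varepsilon}).$$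
   Context: $\mathbb P$ is a probability measure on sequences $(F_j)_{j\in\mathbb Z_+}$ of Borel probability distributions on $\mathbb R$ (the environment), with expectation $\mathbb E$; $F_j(\cdot)$ also denotes the distribution function. Given $(F_j)$, the weights $\{X(i,j):(i,j)\in\mathbb Z_+^2\}$ are independent with $X(i,j)\sim F_j$. $T(k,\ell)$ is the maximum of $\sum_{z\in\pi}X(z)$ over all nearest-neighbor lattice paths $\pi$ from $(0,0)$ to $(k,\ell)$ with steps $(1,0)$ or $(0,1)$, the endpoint $(k,\ell)$ excluded. $\Psi_F(x,y)=\lim_{n\to\infty}\frac1nT(\lfloor nx\rfloor,\lfloor ny\rfloor)$, $(x,y)\in(0,\infty)^2$, is the deterministic limit, almost sure and in $L^1$ over environment and weights. $\mu_j$ and $\sigma_j^2$ denote the mean and variance of the (random) distribution $F_j$; $\mu_F=\mathbb E(\mu_0)$, $\sigma_F^2=\mathbb E(\sigma_0^2)$, $\sigma_F=\sqrt{\sigma_F^2}$. $\operatorname{ess\,sup}_{\mathbb P}f=\inf\{s\in\mathbb R:\mathbb P(f>s)=0\}$. *)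

theory Defs
  imports "HOL-Probability.Probability" "HOL-Library.Landau_Symbols"
begin

section \<open>Random environments\<close>

text \<open>
  An environment is a sequence \<open>F\<close> of Borel probability distributions on the real line; \<open>F j\<close> is
  attached to all lattice sites \<open>(i, j)\<close> with second coordinate \<open>j\<close>.
\<close>

type_synonym env = "nat \<Rightarrow> real measure"

type_synonym weights = "nat \<times> nat \<Rightarrow> real"

definition env_space :: "env measure" where
  "env_space = (\<Pi>\<^sub>M j\<in>UNIV. prob_algebra borel)"

definition iid_env :: "env measure \<Rightarrow> bool" where
  "iid_env P \<longleftrightarrow>
     prob_space P \<and> sets P = sets env_space \<and>
     prob_space.indep_vars P (\<lambda>_. prob_algebra borel) (\<lambda>j F. F j) UNIV \<and>
     (\<forall>j. distr P (prob_algebra borel) (\<lambda>F. F j) = distr P (prob_algebra borel) (\<lambda>F. F 0))"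

definition weight_space :: "weights measure" where
  "weight_space = (\<Pi>\<^sub>M z\<in>UNIV. borel)"

definition weight_law :: "env \<Rightarrow> weights measure" where
  "weight_law F = (\<Pi>\<^sub>M (i, j)\<in>UNIV. F j)"

definition joint_law :: "env measure \<Rightarrow> (env \<times> weights) measure" where
  "joint_law P =
     P \<bind> (\<lambda>F. distr (weight_law F) (env_space \<Otimes>\<^sub>M weight_space) (\<lambda>X. (F, X)))"

text \<open>The quenched law is a probability kernel, so the monadic bind defines a genuine joint law.\<close>

lemma measurable_weight_law: "weight_law \<in> env_space \<rightarrow>\<^sub>M prob_algebra weight_space"
proof (rule measurable_prob_algebra_generated)
  show "sets weight_space = sigma_sets (\<Pi>\<^sub>E i\<in>UNIV. space borel) (prod_algebra UNIV (\<lambda>_. borel))"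
    unfolding weight_space_def by (rule sets_PiM)
  show "Int_stable (prod_algebra UNIV (\<lambda>_. borel))" by (rule Int_stable_prod_algebra)
  show "prod_algebra UNIV (\<lambda>_::nat\<times>nat. borel::real measure) \<subseteq> Pow (\<Pi>\<^sub>E i\<in>UNIV. space borel)" by (rule prod_algebra_sets_into_space)
  fix F assume "F \<in> space env_space"
  then have F: "prob_space (F j)" "sets (F j) = sets borel" for j
    by (auto simp: env_space_def space_PiM space_prob_algebra)
  show "prob_space (weight_law F)" unfolding weight_law_def by (rule prob_space_PiM) (use F in auto)
  show "sets (weight_law F) = sets weight_space" unfolding weight_law_def weight_space_def
    by (rule sets_PiM_cong) (use F in auto)
next
  fix A assume "A \<in> prod_algebra UNIV (\<lambda>_::nat\<times>nat. borel::real measure)"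
  then obtain J E where A: "A = prod_emb UNIV (\<lambda>_. borel) J (\<Pi>\<^sub>E j\<in>J. E j)" "finite J" "\<And>i. i \<in> J \<Longrightarrow> E i \<in> sets borel"
    by (rule prod_algebraE) blast
  have *: "emeasure (weight_law F) A = (\<Prod>i\<in>J. emeasure (F (snd i)) (E i))" if "F \<in> space env_space" for F
  proof -
    from that have F: "prob_space (F j)" "sets (F j) = sets borel" for j
      by (auto simp: env_space_def space_PiM space_prob_algebra)
    have s: "space (F j) = UNIV" for j using sets_eq_imp_space_eq[OF F(2)] by simp
    have A': "A = prod_emb UNIV (\<lambda>(i,j). F j) J (\<Pi>\<^sub>E j\<in>J. E j)" unfolding A(1) by (simp add: prod_emb_def s split_beta)
    then show ?thesis unfolding weight_law_def using A F
      by (subst A', subst emeasure_PiM_emb) (auto simp: split_beta)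
  qed
  have "(\<lambda>F. \<Prod>i\<in>J. emeasure (F (snd i)) (E i)) \<in> borel_measurable env_space"
  proof (rule borel_measurable_prod_ennreal)
    fix i assume "i \<in> J"
    have "(\<lambda>F. F (snd i)) \<in> env_space \<rightarrow>\<^sub>M prob_algebra borel" unfolding env_space_def by (rule measurable_component_singleton) simp
    then have "(\<lambda>F. F (snd i)) \<in> env_space \<rightarrow>\<^sub>M subprob_algebra borel" by (rule measurable_prob_algebraD)
    from measurable_compose[OF this measurable_emeasure_subprob_algebra[OF A(3)[OF \<open>i\<in>J\<close>]]]
    show "(\<lambda>F. emeasure (F (snd i)) (E i)) \<in> borel_measurable env_space" .
  qed
  with * show "(\<lambda>F. emeasure (weight_law F) A) \<in> borel_measurable env_space" by (simp cong: measurable_cong)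
qed

lemma measurable_joint_kernel: "(\<lambda>F. distr (weight_law F) (env_space \<Otimes>\<^sub>M weight_space) (\<lambda>X. (F, X))) \<in> env_space \<rightarrow>\<^sub>M prob_algebra (env_space \<Otimes>\<^sub>M weight_space)"
  by (rule measurable_distr_prob_space2[OF measurable_weight_law]) measurable

lemma prob_space_joint_law: "iid_env P \<Longrightarrow> prob_space (joint_law P)"
  unfolding joint_law_def iid_env_def
  by (intro prob_space_bind'[OF _ measurable_joint_kernel]) (auto simp: space_prob_algebra)

section \<open>Last-passage times and the limit shape\<close>

definition lattice_path :: "nat \<times> nat \<Rightarrow> nat \<times> nat \<Rightarrow> (nat \<times> nat) list \<Rightarrow> bool" where
  "lattice_path p q zs \<longleftrightarrow>
     zs \<noteq> [] \<and> hd zs = p \<and> last zs = q \<and>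
     (\<forall>m. Suc m < length zs \<longrightarrow>
        zs ! Suc m = (Suc (fst (zs ! m)), snd (zs ! m)) \<or>
        zs ! Suc m = (fst (zs ! m), Suc (snd (zs ! m))))"

text \<open>The endpoint of the path does not contribute, hence \<^term>\<open>butlast\<close>.\<close>

definition passage_time :: "weights \<Rightarrow> nat \<Rightarrow> nat \<Rightarrow> real" where
  "passage_time X k l =
     Max {\<Sum>z\<leftarrow>butlast zs. X z | zs. lattice_path (0, 0) (k, l) zs}"

definition scaled_passage_time :: "weights \<Rightarrow> real \<Rightarrow> real \<Rightarrow> nat \<Rightarrow> real" where
  "scaled_passage_time X x y n =
     passage_time X (nat \<lfloor>real n * x\<rfloor>) (nat \<lfloor>real n * y\<rfloor>) / real n"

text \<open>
  \<open>\<Psi>\<close> is the deterministic limit of the scaled last-passage times, almost surely and in \<open>L\<^sup>1\<close> with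
  respect to the joint law of environment and weights.  Its values outside the open quadrant are
  irrelevant.
\<close>

definition limit_shape :: "env measure \<Rightarrow> (real \<Rightarrow> real \<Rightarrow> real) \<Rightarrow> bool" where
  "limit_shape P \<Psi> \<longleftrightarrow>
     (\<forall>x>0. \<forall>y>0.
        (AE (F, X) in joint_law P. scaled_passage_time X x y \<longlonglongrightarrow> \<Psi> x y) \<and>
        (\<lambda>n. \<integral>\<^sup>+ (F, X). ennreal \<bar>scaled_passage_time X x y n - \<Psi> x y\<bar> \<partial>joint_law P)
          \<longlonglongrightarrow> 0)"

section \<open>Averaged mean and variance\<close>

definition mean_of :: "real measure \<Rightarrow> real" where
  "mean_of N = (\<integral>x. x \<partial>N)"

definition variance_of :: "real measure \<Rightarrow> real" where
  "variance_of N = (\<integral>x. (x - mean_of N)\<^sup>2 \<partial>N)"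

definition env_mean :: "env measure \<Rightarrow> real" where
  "env_mean P = (\<integral>F. mean_of (F 0) \<partial>P)"

definition env_sd :: "env measure \<Rightarrow> real" where
  "env_sd P = sqrt (\<integral>F. variance_of (F 0) \<partial>P)"

section \<open>Tail assumptions\<close>

text \<open>
  The integrands are nonnegative, so finiteness of the integrals is stated with the nonnegative
  Lebesgue integral.  The functions under the essential supremum take values in the unit interval,
  so their essential supremum in \<^typ>\<open>ennreal\<close> agrees with the one over real levels.
\<close>

definition tail_assumptions :: "env measure \<Rightarrow> bool" where
  "tail_assumptions P \<longleftrightarrow>
     (\<integral>\<^sup>+x\<in>{0..}. ennreal (sqrt (1 - (\<integral>F. cdf (F 0) x \<partial>P))) \<partial>lborel) < \<infinity> \<and>
     (\<integral>\<^sup>+x\<in>{0..}. esssup P (\<lambda>F. ennreal (1 - cdf (F 0) x)) \<partial>lborel) < \<infinity> \<and>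
     (\<integral>\<^sup>+x\<in>{..0}. ennreal (sqrt (\<integral>F. cdf (F 0) x \<partial>P)) \<partial>lborel) < \<infinity> \<and>
     (\<integral>\<^sup>+x\<in>{..0}. esssup P (\<lambda>F. ennreal (cdf (F 0) x)) \<partial>lborel) < \<infinity>"

end

theory Submission
  imports Defs "HOL-Real_Asymp.Real_Asymp"
begin

text \<open>
  A path from the origin to \<open>(\<alpha> n, n)\<close> makes only \<open>\<alpha> n\<close> horizontal steps.  With weights bounded
  by \<open>M\<close> it therefore costs at most \<open>\<alpha> n M\<close> to count a single weight per row, and subtracting the row means
  leaves i.i.d. rows of centered, uncorrelated weights with averaged variance \<open>\<sigma>\<^sup>2\<close>.

  Replacing the maximum by the free energy at inverse temperature \<open>\<beta>\<close> costs \<open>O(n \<alpha> ln (1/\<alpha>) / \<beta>)\<close>, the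
  logarithm of the number of paths.  Given the other rows, the free energy depends on one row
  through the logarithm of an average of \<open>exp (\<beta> X)\<close>, whose expectation is determined by the first
  two moments up to \<open>O(\<beta>\<^sup>3)\<close>.  So all rows may be exchanged for rows of independent fair signs \<open>\<plusminus>\<sigma>\<close>
  at a cost \<open>O(n \<beta>\<^sup>2)\<close>, and \<open>\<beta> = \<alpha> powr (1/3)\<close> gives an error \<open>O(n \<alpha> powr (2/3) ln (1/\<alpha>))\<close>.

  For fair signs the model is solvable.  It is first passage over fair coins, that is, the total output
  of a series of discrete-time queues, and by Burke's theorem a stationary series with departure rate \<open>v\<close>
  has mean output \<open>v\<close> per unit of time.  Varying \<open>v\<close> gives the limit
  \<open>(1 - sqrt \<alpha>)\<^sup>2 / 2\<close> of the first-passage time per row, by convex duality and concentration.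
\<close>

text \<open>Averaged over the environment, the weights of one row are dependent; subtracting the
  random row mean makes them uncorrelated, but no more than that. Fair signs are
  \<open>\<sigma> * (1 - 2 e)\<close> with a coin \<open>e\<close>, so a path that meets N true
  coins collects \<open>\<sigma> * (l - 2 N)\<close>. If f(x) is the limit of the least N per row
  with x columns per row, the answer is \<open>\<sigma> * (1 - 2 f(\<alpha>))\<close>. A queue with
  arrival rate (1 - c)/2 and service rate 1/2 has stationary mean (1 - c)/(2c). The output of the
  series is a minimum over columns, which in the limit reads (1 - c)/2 = min over x of f(x) + x (1 -
  c)/(2c). Inverting this Legendre transform at c = sqrt x gives f(x) = (1 - sqrt x)^2 / 2, hence 1
  - 2 f(\<alpha>) = 2 sqrt \<alpha> - \<alpha>. The mean of a minimum is at most the minimum of the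
  means, so stationarity alone yields only lower bounds on f. The reverse bound needs exponential
  moments on a scale o(l).\<close>

section \<open>Strict-weak last-passage values\<close>

text \<open>
  \<open>swl a k l\<close> is the maximum of \<open>\<Sum>j<l. a j (s j)\<close> over nondecreasing column choices
  \<open>s 0 \<le> \<dots> \<le> s (l - 1) \<le> k\<close>: a path collects one weight per row, and horizontal steps are free.
\<close>

fun swl :: "(nat \<Rightarrow> nat \<Rightarrow> real) \<Rightarrow> nat \<Rightarrow> nat \<Rightarrow> real" where
  "swl a k 0 = 0"
| "swl a 0 (Suc l) = swl a 0 l + a l 0"
| "swl a (Suc k) (Suc l) = max (swl a k (Suc l)) (swl a (Suc k) l + a l (Suc k))"

text \<open>Splitting off the last step, rather than the first, matches the recursion in the
  endpoint \<open>(k, l)\<close>.\<close>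

lemma lattice_path_snoc:
  "lattice_path p q (ys @ [z]) \<longleftrightarrow> z = q \<and> (ys = [] \<and> q = p \<or>
     (\<exists>q'. lattice_path p q' ys \<and> (q = (Suc (fst q'), snd q') \<or> q = (fst q', Suc (snd q')))))"
proof (cases "ys = []")
  case True
  then show ?thesis by (auto simp: lattice_path_def)
next
  case False
  define Q where "Q zs m \<longleftrightarrow> zs ! Suc m = (Suc (fst (zs ! m)), snd (zs ! m)) \<or>
      zs ! Suc m = (fst (zs ! m), Suc (snd (zs ! m)))" for zs :: "(nat \<times> nat) list" and m
  have path: "lattice_path p q zs \<longleftrightarrow> zs \<noteq> [] \<and> hd zs = p \<and> last zs = q \<and>
      (\<forall>m. Suc m < length zs \<longrightarrow> Q zs m)" for p q zs
    by (simp add: lattice_path_def Q_def)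
  have less: "Suc m < length (ys @ [z]) \<longleftrightarrow> Suc m < length ys \<or> m = length ys - 1" for m
    using False by (cases ys) auto
  have Q_init: "Q (ys @ [z]) m \<longleftrightarrow> Q ys m" if "Suc m < length ys" for m
    using that by (simp add: Q_def nth_append)
  have Q_last: "Q (ys @ [z]) (length ys - 1) \<longleftrightarrow>
      z = (Suc (fst (last ys)), snd (last ys)) \<or> z = (fst (last ys), Suc (snd (last ys)))"
    using False by (simp add: Q_def nth_append last_conv_nth)
  have "(\<forall>m. Suc m < length (ys @ [z]) \<longrightarrow> Q (ys @ [z]) m) \<longleftrightarrow>
      (\<forall>m. Suc m < length ys \<longrightarrow> Q ys m) \<and> Q (ys @ [z]) (length ys - 1)"
    unfolding less using Q_init by blast
  then have "lattice_path p q (ys @ [z]) \<longleftrightarrow> z = q \<and> hd ys = p \<and>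
      (\<forall>m. Suc m < length ys \<longrightarrow> Q ys m) \<and>
      (z = (Suc (fst (last ys)), snd (last ys)) \<or> z = (fst (last ys), Suc (snd (last ys))))"
    unfolding path Q_last using False by auto
  then show ?thesis unfolding path using False by auto
qed

definition path_sums :: "weights \<Rightarrow> nat \<Rightarrow> nat \<Rightarrow> real set" where
  "path_sums X k l = {\<Sum>z\<leftarrow>butlast zs. X z | zs. lattice_path (0, 0) (k, l) zs}"

text \<open>The index sets \<open>{k'. Suc k' = k}\<close> are empty or singletons, so one equation
  covers all four boundary cases. The endpoint is not counted, so prolonging a path adds the weight
  of the old endpoint.\<close>

lemma path_sums_eq:
  "path_sums X k l = (if k = 0 \<and> l = 0 then {0} else {})
     \<union> (\<Union>k'\<in>{k'. Suc k' = k}. (\<lambda>t. t + X (k', l)) ` path_sums X k' l)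
     \<union> (\<Union>l'\<in>{l'. Suc l' = l}. (\<lambda>t. t + X (k, l')) ` path_sums X k l')"
    (is "_ = ?R")
proof (intro set_eqI iffI)
  have sum_last: "(\<Sum>z\<leftarrow>ys. X z) = (\<Sum>z\<leftarrow>butlast ys. X z) + X q"
    if "lattice_path (0, 0) q ys" for q ys
  proof -
    have "ys = butlast ys @ [q]" using that by (metis append_butlast_last_id lattice_path_def)
    then have "(\<Sum>z\<leftarrow>ys. X z) = (\<Sum>z\<leftarrow>butlast ys @ [q]. X z)" by simp
    then show ?thesis by simp
  qed
  fix t
  {
    assume "t \<in> path_sums X k l"
    then obtain zs where zs: "lattice_path (0, 0) (k, l) zs" "t = (\<Sum>z\<leftarrow>butlast zs. X z)"
      by (auto simp: path_sums_def)
    then obtain ys z where ys: "zs = ys @ [z]"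
      by (metis append_butlast_last_id lattice_path_def)
    consider "ys = []" "k = 0" "l = 0"
      | q where "lattice_path (0, 0) q ys" "k = Suc (fst q)" "l = snd q"
      | q where "lattice_path (0, 0) q ys" "k = fst q" "l = Suc (snd q)"
      using zs(1) unfolding ys lattice_path_snoc by auto
    then show "t \<in> ?R"
    proof cases
      case 1
      then show ?thesis using zs ys by auto
    next
      case 2
      then have "t = (\<Sum>z\<leftarrow>butlast ys. X z) + X (fst q, snd q)"
        using zs(2) ys sum_last[OF 2(1)] by simp
      moreover have "(\<Sum>z\<leftarrow>butlast ys. X z) \<in> path_sums X (fst q) (snd q)"
        using 2 unfolding path_sums_def by auto
      ultimately show ?thesis using 2 by auto
    next
      case 3
      then have "t = (\<Sum>z\<leftarrow>butlast ys. X z) + X (fst q, snd q)"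
        using zs(2) ys sum_last[OF 3(1)] by simp
      moreover have "(\<Sum>z\<leftarrow>butlast ys. X z) \<in> path_sums X (fst q) (snd q)"
        using 3 unfolding path_sums_def by auto
      ultimately show ?thesis using 3 by auto
    qed
  next
    assume "t \<in> ?R"
    then consider "k = 0" "l = 0" "t = 0"
      | k' s where "k = Suc k'" "s \<in> path_sums X k' l" "t = s + X (k', l)"
      | l' s where "l = Suc l'" "s \<in> path_sums X k l'" "t = s + X (k, l')"
      by (auto split: if_splits)
    then show "t \<in> path_sums X k l"
    proof cases
      case 1
      have "lattice_path (0, 0) (0, 0) ([] @ [(0, 0)])" unfolding lattice_path_snoc by simp
      then show ?thesis using 1 by (force simp: path_sums_def)
    next
      case 2
      then obtain ys where ys: "lattice_path (0, 0) (k', l) ys" "s = (\<Sum>z\<leftarrow>butlast ys. X z)"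
        by (auto simp: path_sums_def)
      then have "lattice_path (0, 0) (k, l) (ys @ [(k, l)])" "t = (\<Sum>z\<leftarrow>butlast (ys @ [(k, l)]). X z)"
        using 2 sum_last[OF ys(1)] by (auto simp: lattice_path_snoc)
      then show ?thesis unfolding path_sums_def by blast
    next
      case 3
      then obtain ys where ys: "lattice_path (0, 0) (k, l') ys" "s = (\<Sum>z\<leftarrow>butlast ys. X z)"
        by (auto simp: path_sums_def)
      then have "lattice_path (0, 0) (k, l) (ys @ [(k, l)])" "t = (\<Sum>z\<leftarrow>butlast (ys @ [(k, l)]). X z)"
        using 3 sum_last[OF ys(1)] by (auto simp: lattice_path_snoc)
      then show ?thesis unfolding path_sums_def by blast
    qed
  }
qed

lemma path_sums_simps:
  "path_sums X 0 0 = {0}"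
  "path_sums X (Suc k) 0 = (\<lambda>t. t + X (k, 0)) ` path_sums X k 0"
  "path_sums X 0 (Suc l) = (\<lambda>t. t + X (0, l)) ` path_sums X 0 l"
  "path_sums X (Suc k) (Suc l) =
     (\<lambda>t. t + X (k, Suc l)) ` path_sums X k (Suc l) \<union> (\<lambda>t. t + X (Suc k, l)) ` path_sums X (Suc k) l"
  by (subst path_sums_eq; simp)+

lemma path_sums_finite: "finite (path_sums X k l) \<and> path_sums X k l \<noteq> {}"
proof (induction k arbitrary: l)
  case 0
  show ?case by (induction l) (auto simp: path_sums_simps)
next
  case (Suc k)
  show ?case by (induction l) (use Suc in \<open>auto simp: path_sums_simps\<close>)
qed

lemma Max_add_image:
  fixes S :: "real set"
  assumes "finite S" "S \<noteq> {}"
  shows "Max ((\<lambda>t. t + c) ` S) = Max S + c"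
  using mono_Max_commute[of "\<lambda>t. t + c" S] assms by (simp add: monoI)

lemma passage_time_simps:
  "passage_time X 0 0 = 0"
  "passage_time X (Suc k) 0 = passage_time X k 0 + X (k, 0)"
  "passage_time X 0 (Suc l) = passage_time X 0 l + X (0, l)"
  "passage_time X (Suc k) (Suc l) =
     max (passage_time X k (Suc l) + X (k, Suc l)) (passage_time X (Suc k) l + X (Suc k, l))"
  unfolding passage_time_def path_sums_def[symmetric] path_sums_simps
  using path_sums_finite by (simp_all add: Max_add_image Max_Un)

text \<open>The two recursions differ only in the weight that \<open>passage_time\<close> adds at a
  horizontal step, and a path makes \<open>k\<close> such steps.\<close>

lemma passage_time_near_swl:
  assumes "\<And>z. \<bar>X z\<bar> \<le> M"
  shows "\<bar>passage_time X k l - swl (\<lambda>j i. X (i, j)) k l\<bar> \<le> real k * M"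
proof (induction k arbitrary: l)
  case 0
  show ?case by (induction l) (auto simp: passage_time_simps)
next
  case (Suc k)
  note IH = Suc.IH
  show ?case
  proof (induction l)
    case 0
    show ?case using IH[of 0] assms[of "(k, 0)"] by (simp add: passage_time_simps algebra_simps)
  next
    case (Suc l')
    have "\<bar>passage_time X k (Suc l') - swl (\<lambda>j i. X (i, j)) k (Suc l')\<bar> \<le> real k * M"
      by (rule IH)
    moreover have "\<bar>max (p + x) (p' + y) - max s (s' + y)\<bar> \<le> u + M"
      if "\<bar>p - s\<bar> \<le> u" "\<bar>p' - s'\<bar> \<le> u + M" "\<bar>x\<bar> \<le> M" for p p' s s' x y u :: real
      using that by linarith
    ultimately show ?case
      using assms[of "(k, Suc l')"] \<open>\<bar>passage_time X (Suc k) l' - _\<bar> \<le> _\<close>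
      by (simp add: passage_time_simps algebra_simps)
  qed
qed

lemma swl_mult:
  assumes "c \<ge> 0"
  shows "swl (\<lambda>j i. c * a j i) k l = c * swl a k l"
proof (induction a k l rule: swl.induct)
  case (2 a l)
  then show ?case by (simp add: distrib_left)
next
  case (3 a k l)
  have "c * max x y = max (c * x) (c * y)" for x y :: real
    using assms mult_left_mono[of x y c] mult_left_mono[of y x c] by (auto simp: max_def)
  then show ?case using 3 by (simp add: distrib_left)
qed simp

text \<open>Every choice of columns takes exactly one weight per row, so row constants such as the
  row means leave the maximum.\<close>

lemma swl_add_row: "swl (\<lambda>j i. a j i + b j) k l = swl a k l + (\<Sum>j<l. b j)"
proof (induction a k l rule: swl.induct)
  case (3 a k l)
  have "max (x + z) (y + z) = max x y + z" for x y z :: real by (auto simp: max_def)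
  from this[of "swl a k (Suc l)" "(\<Sum>j<Suc l. b j)" "swl a (Suc k) l + a l (Suc k)"] 3
  show ?case by (simp add: add.assoc add.left_commute add.commute)
qed simp_all

lemma swl_cong:
  assumes "\<And>i j. i \<le> k \<Longrightarrow> j < l \<Longrightarrow> a j i = b j i"
  shows "swl a k l = swl b k l"
  using assms by (induction a k l rule: swl.induct) simp_all

lemma abs_swl_le:
  assumes "\<And>i j. \<bar>a j i\<bar> \<le> M"
  shows "\<bar>swl a k l\<bar> \<le> real l * M"
  using assms
proof (induction a k l rule: swl.induct)
  case (2 a l)
  show ?case using 2(1)[OF 2(2)] 2(2)[of l 0] by (simp add: algebra_simps abs_le_iff)
next
  case (3 a k l)
  show ?case using 3(1)[OF 3(3)] 3(2)[OF 3(3)] 3(3)[of l "Suc k"]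
    by (simp add: algebra_simps abs_le_iff max_def)
qed simp

section \<open>Partition functions and the entropy of column choices\<close>

fun partition_fun :: "(nat \<Rightarrow> nat \<Rightarrow> real) \<Rightarrow> nat \<Rightarrow> nat \<Rightarrow> real" where
  "partition_fun a k 0 = 1"
| "partition_fun a 0 (Suc l) = partition_fun a 0 l * exp (a l 0)"
| "partition_fun a (Suc k) (Suc l) =
     partition_fun a k (Suc l) + partition_fun a (Suc k) l * exp (a l (Suc k))"

lemma exp_swl_le_partition_fun: "exp (swl a k l) \<le> partition_fun a k l"
proof (induction a k l rule: swl.induct)
  case (3 a k l)
  have "exp (swl a (Suc k) (Suc l)) \<le> exp (swl a k (Suc l)) + exp (swl a (Suc k) l) * exp (a l (Suc k))"
    by (simp add: max_def exp_add)
  also have "\<dots> \<le> partition_fun a (Suc k) (Suc l)"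
    using 3 by (simp add: add_mono mult_right_mono)
  finally show ?case .
qed (auto simp: exp_add)

text \<open>The prefactor dominates the number of column choices, a binomial coefficient: it passes
  through the Pascal recursion because 1/q + 1/(1 - q) = 1/(q (1 - q)). The parameter
  \<open>q\<close> stays free until it is set to \<alpha>, which makes the entropy per row of order
  \<alpha> ln(1/\<alpha>).\<close>

lemma partition_fun_le:
  assumes "0 < q" "q < 1"
  shows "partition_fun a k l \<le> (1 / q) ^ k * (1 / (1 - q)) ^ l * exp (swl a k l)"
proof (induction a k l rule: swl.induct)
  case (1 a k)
  show ?case using assms by simp
next
  case (2 a l)
  have "partition_fun a 0 (Suc l) \<le> ((1 / (1 - q)) ^ l * exp (swl a 0 l)) * exp (a l 0)"
    using 2 by (simp add: mult_right_mono)
  also have "\<dots> \<le> (1 / (1 - q)) * (((1 / (1 - q)) ^ l * exp (swl a 0 l)) * exp (a l 0))"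
    using assms by (intro mult_le_cancel_right1[THEN iffD2]) (auto simp: not_less)
  finally show ?case by (simp add: exp_add mult_ac)
next
  case (3 a k l)
  define C where "C = (1 / q) ^ k * (1 / (1 - q)) ^ l"
  define m where "m = swl a (Suc k) (Suc l)"
  have C: "C \<ge> 0" using assms by (simp add: C_def)
  have "partition_fun a (Suc k) (Suc l) \<le>
      C / (1 - q) * exp (swl a k (Suc l)) + C / q * exp (swl a (Suc k) l) * exp (a l (Suc k))"
  proof -
    have "partition_fun a (Suc k) l \<le> C / q * exp (swl a (Suc k) l)"
      using 3 by (simp add: C_def mult_ac)
    then have "partition_fun a (Suc k) l * exp (a l (Suc k)) \<le>
        C / q * exp (swl a (Suc k) l) * exp (a l (Suc k))"
      by (rule mult_right_mono) simp
    moreover have "partition_fun a k (Suc l) \<le> C / (1 - q) * exp (swl a k (Suc l))"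
      using 3 by (simp add: C_def mult_ac)
    ultimately show ?thesis by simp
  qed
  also have "\<dots> = C / (1 - q) * exp (swl a k (Suc l)) + C / q * exp (swl a (Suc k) l + a l (Suc k))"
    by (simp add: exp_add)
  also have "\<dots> \<le> C / (1 - q) * exp m + C / q * exp m"
    using assms C by (intro add_mono mult_left_mono) (auto simp: m_def)
  also have "\<dots> = C / (q * (1 - q)) * exp m"
    using assms by (simp add: field_simps)
  finally show ?case by (simp add: C_def m_def)
qed

lemma ln_partition_fun:
  assumes "0 < q" "q < 1"
  shows "swl a k l \<le> ln (partition_fun a k l)"
    and "ln (partition_fun a k l) \<le> swl a k l + k * ln (1 / q) + l * ln (1 / (1 - q))"
proof -
  have pos: "partition_fun a k l > 0"
    using exp_swl_le_partition_fun[of a k l] exp_gt_zero less_le_trans by blast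
  show "swl a k l \<le> ln (partition_fun a k l)"
    using exp_swl_le_partition_fun[of a k l] pos by (simp add: ln_ge_iff)
  have "ln (partition_fun a k l) \<le> ln ((1 / q) ^ k * (1 / (1 - q)) ^ l * exp (swl a k l))"
    using partition_fun_le[OF assms, of a k l] pos by (subst ln_le_cancel_iff) auto
  also have "\<dots> = swl a k l + k * ln (1 / q) + l * ln (1 / (1 - q))"
    using assms by (simp add: ln_mult ln_realpow)
  finally show "ln (partition_fun a k l) \<le> swl a k l + k * ln (1 / q) + l * ln (1 / (1 - q))" .
qed

text \<open>One list of choices serves all weights, so the environment and the coins can be compared
  over the same index set. A list needs no proof that the choices are distinct.\<close>

lemma partition_fun_as_sum:
  "\<exists>ps :: (nat \<Rightarrow> nat) list. ps \<noteq> [] \<and> (\<forall>s\<in>set ps. \<forall>j. s j \<le> k) \<and>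
     (\<forall>a. partition_fun a k l = (\<Sum>s\<leftarrow>ps. exp (\<Sum>j<l. a j (s j))))"
proof (induction k arbitrary: l)
  case 0
  have "partition_fun a 0 l = exp (\<Sum>j<l. a j 0)" for a
    by (induction l) (auto simp: exp_add)
  then show ?case by (intro exI[of _ "[\<lambda>_. 0]"]) simp
next
  case (Suc k)
  show ?case
  proof (induction l)
    case 0
    show ?case by (intro exI[of _ "[\<lambda>_. 0]"]) simp
  next
    case (Suc l)
    obtain ps where ps: "ps \<noteq> []" "\<forall>s\<in>set ps. \<forall>j. s j \<le> k"
        "\<And>a. partition_fun a k (Suc l) = (\<Sum>s\<leftarrow>ps. exp (\<Sum>j<Suc l. a j (s j)))"
      using \<open>\<And>l. \<exists>ps. ps \<noteq> [] \<and> (\<forall>s\<in>set ps. \<forall>j. s j \<le> k) \<and> _ ps l\<close>[of "Suc l"] by blast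
    obtain rs where rs: "rs \<noteq> []" "\<forall>s\<in>set rs. \<forall>j. s j \<le> Suc k"
        "\<And>a. partition_fun a (Suc k) l = (\<Sum>s\<leftarrow>rs. exp (\<Sum>j<l. a j (s j)))"
      using Suc by blast
    show ?case
    proof (intro exI[of _ "ps @ map (\<lambda>s. s(l := Suc k)) rs"] conjI allI ballI)
      show "ps @ map (\<lambda>s. s(l := Suc k)) rs \<noteq> []" using ps by simp
    next
      fix s j assume "s \<in> set (ps @ map (\<lambda>s. s(l := Suc k)) rs)"
      then show "s j \<le> Suc k" using ps(2) rs(2) by (auto intro: le_SucI)
    next
      fix a :: "nat \<Rightarrow> nat \<Rightarrow> real"
      have "(\<Sum>s\<leftarrow>rs. exp (\<Sum>j<l. a j (s j))) * exp (a l (Suc k)) =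
          (\<Sum>s\<leftarrow>map (\<lambda>s. s(l := Suc k)) rs. exp (\<Sum>j<Suc l. a j (s j)))"
        by (simp add: sum_list_mult_const[symmetric] exp_add o_def)
      then show "partition_fun a (Suc k) (Suc l) =
          (\<Sum>s\<leftarrow>ps @ map (\<lambda>s. s(l := Suc k)) rs. exp (\<Sum>j<Suc l. a j (s j)))"
        using ps(3) rs(3) by simp
    qed
  qed
qed

section \<open>Second-order comparison of free energies\<close>

lemma exp_cubic_bound:
  fixes x :: real
  assumes "\<bar>x\<bar> \<le> 1"
  shows "\<bar>exp x - 1 - x - x\<^sup>2 / 2\<bar> \<le> \<bar>x\<bar> ^ 3"
proof -
  obtain t where t: "\<bar>t\<bar> \<le> \<bar>x\<bar>" "exp x = (\<Sum>m<3. x ^ m / fact m) + exp t / fact 3 * x ^ 3"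
    using Maclaurin_exp_le[of x 3] by blast
  have "exp t \<le> exp 1" using t assms by simp
  also have "\<dots> \<le> 3" by (rule exp_le)
  finally have "exp t / 6 * \<bar>x\<bar> ^ 3 \<le> 1 * \<bar>x\<bar> ^ 3"
    by (intro mult_right_mono) auto
  moreover have "exp x - 1 - x - x\<^sup>2 / 2 = exp t / 6 * x ^ 3"
    using t(2) by (simp add: lessThan_nat_numeral fact_numeral power2_eq_square)
  then have "\<bar>exp x - 1 - x - x\<^sup>2 / 2\<bar> = exp t / 6 * \<bar>x\<bar> ^ 3"
    by (simp only: abs_mult power_abs) simp
  ultimately show ?thesis by simp
qed



lemma ln_cubic_bound:
  fixes y :: real
  assumes "\<bar>y\<bar> \<le> 1/2"
  shows "\<bar>ln (1 + y) - y + y\<^sup>2 / 2\<bar> \<le> 3 * \<bar>y\<bar> ^ 3"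
proof -
  \<comment> \<open>The function and its three derivatives, in the form that the Maclaurin theorem
    expects.\<close>
  define f where "f m t = (if m = 0 then ln (1 + t) else if m = 1 then inverse (1 + t)
      else if m = 2 then - ((inverse (1 + t)) ^ 2) else 2 * (inverse (1 + t)) ^ 3)" for m :: nat and t :: real
  have deriv: "(f m has_real_derivative f (Suc m) t) (at t)" if "m < 3" "\<bar>t\<bar> \<le> \<bar>y\<bar>" for m t
  proof -
    have pos: "1 + t > 0" using that assms by linarith
    consider "m = 0" | "m = 1" | "m = 2" using \<open>m < 3\<close> by linarith
    then show ?thesis
    proof cases
      case 1
      then show ?thesis unfolding f_def using pos
        by (auto intro!: derivative_eq_intros simp: inverse_eq_divide)
    next
      case 2
      then show ?thesis unfolding f_def using pos
        by (auto intro!: derivative_eq_intros simp: power2_eq_square)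
    next
      case 3
      have "((\<lambda>t. - ((inverse (1 + t)) ^ 2)) has_real_derivative 2 * (inverse (1 + t)) ^ 3) (at t)"
        using pos by (auto intro!: derivative_eq_intros simp: power2_eq_square power3_eq_cube)
      then show ?thesis using 3 by (simp add: f_def[abs_def])
    qed
  qed
  obtain t where t: "\<bar>t\<bar> \<le> \<bar>y\<bar>" "f 0 y = (\<Sum>m<3. f m 0 / fact m * y ^ m) + f 3 t / fact 3 * y ^ 3"
    using Maclaurin_bi_le[of f "f 0" 3 y] deriv by blast
  \<comment> \<open>The remainder coefficient is 1/(3 (1 + t)^3), which is at most 8/3 for 1 + t
    \<ge> 1/2.\<close>
  have "1 + t \<ge> 1 / 2" using t assms by linarith
  then have "(1 / 2) ^ 3 \<le> (1 + t) ^ 3" by (intro power_mono) auto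
  then have "1 \<le> 9 * (1 + t) ^ 3" "(1 + t) ^ 3 > 0" by (auto simp: power3_eq_cube)
  then have le: "\<bar>f 3 t / fact 3\<bar> \<le> 3"
    by (simp add: f_def fact_numeral divide_simps power_inverse)
  have "ln (1 + y) - y + y\<^sup>2 / 2 = f 3 t / fact 3 * y ^ 3"
    using t(2) by (simp add: lessThan_nat_numeral f_def)
  then have "\<bar>ln (1 + y) - y + y\<^sup>2 / 2\<bar> = \<bar>f 3 t / fact 3\<bar> * \<bar>y\<bar> ^ 3"
    by (simp add: abs_mult power_abs)
  also have "\<dots> \<le> 3 * \<bar>y\<bar> ^ 3" using le by (rule mult_right_mono) simp
  finally show ?thesis .
qed

text \<open>A cumulant expansion: mean plus half the variance of \<open>x\<close> under the weights
  \<open>p\<close>, with cubic remainder. The bound \<open>b \<le> 1/4\<close> gives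
  \<open>\<bar>y\<bar> \<le> 2 * b \<le> 1/2\<close>, the range of
  \<open>ln_cubic_bound\<close>.\<close>

lemma ln_sum_exp_expansion:
  fixes p x :: "'a \<Rightarrow> real"
  assumes "\<And>s. s \<in> S \<Longrightarrow> p s \<ge> 0" and p1: "(\<Sum>s\<in>S. p s) = 1"
    and x: "\<And>s. s \<in> S \<Longrightarrow> \<bar>x s\<bar> \<le> b" and b: "b \<le> 1/4"
  defines "m\<^sub>1 \<equiv> \<Sum>s\<in>S. p s * x s" and "m\<^sub>2 \<equiv> \<Sum>s\<in>S. p s * (x s)\<^sup>2"
  shows "\<bar>ln (\<Sum>s\<in>S. p s * exp (x s)) - (m\<^sub>1 + m\<^sub>2 / 2 - m\<^sub>1\<^sup>2 / 2)\<bar> \<le> 30 * b ^ 3"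
proof -
  have avg: "\<bar>\<Sum>s\<in>S. p s * f s\<bar> \<le> C" if "\<And>s. s \<in> S \<Longrightarrow> \<bar>f s\<bar> \<le> C" for f C
  proof -
    have "\<bar>\<Sum>s\<in>S. p s * f s\<bar> \<le> (\<Sum>s\<in>S. \<bar>p s * f s\<bar>)" by (rule sum_abs)
    also have "\<dots> \<le> (\<Sum>s\<in>S. p s * C)"
      using that assms(1) by (intro sum_mono) (auto simp: abs_mult intro: mult_left_mono)
    also have "\<dots> = C" using p1 by (simp add: sum_distrib_right[symmetric])
    finally show ?thesis .
  qed
  obtain s\<^sub>0 where "s\<^sub>0 \<in> S" using p1 by (metis all_not_in_conv sum.empty zero_neq_one)
  then have b0: "b \<ge> 0" using x[of s\<^sub>0] by linarith
  define y where "y = (\<Sum>s\<in>S. p s * (exp (x s) - 1))"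
  have exp_sum: "(\<Sum>s\<in>S. p s * exp (x s)) = 1 + y"
    unfolding y_def using p1 by (simp add: algebra_simps sum_subtractf)
  have m1: "\<bar>m\<^sub>1\<bar> \<le> b" unfolding m\<^sub>1_def by (rule avg) (rule x)
  have m2: "\<bar>m\<^sub>2\<bar> \<le> b\<^sup>2" unfolding m\<^sub>2_def
    by (rule avg) (use x b0 in \<open>auto simp: abs_le_square_iff[symmetric]\<close>)
  have "\<bar>\<Sum>s\<in>S. p s * (exp (x s) - 1 - x s - (x s)\<^sup>2 / 2)\<bar> \<le> b ^ 3"
  proof (rule avg)
    fix s assume "s \<in> S"
    then have "\<bar>x s\<bar> \<le> b" by (rule x)
    moreover from this have "\<bar>exp (x s) - 1 - x s - (x s)\<^sup>2 / 2\<bar> \<le> \<bar>x s\<bar> ^ 3"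
      using b by (intro exp_cubic_bound) linarith
    ultimately show "\<bar>exp (x s) - 1 - x s - (x s)\<^sup>2 / 2\<bar> \<le> b ^ 3"
      by (meson abs_ge_zero order_trans power_mono)
  qed
  also have "(\<Sum>s\<in>S. p s * (exp (x s) - 1 - x s - (x s)\<^sup>2 / 2)) = y - m\<^sub>1 - m\<^sub>2 / 2"
    by (simp add: y_def m\<^sub>1_def m\<^sub>2_def algebra_simps sum_subtractf sum.distrib sum_divide_distrib)
  finally have y: "\<bar>y - m\<^sub>1 - m\<^sub>2 / 2\<bar> \<le> b ^ 3" .
  have b23: "b\<^sup>2 \<le> b / 4" "b ^ 3 \<le> b\<^sup>2 / 4"
    using b b0 mult_left_mono[of b "1/4" b] mult_left_mono[of b "1/4" "b\<^sup>2"]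
    by (auto simp: power2_eq_square power3_eq_cube)
  have y_m1: "\<bar>y - m\<^sub>1\<bar> \<le> b\<^sup>2" using y m2 b23 by (simp add: abs_le_iff)
  have y2b: "\<bar>y\<bar> \<le> 2 * b" using y_m1 m1 b23 b0 by linarith
  then have "\<bar>y\<bar> \<le> 1 / 2" using b by linarith
  then have "\<bar>ln (1 + y) - y + y\<^sup>2 / 2\<bar> \<le> 3 * \<bar>y\<bar> ^ 3" by (rule ln_cubic_bound)
  also have "\<dots> \<le> 3 * (2 * b) ^ 3" using y2b by (intro mult_left_mono power_mono) auto
  finally have ln: "\<bar>ln (1 + y) - y + y\<^sup>2 / 2\<bar> \<le> 24 * b ^ 3" by (simp add: power_mult_distrib)
  have "\<bar>y\<^sup>2 - m\<^sub>1\<^sup>2\<bar> = \<bar>y - m\<^sub>1\<bar> * \<bar>y + m\<^sub>1\<bar>"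
    by (simp add: abs_mult[symmetric] power2_eq_square algebra_simps)
  also have "\<dots> \<le> b\<^sup>2 * (3 * b)" using y_m1 y2b m1 b0 by (intro mult_mono) auto
  finally have "\<bar>y\<^sup>2 - m\<^sub>1\<^sup>2\<bar> \<le> 3 * b ^ 3" by (simp add: power2_eq_square power3_eq_cube)
  moreover have "\<bar>ln (1 + y) - (m\<^sub>1 + m\<^sub>2 / 2 - m\<^sub>1\<^sup>2 / 2)\<bar> \<le> 24 * B + B + 3 * B"
    if "\<bar>y\<^sup>2 - m\<^sub>1\<^sup>2\<bar> \<le> 3 * B" "\<bar>ln (1 + y) - y + y\<^sup>2 / 2\<bar> \<le> 24 * B" "\<bar>y - m\<^sub>1 - m\<^sub>2 / 2\<bar> \<le> B" for B
    using that by (simp add: abs_le_iff)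
  ultimately have "\<bar>ln (1 + y) - (m\<^sub>1 + m\<^sub>2 / 2 - m\<^sub>1\<^sup>2 / 2)\<bar> \<le> 28 * b ^ 3"
    using ln y by fastforce
  also have "\<dots> \<le> 30 * b ^ 3" using b0 by simp
  finally show ?thesis unfolding exp_sum .
qed

lemma finite_set_replicate_pmf: "finite (set_pmf p) \<Longrightarrow> finite (set_pmf (replicate_pmf n p))"
  using finite_lists_length_eq[of "set_pmf p" n]
  by (simp add: set_replicate_pmf lists_eq_set conj_commute)

lemma expectation_replicate_pmf_Suc:
  fixes f :: "'a list \<Rightarrow> real"
  assumes "finite (set_pmf p)"
  shows "measure_pmf.expectation (replicate_pmf (Suc n) p) f =
    measure_pmf.expectation p (\<lambda>x. measure_pmf.expectation (replicate_pmf n p) (\<lambda>xs. f (x # xs)))"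
proof -
  have "replicate_pmf (Suc n) p = p \<bind> (\<lambda>x. map_pmf (Cons x) (replicate_pmf n p))"
    by (simp add: map_pmf_def)
  then show ?thesis
    using assms finite_set_replicate_pmf[OF assms]
    by (simp add: pmf_expectation_bind[of "set_pmf p"] integral_measure_pmf[of "set_pmf p"])
qed

text \<open>Only pairwise covariances are prescribed, since a row of the environment is merely
  uncorrelated after averaging. The abstract sample space covers both infinite rows of weights and
  finite lists of coins; the cut at \<open>k\<close> is for the latter.\<close>

definition centered_row :: "'a measure \<Rightarrow> (nat \<Rightarrow> 'a \<Rightarrow> real) \<Rightarrow> nat \<Rightarrow> real \<Rightarrow> real \<Rightarrow> bool" where
  "centered_row N Y k B v \<longleftrightarrow> prob_space N \<and>
     (\<forall>i\<le>k. Y i \<in> borel_measurable N \<and> (AE \<omega> in N. \<bar>Y i \<omega>\<bar> \<le> B) \<and> (\<integral>\<omega>. Y i \<omega> \<partial>N) = 0) \<and>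
     (\<forall>i\<le>k. \<forall>i'\<le>k. (\<integral>\<omega>. Y i \<omega> * Y i' \<omega> \<partial>N) = (if i = i' then v else 0))"

text \<open>This is the second-order expansion under the Gibbs weights c s / C. Centering kills the
  linear term, and uncorrelatedness leaves \<open>v\<close> times one minus the probability that two
  independent Gibbs samples use the same column. The main term depends on the law of the row only
  through \<open>v\<close>, which is what permits the exchange.\<close>

lemma centered_row_integral_ln:
  fixes c :: "'s \<Rightarrow> real" and h :: "'s \<Rightarrow> nat"
  assumes row: "centered_row N Y k B v"
    and S: "finite S" "S \<noteq> {}" and c: "\<And>s. s \<in> S \<Longrightarrow> c s > 0" and h: "\<And>s. s \<in> S \<Longrightarrow> h s \<le> k"
    and \<beta>: "\<beta> \<ge> 0" "\<beta> * B \<le> 1/4"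
  defines "C \<equiv> \<Sum>s\<in>S. c s"
  shows "\<bar>(\<integral>\<omega>. ln (\<Sum>s\<in>S. c s * exp (\<beta> * Y (h s) \<omega>)) \<partial>N) -
     (ln C + \<beta>\<^sup>2 * v / 2 * (1 - (\<Sum>s\<in>S. \<Sum>t\<in>S. c s / C * (c t / C) * (if h s = h t then 1 else 0))))\<bar>
     \<le> 30 * (\<beta> * B) ^ 3"
proof -
  interpret prob_space N using row by (simp add: centered_row_def)
  have meas [measurable]: "Y (h s) \<in> borel_measurable N" if "s \<in> S" for s
    using row h[OF that] by (simp add: centered_row_def)
  have bdd: "AE \<omega> in N. \<forall>s\<in>S. \<bar>Y (h s) \<omega>\<bar> \<le> B"
    by (rule AE_finite_allI[OF S(1)]) (use row h in \<open>simp add: centered_row_def\<close>)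
  have C: "C > 0" unfolding C_def using S c by (intro sum_pos) auto
  define p where "p s = c s / C" for s
  have p0: "p s > 0" if "s \<in> S" for s using c[OF that] C by (simp add: p_def)
  have p1: "(\<Sum>s\<in>S. p s) = 1"
    unfolding p_def using C by (simp add: sum_divide_distrib[symmetric] C_def[symmetric])
  have ln_eq: "ln (\<Sum>s\<in>S. c s * exp (\<beta> * Y (h s) \<omega>)) = ln C + ln (\<Sum>s\<in>S. p s * exp (\<beta> * Y (h s) \<omega>))" for \<omega>
  proof -
    have "(\<Sum>s\<in>S. c s * exp (\<beta> * Y (h s) \<omega>)) = C * (\<Sum>s\<in>S. p s * exp (\<beta> * Y (h s) \<omega>))"
      using C by (simp add: p_def sum_distrib_left)
    moreover have "(\<Sum>s\<in>S. p s * exp (\<beta> * Y (h s) \<omega>)) > 0"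
      using S p0 by (intro sum_pos) auto
    ultimately show ?thesis using C by (simp add: ln_mult)
  qed
  define Q where "Q \<omega> = (\<Sum>s\<in>S. p s * (\<beta> * Y (h s) \<omega>)) + (\<Sum>s\<in>S. p s * (\<beta> * Y (h s) \<omega>)\<^sup>2) / 2
      - (\<Sum>s\<in>S. p s * (\<beta> * Y (h s) \<omega>))\<^sup>2 / 2" for \<omega>
  have near: "AE \<omega> in N. \<bar>ln (\<Sum>s\<in>S. c s * exp (\<beta> * Y (h s) \<omega>)) - (ln C + Q \<omega>)\<bar> \<le> 30 * (\<beta> * B) ^ 3"
    using bdd
  proof eventually_elim
    case (elim \<omega>)
    have "\<bar>ln (\<Sum>s\<in>S. p s * exp (\<beta> * Y (h s) \<omega>)) - Q \<omega>\<bar> \<le> 30 * (\<beta> * B) ^ 3"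
      unfolding Q_def
      by (rule ln_sum_exp_expansion)
         (use elim p0 p1 \<beta> in \<open>auto simp: abs_mult less_imp_le intro!: mult_left_mono\<close>)
    then show ?case unfolding ln_eq by simp
  qed
  have int1: "integrable N (Y (h s))" if "s \<in> S" for s
    by (rule integrable_const_bound[of _ B]) (use bdd that in \<open>auto elim: eventually_mono\<close>)
  have int2: "integrable N (\<lambda>\<omega>. Y (h s) \<omega> * Y (h t) \<omega>)" if "s \<in> S" "t \<in> S" for s t
  proof (rule integrable_const_bound[of _ "B * B"])
    show "AE \<omega> in N. norm (Y (h s) \<omega> * Y (h t) \<omega>) \<le> B * B"
      using bdd
    proof eventually_elim
      case (elim \<omega>)
      then have "\<bar>Y (h s) \<omega>\<bar> \<le> B" "\<bar>Y (h t) \<omega>\<bar> \<le> B" using that by auto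
      then show ?case by (simp add: abs_mult mult_mono')
    qed
  qed (use that in measurable)
  have sq1: "p s * (\<beta> * Y (h s) \<omega>)\<^sup>2 = p s * \<beta>\<^sup>2 * (Y (h s) \<omega> * Y (h s) \<omega>)" for s \<omega>
    by (simp add: power2_eq_square)
  have sq2: "(\<Sum>s\<in>S. p s * (\<beta> * Y (h s) \<omega>))\<^sup>2 =
      (\<Sum>s\<in>S. \<Sum>t\<in>S. (p s * p t * \<beta>\<^sup>2) * (Y (h s) \<omega> * Y (h t) \<omega>))" for \<omega>
    unfolding power2_eq_square sum_product by (simp add: mult_ac)
  have Q_eq: "Q = (\<lambda>\<omega>. (\<Sum>s\<in>S. p s * (\<beta> * Y (h s) \<omega>)) +
      (\<Sum>s\<in>S. p s * \<beta>\<^sup>2 * (Y (h s) \<omega> * Y (h s) \<omega>)) / 2 -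
      (\<Sum>s\<in>S. \<Sum>t\<in>S. (p s * p t * \<beta>\<^sup>2) * (Y (h s) \<omega> * Y (h t) \<omega>)) / 2)"
    unfolding Q_def sq1 sq2 ..
  have intQ: "integrable N Q"
    unfolding Q_eq using int1 int2 by auto
  have "(\<integral>\<omega>. Q \<omega> \<partial>N) = (\<Sum>s\<in>S. p s * (\<beta> * (\<integral>\<omega>. Y (h s) \<omega> \<partial>N))) +
      (\<Sum>s\<in>S. p s * \<beta>\<^sup>2 * (\<integral>\<omega>. Y (h s) \<omega> * Y (h s) \<omega> \<partial>N)) / 2 -
      (\<Sum>s\<in>S. \<Sum>t\<in>S. (p s * p t * \<beta>\<^sup>2) * (\<integral>\<omega>. Y (h s) \<omega> * Y (h t) \<omega> \<partial>N)) / 2"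
    unfolding Q_eq using int1 int2
    by (simp add: Bochner_Integration.integral_sum Bochner_Integration.integral_add
        Bochner_Integration.integral_diff)
  also have "\<dots> = (\<Sum>s\<in>S. p s) * (\<beta>\<^sup>2 * v / 2) -
      (\<Sum>s\<in>S. \<Sum>t\<in>S. p s * p t * \<beta>\<^sup>2 * (if h s = h t then v else 0)) / 2"
  proof -
    have m1: "(\<integral>\<omega>. Y (h s) \<omega> \<partial>N) = 0" if "s \<in> S" for s
      using row h that by (simp add: centered_row_def)
    have m2: "(\<integral>\<omega>. Y (h s) \<omega> * Y (h t) \<omega> \<partial>N) = (if h s = h t then v else 0)"
      if "s \<in> S" "t \<in> S" for s t
    proof -
      have "\<forall>i\<le>k. \<forall>i'\<le>k. (\<integral>\<omega>. Y i \<omega> * Y i' \<omega> \<partial>N) = (if i = i' then v else 0)"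
        using row unfolding centered_row_def by (elim conjE)
      then show ?thesis using h[OF that(1)] h[OF that(2)] by simp
    qed
    have "(\<Sum>s\<in>S. p s * (\<beta> * (\<integral>\<omega>. Y (h s) \<omega> \<partial>N))) = 0"
      by (rule sum.neutral) (simp add: m1)
    moreover have "(\<Sum>s\<in>S. p s * \<beta>\<^sup>2 * (\<integral>\<omega>. Y (h s) \<omega> * Y (h s) \<omega> \<partial>N)) = (\<Sum>s\<in>S. p s) * (\<beta>\<^sup>2 * v)"
      unfolding sum_distrib_right by (intro sum.cong refl) (simp only: m2 if_True mult.assoc simp_thms)
    moreover have "(\<Sum>s\<in>S. \<Sum>t\<in>S. (p s * p t * \<beta>\<^sup>2) * (\<integral>\<omega>. Y (h s) \<omega> * Y (h t) \<omega> \<partial>N)) =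
        (\<Sum>s\<in>S. \<Sum>t\<in>S. p s * p t * \<beta>\<^sup>2 * (if h s = h t then v else 0))"
      by (intro sum.cong refl) (simp only: m2)
    ultimately show ?thesis by simp
  qed
  also have "(\<Sum>s\<in>S. \<Sum>t\<in>S. p s * p t * \<beta>\<^sup>2 * (if h s = h t then v else 0)) =
      \<beta>\<^sup>2 * v * (\<Sum>s\<in>S. \<Sum>t\<in>S. p s * p t * (if h s = h t then 1 else 0))"
    unfolding sum_distrib_left by (intro sum.cong) auto
  finally have EQ: "(\<integral>\<omega>. Q \<omega> \<partial>N) = \<beta>\<^sup>2 * v / 2 *
      (1 - (\<Sum>s\<in>S. \<Sum>t\<in>S. p s * p t * (if h s = h t then 1 else 0)))"
    unfolding p1 by (simp only: mult_1 right_diff_distrib mult_1_right times_divide_eq_left times_divide_eq_right)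
  let ?L = "\<lambda>\<omega>. ln (\<Sum>s\<in>S. c s * exp (\<beta> * Y (h s) \<omega>))"
  \<comment> \<open>Integrability of the logarithm is obtained from its bounded distance to the
    integrable quadratic expression.\<close>
  have intD: "integrable N (\<lambda>\<omega>. ?L \<omega> - (ln C + Q \<omega>))"
    by (rule integrable_const_bound[of _ "30 * (\<beta> * B) ^ 3"])
       (use near intQ in \<open>auto intro!: borel_measurable_integrable\<close>)
  have "integrable N (\<lambda>\<omega>. (?L \<omega> - (ln C + Q \<omega>)) + (ln C + Q \<omega>))"
    by (intro Bochner_Integration.integrable_add intD intQ integrable_const)
  then have intL: "integrable N ?L" by simp
  have "(\<integral>\<omega>. ?L \<omega> - (ln C + Q \<omega>) \<partial>N) = (\<integral>\<omega>. ?L \<omega> \<partial>N) - (ln C + (\<integral>\<omega>. Q \<omega> \<partial>N))"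
    using intL intQ by (simp add: prob_space)
  moreover have "\<bar>\<integral>\<omega>. ?L \<omega> - (ln C + Q \<omega>) \<partial>N\<bar> \<le> 30 * (\<beta> * B) ^ 3"
  proof -
    have "\<bar>\<integral>\<omega>. ?L \<omega> - (ln C + Q \<omega>) \<partial>N\<bar> \<le> (\<integral>\<omega>. \<bar>?L \<omega> - (ln C + Q \<omega>)\<bar> \<partial>N)"
      by (rule integral_abs_bound)
    also have "\<dots> \<le> 30 * (\<beta> * B) ^ 3"
      by (rule integral_le_const) (use near intD in auto)
    finally show ?thesis .
  qed
  ultimately show ?thesis unfolding EQ p_def by simp
qed

text \<open>
  One row is exchanged at a time.  Given the other rows, the free energy is \<open>ln (\<Sum> c exp (\<beta> Y))\<close> in
  the exchanged row, so only its first two moments matter up to the cubic error.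
\<close>

lemma partition_comparison:
  fixes N :: "nat \<Rightarrow> (nat \<Rightarrow> real) measure" and p :: "'r pmf" and g :: "nat \<Rightarrow> 'r \<Rightarrow> real"
    and h :: "'s \<Rightarrow> nat \<Rightarrow> nat"
  assumes sets_N: "\<And>j. sets (N j) = sets (\<Pi>\<^sub>M i\<in>UNIV. borel)"
    and N: "\<And>j. centered_row (N j) (\<lambda>i r. r i) k B v"
    and p: "finite (set_pmf p)" "centered_row (measure_pmf p) g k B v"
    and S: "finite S" "S \<noteq> {}" and h: "\<And>s j. s \<in> S \<Longrightarrow> h s j \<le> k"
    and \<beta>: "\<beta> \<ge> 0" "\<beta> * B \<le> 1/4"
    and c: "\<And>s. s \<in> S \<Longrightarrow> c s > 0"
  shows "\<bar>(\<integral>\<omega>. ln (\<Sum>s\<in>S. c s * exp (\<beta> * (\<Sum>j<l. \<omega> j (h s j)))) \<partial>(\<Pi>\<^sub>M j\<in>{..<l}. N j)) -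
     measure_pmf.expectation (replicate_pmf l p)
       (\<lambda>rs. ln (\<Sum>s\<in>S. c s * exp (\<beta> * (\<Sum>j<l. g (h s j) (rev rs ! j)))))\<bar>
     \<le> real l * (60 * (\<beta> * B) ^ 3)"
  using c
proof (induction l arbitrary: c)
  case 0
  interpret prob_space "\<Pi>\<^sub>M j\<in>{}. N j" by (rule prob_space_PiM) simp
  show ?case by (simp add: prob_space)
next
  case (Suc l)
  have prob_N: "prob_space (N j)" for j using N by (simp add: centered_row_def)
  interpret product_prob_space N "{..<Suc l}"
    using prob_N by (auto simp: product_prob_space_def product_sigma_finite_def
        product_prob_space_axioms_def prob_space_imp_sigma_finite)
  interpret Pl: prob_space "\<Pi>\<^sub>M j\<in>{..<l}. N j" by (rule prob_space_PiM) (rule prob_N)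
  interpret PSl: prob_space "\<Pi>\<^sub>M j\<in>{..<Suc l}. N j" by (rule prob_space_PiM) (rule prob_N)
  define F where "F c n \<omega> = ln (\<Sum>s\<in>S. c s * exp (\<beta> * (\<Sum>j<n. \<omega> j (h s j))))"
    for c n and \<omega> :: "nat \<Rightarrow> nat \<Rightarrow> real"
  define G where "G c n rs = ln (\<Sum>s\<in>S. c s * exp (\<beta> * (\<Sum>j<n. g (h s j) (rev rs ! j))))"
    for c n and rs :: "'r list"
  \<comment> \<open>An exchanged row of coins is absorbed into the coefficients; this is why the
    induction runs over all positive \<open>c\<close>.\<close>
  define c' where "c' r s = c s * exp (\<beta> * g (h s l) r)" for r s
  have meas_N [measurable]: "(\<lambda>r. r i) \<in> borel_measurable (N j)" for i j
    by (subst measurable_cong_sets[OF sets_N refl]) simp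
  have meas_F [measurable]: "F c n \<in> borel_measurable (\<Pi>\<^sub>M j\<in>{..<n}. N j)" for c n
  proof -
    have "(\<lambda>\<omega>. \<omega> j (h s j)) \<in> borel_measurable (\<Pi>\<^sub>M j\<in>{..<n}. N j)" if "j < n" for s j
    proof -
      have "(\<lambda>\<omega>. \<omega> j) \<in> (\<Pi>\<^sub>M j\<in>{..<n}. N j) \<rightarrow>\<^sub>M N j"
        using that by (intro measurable_component_singleton) simp
      from measurable_compose[OF this meas_N[of "h s j" j]] show ?thesis .
    qed
    then show ?thesis unfolding F_def by measurable
  qed
  have bdd: "AE \<omega> in (\<Pi>\<^sub>M j\<in>{..<n}. N j). \<bar>F c n \<omega>\<bar> \<le> \<bar>ln (\<Sum>s\<in>S. c s)\<bar> + \<beta> * (real n * B)"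
    if c: "\<And>s. s \<in> S \<Longrightarrow> c s > 0" for c :: "'s \<Rightarrow> real" and n
  proof -
    have "AE \<omega> in (\<Pi>\<^sub>M j\<in>{..<n}. N j). \<forall>j\<in>{..<n}. \<forall>i\<in>{..k}. \<bar>\<omega> j i\<bar> \<le> B"
    proof (intro AE_finite_allI)
      fix j i assume "j \<in> {..<n}" "i \<in> {..k}"
      then show "AE \<omega> in (\<Pi>\<^sub>M j\<in>{..<n}. N j). \<bar>\<omega> j i\<bar> \<le> B"
        using N[of j] prob_N by (intro AE_PiM_component) (auto simp: centered_row_def)
    qed auto
    then show ?thesis
    proof eventually_elim
      case (elim \<omega>)
      have le: "\<bar>\<beta> * (\<Sum>j<n. \<omega> j (h s j))\<bar> \<le> \<beta> * (real n * B)" if "s \<in> S" for s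
      proof -
        have "\<bar>\<Sum>j<n. \<omega> j (h s j)\<bar> \<le> (\<Sum>j<n. \<bar>\<omega> j (h s j)\<bar>)" by (rule sum_abs)
        also have "\<dots> \<le> (\<Sum>j<n. B)" using elim h[OF that] by (intro sum_mono) auto
        finally show ?thesis using \<beta>(1) by (simp add: abs_mult mult_left_mono)
      qed
      define D where "D = \<beta> * (real n * B)"
      have C: "(\<Sum>s\<in>S. c s) > 0" using S c by (intro sum_pos) auto
      have upper: "(\<Sum>s\<in>S. c s * exp (\<beta> * (\<Sum>j<n. \<omega> j (h s j)))) \<le> (\<Sum>s\<in>S. c s) * exp D"
        unfolding sum_distrib_right
        by (intro sum_mono mult_left_mono) (use le c in \<open>auto simp: D_def abs_le_iff less_imp_le\<close>)
      have lower: "(\<Sum>s\<in>S. c s) * exp (- D) \<le> (\<Sum>s\<in>S. c s * exp (\<beta> * (\<Sum>j<n. \<omega> j (h s j))))"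
        unfolding sum_distrib_right
        by (intro sum_mono mult_left_mono) (use le c in \<open>force simp: D_def abs_le_iff less_imp_le\<close>)+
      have pos: "(\<Sum>s\<in>S. c s * exp (\<beta> * (\<Sum>j<n. \<omega> j (h s j)))) > 0"
        using S c by (intro sum_pos) auto
      have "F c n \<omega> \<le> ln ((\<Sum>s\<in>S. c s) * exp D)"
        unfolding F_def using upper pos C by (subst ln_le_cancel_iff) auto
      moreover have "ln ((\<Sum>s\<in>S. c s) * exp (- D)) \<le> F c n \<omega>"
        unfolding F_def using lower pos C by (subst ln_le_cancel_iff) auto
      ultimately show ?case using C unfolding D_def[symmetric] by (simp add: ln_mult)
    qed
  qed
  have int: "integrable (\<Pi>\<^sub>M j\<in>{..<n}. N j) (F c n)"
    if c: "\<And>s. s \<in> S \<Longrightarrow> c s > 0" for c :: "'s \<Rightarrow> real" and n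
  proof -
    interpret prob_space "\<Pi>\<^sub>M j\<in>{..<n}. N j" by (rule prob_space_PiM) (rule prob_N)
    show ?thesis
      by (rule integrable_const_bound[OF _ meas_F]) (use bdd[of c n, OF c] in auto)
  qed
  have c'_pos: "c' r s > 0" if "s \<in> S" for r s using Suc.prems[OF that] by (simp add: c'_def)
  have peel: "F c (Suc l) (x(l := y)) =
      ln (\<Sum>s\<in>S. (c s * exp (\<beta> * (\<Sum>j<l. x j (h s j)))) * exp (\<beta> * y (h s l)))" for x y
    by (simp add: F_def distrib_left exp_add mult.assoc)
  have peel': "F (c' r) l x =
      ln (\<Sum>s\<in>S. (c s * exp (\<beta> * (\<Sum>j<l. x j (h s j)))) * exp (\<beta> * g (h s l) r))" for x r
    by (simp add: F_def c'_def mult_ac)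
  define I where "I x = (\<integral>y. F c (Suc l) (x(l := y)) \<partial>N l)" for x
  define J where "J x = measure_pmf.expectation p (\<lambda>r. F (c' r) l x)" for x
  have J_sum: "J x = (\<Sum>r\<in>set_pmf p. pmf p r * F (c' r) l x)" for x
    unfolding J_def using p(1) by (subst integral_measure_pmf[of "set_pmf p"]) auto
  \<comment> \<open>Both row integrals lie within 30 (\<beta> B)^3 of the same main term, hence the
    60.\<close>
  have near: "\<bar>I x - J x\<bar> \<le> 60 * (\<beta> * B) ^ 3" for x
  proof -
    define w where "w s = c s * exp (\<beta> * (\<Sum>j<l. x j (h s j)))" for s
    have w: "w s > 0" if "s \<in> S" for s using Suc.prems[OF that] by (simp add: w_def)
    show ?thesis
      unfolding I_def J_def peel peel' w_def[symmetric]
      using centered_row_integral_ln[OF N[of l] S, of w "\<lambda>s. h s l" \<beta>]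
        centered_row_integral_ln[OF p(2) S, of w "\<lambda>s. h s l" \<beta>] w h \<beta> by fastforce
  qed
  have insert: "{..<Suc l} = insert l {..<l}" by auto
  have eq_I: "(\<integral>\<omega>. F c (Suc l) \<omega> \<partial>(\<Pi>\<^sub>M j\<in>{..<Suc l}. N j)) = (\<integral>x. I x \<partial>(\<Pi>\<^sub>M j\<in>{..<l}. N j))"
    unfolding insert I_def using int[of c "Suc l", OF Suc.prems]
    by (intro product_integral_insert) (auto simp: insert)
  have int_J: "integrable (\<Pi>\<^sub>M j\<in>{..<l}. N j) J"
    unfolding J_sum[abs_def] using int[of "c' _" l, OF c'_pos] by auto
  have int_I: "integrable (\<Pi>\<^sub>M j\<in>{..<l}. N j) I"
  proof (rule Bochner_Integration.integrable_bound)
    show "integrable (\<Pi>\<^sub>M j\<in>{..<l}. N j) (\<lambda>x. \<bar>J x\<bar> + 60 * (\<beta> * B) ^ 3)"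
      using int_J by simp
    have "(\<lambda>(x, y). F c (Suc l) (x(l := y))) \<in> borel_measurable ((\<Pi>\<^sub>M j\<in>{..<l}. N j) \<Otimes>\<^sub>M N l)"
      using measurable_compose[OF measurable_add_dim[of l "{..<l}" N] meas_F[of c "Suc l", unfolded insert]]
      by (simp add: split_beta')
    then show "I \<in> borel_measurable (\<Pi>\<^sub>M j\<in>{..<l}. N j)"
      unfolding I_def by (rule sigma_finite_measure.borel_measurable_lebesgue_integral[OF prob_space_imp_sigma_finite[OF prob_N]])
    show "AE x in (\<Pi>\<^sub>M j\<in>{..<l}. N j). norm (I x) \<le> norm (\<bar>J x\<bar> + 60 * (\<beta> * B) ^ 3)"
    proof (rule AE_I2)
      fix x
      show "norm (I x) \<le> norm (\<bar>J x\<bar> + 60 * (\<beta> * B) ^ 3)"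
        using near[of x] by (simp add: abs_le_iff) linarith
    qed
  qed
  have eq_J: "(\<integral>x. J x \<partial>(\<Pi>\<^sub>M j\<in>{..<l}. N j)) =
      (\<Sum>r\<in>set_pmf p. pmf p r * (\<integral>x. F (c' r) l x \<partial>(\<Pi>\<^sub>M j\<in>{..<l}. N j)))"
    unfolding J_sum using int[of "c' _" l, OF c'_pos] by (subst Bochner_Integration.integral_sum) auto
  \<comment> \<open>Lists are read backwards, so the head \<open>r\<close> is the row with index
    \<open>l\<close>, the one just exchanged.\<close>
  have G_Cons: "G c (Suc l) (r # rs) = G (c' r) l rs" if "rs \<in> set_pmf (replicate_pmf l p)" for r rs
  proof -
    have "length rs = l" using that by (simp add: set_replicate_pmf)
    then show ?thesis
      by (simp add: G_def c'_def nth_append distrib_left exp_add mult_ac)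
  qed
  have "measure_pmf.expectation (replicate_pmf l p) (\<lambda>rs. G c (Suc l) (r # rs)) =
      measure_pmf.expectation (replicate_pmf l p) (G (c' r) l)" for r
    by (intro integral_cong_AE) (auto simp: AE_measure_pmf_iff G_Cons)
  then have G_Suc: "measure_pmf.expectation (replicate_pmf (Suc l) p) (G c (Suc l)) =
      (\<Sum>r\<in>set_pmf p. pmf p r * measure_pmf.expectation (replicate_pmf l p) (G (c' r) l))"
    unfolding expectation_replicate_pmf_Suc[OF p(1)]
    using p(1) by (simp add: integral_measure_pmf[of "set_pmf p"])
  have IH: "\<bar>(\<integral>x. F (c' r) l x \<partial>(\<Pi>\<^sub>M j\<in>{..<l}. N j)) -
      measure_pmf.expectation (replicate_pmf l p) (G (c' r) l)\<bar> \<le> real l * (60 * (\<beta> * B) ^ 3)" for r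
    using Suc.IH[of "c' r"] c'_pos unfolding F_def G_def by simp
  have "\<bar>(\<integral>\<omega>. F c (Suc l) \<omega> \<partial>(\<Pi>\<^sub>M j\<in>{..<Suc l}. N j)) - (\<integral>x. J x \<partial>(\<Pi>\<^sub>M j\<in>{..<l}. N j))\<bar>
      = \<bar>\<integral>x. I x - J x \<partial>(\<Pi>\<^sub>M j\<in>{..<l}. N j)\<bar>"
    unfolding eq_I using int_I int_J by simp
  also have "\<dots> \<le> (\<integral>x. \<bar>I x - J x\<bar> \<partial>(\<Pi>\<^sub>M j\<in>{..<l}. N j))" by (rule integral_abs_bound)
  also have "\<dots> \<le> 60 * (\<beta> * B) ^ 3"
    by (rule Pl.integral_le_const) (use near int_I int_J in auto)
  finally have 1: "\<bar>(\<integral>\<omega>. F c (Suc l) \<omega> \<partial>(\<Pi>\<^sub>M j\<in>{..<Suc l}. N j)) -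
      (\<integral>x. J x \<partial>(\<Pi>\<^sub>M j\<in>{..<l}. N j))\<bar> \<le> 60 * (\<beta> * B) ^ 3" .
  have "\<bar>(\<integral>x. J x \<partial>(\<Pi>\<^sub>M j\<in>{..<l}. N j)) - measure_pmf.expectation (replicate_pmf (Suc l) p) (G c (Suc l))\<bar>
      = \<bar>\<Sum>r\<in>set_pmf p. pmf p r * ((\<integral>x. F (c' r) l x \<partial>(\<Pi>\<^sub>M j\<in>{..<l}. N j)) -
          measure_pmf.expectation (replicate_pmf l p) (G (c' r) l))\<bar>"
    unfolding eq_J G_Suc by (simp add: right_diff_distrib sum_subtractf)
  also have "\<dots> \<le> (\<Sum>r\<in>set_pmf p. \<bar>pmf p r * ((\<integral>x. F (c' r) l x \<partial>(\<Pi>\<^sub>M j\<in>{..<l}. N j)) -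
          measure_pmf.expectation (replicate_pmf l p) (G (c' r) l))\<bar>)" by (rule sum_abs)
  also have "\<dots> \<le> (\<Sum>r\<in>set_pmf p. pmf p r * (real l * (60 * (\<beta> * B) ^ 3)))"
    using IH by (intro sum_mono) (auto simp: abs_mult intro!: mult_left_mono)
  also have "\<dots> = real l * (60 * (\<beta> * B) ^ 3)"
    using sum_pmf_eq_1[OF p(1) order_refl] by (simp add: sum_distrib_right[symmetric])
  finally have 2: "\<bar>(\<integral>x. J x \<partial>(\<Pi>\<^sub>M j\<in>{..<l}. N j)) -
      measure_pmf.expectation (replicate_pmf (Suc l) p) (G c (Suc l))\<bar> \<le> real l * (60 * (\<beta> * B) ^ 3)" .
  show ?case
    using 1 2 unfolding F_def G_def by (simp add: distrib_right abs_le_iff)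
qed

section \<open>First passage over fair coins and queues in series\<close>

text \<open>
  One time step of a series of queues.  The entries of \<open>ds\<close> are the queue lengths, the coins \<open>es\<close>
  say which servers are active, and \<open>w\<close> is the external arrival; it enters at the end of the list, and
  the output of each queue is the arrival at the queue listed before it.
\<close>

fun queue_row :: "nat list \<Rightarrow> bool list \<Rightarrow> bool \<Rightarrow> nat list \<times> bool" where
  "queue_row (d # ds) (e # es) w =
     (let (ds', u) = queue_row ds es w; u' = (e \<and> (u \<or> d > 0))
      in ((of_bool u + d - of_bool u') # ds', u'))"
| "queue_row ds es w = ([], w)"

fun queue_output :: "nat list \<Rightarrow> (bool list \<times> bool) list \<Rightarrow> nat" where
  "queue_output ds [] = 0"
| "queue_output ds ((es, w) # rs) =
     (let (ds', u) = queue_row ds es w in of_bool u + queue_output ds' rs)"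

text \<open>Row lists are read backwards: the head of the list is the last row.\<close>

fun fpp :: "nat \<Rightarrow> bool list list \<Rightarrow> nat" where
  "fpp k [] = 0"
| "fpp 0 (es # rs) = fpp 0 rs + of_bool (es ! 0)"
| "fpp (Suc k) (es # rs) = min (fpp k (es # rs)) (fpp (Suc k) rs + of_bool (es ! Suc k))"

text \<open>A choice that meets N true coins collects \<open>\<sigma> * (l - 2 * N)\<close>, so
  maximizing the weight means minimizing N. \<open>rev\<close> undoes the backward reading of row
  lists.\<close>

lemma swl_coins:
  assumes "\<sigma> \<ge> 0"
  shows "swl (\<lambda>j i. \<sigma> * (1 - 2 * of_bool (rev rs ! j ! i))) k (length rs) =
    \<sigma> * (real (length rs) - 2 * real (fpp k rs))"
proof (induction k rs rule: fpp.induct)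
  case (2 es rs)
  have "swl (\<lambda>j i. \<sigma> * (1 - 2 * of_bool (rev (es # rs) ! j ! i))) 0 (length rs) =
      swl (\<lambda>j i. \<sigma> * (1 - 2 * of_bool (rev rs ! j ! i))) 0 (length rs)"
    by (rule swl_cong) (simp add: nth_append)
  then show ?case using 2 by (simp add: nth_append algebra_simps)
next
  case (3 k es rs)
  have "swl (\<lambda>j i. \<sigma> * (1 - 2 * of_bool (rev (es # rs) ! j ! i))) (Suc k) (length rs) =
      swl (\<lambda>j i. \<sigma> * (1 - 2 * of_bool (rev rs ! j ! i))) (Suc k) (length rs)"
    by (rule swl_cong) (simp add: nth_append)
  moreover have "max (\<sigma> * (x - 2 * y)) (\<sigma> * (x - 2 * z)) = \<sigma> * (x - 2 * min y z)" for x y z :: real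
  proof (cases "y \<le> z")
    case True
    then have "\<sigma> * (x - 2 * z) \<le> \<sigma> * (x - 2 * y)" using assms by (intro mult_left_mono) auto
    then show ?thesis using True by (simp add: max_def min_def)
  next
    case False
    then have "\<sigma> * (x - 2 * y) \<le> \<sigma> * (x - 2 * z)" using assms by (intro mult_left_mono) auto
    then show ?thesis using False by (simp add: max_def min_def)
  qed
  note this[of "1 + real (length rs)" "real (fpp k (es # rs))" "real (fpp (Suc k) rs + of_bool (es ! Suc k))"]
  ultimately show ?case using 3 by (simp add: nth_append algebra_simps of_nat_min)
qed simp

section \<open>Monotonicity and bounded differences of first-passage values\<close>

lemma fpp_attained: "\<exists>k'\<le>k. fpp k (es # rs) = fpp k' rs + of_bool (es ! k')"
proof (induction k)
  case (Suc k)
  then obtain k' where "k' \<le> k" "fpp k (es # rs) = fpp k' rs + of_bool (es ! k')" by blast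
  then show ?case by (cases "fpp k (es # rs) \<le> fpp (Suc k) rs + of_bool (es ! Suc k)") (auto intro: le_SucI)
qed simp

lemma fpp_Suc_le: "fpp (Suc k) rs \<le> fpp k rs"
  by (cases rs) simp_all

lemma fpp_antimono: "k \<le> k' \<Longrightarrow> fpp k' rs \<le> fpp k rs"
  by (rule lift_Suc_antimono_le[of "\<lambda>k. fpp k rs"]) (rule fpp_Suc_le)

lemma fpp_le: "fpp k (es # rs) \<le> fpp k rs + of_bool (es ! k)"
  by (cases k) simp_all

lemma fpp_cons_diff:
  assumes "\<And>k. \<bar>real (fpp k rs) - real (fpp k rs')\<bar> \<le> 1"
  shows "\<bar>real (fpp k (es # rs)) - real (fpp k (es # rs'))\<bar> \<le> 1"
proof (induction k)
  case 0
  then show ?case using assms[of 0] by simp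
next
  case (Suc k)
  moreover have "\<bar>min x (y + z) - min x' (y' + z)\<bar> \<le> 1"
    if "\<bar>x - x'\<bar> \<le> 1" "\<bar>y - y'\<bar> \<le> 1" for x x' y y' z :: real
    using that by linarith
  ultimately show ?case using assms[of "Suc k"] by (simp add: of_nat_min)
qed

lemma fpp_head_diff: "\<bar>real (fpp k (es # rs)) - real (fpp k (es' # rs))\<bar> \<le> 1"
  by (induction k) (auto simp: of_bool_def min_def)

text \<open>A path meets one coin per row, so a whole row counts for at most one unit. The
  fluctuations are thereby controlled by the number of rows alone, however many columns there
  are.\<close>

lemma fpp_bounded_difference:
  "\<bar>real (fpp k (pre @ es # post)) - real (fpp k (pre @ es' # post))\<bar> \<le> 1"
proof (induction pre arbitrary: k)
  case Nil
  then show ?case by (simp add: fpp_head_diff)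
next
  case (Cons a pre)
  then show ?case by (simp add: fpp_cons_diff)
qed

section \<open>Queue output as a first-passage value\<close>

lemma length_queue_row: "length es = length ds \<Longrightarrow> length (fst (queue_row ds es w)) = length ds"
  by (induction ds es w rule: queue_row.induct) (auto simp: Let_def split_beta)

text \<open>Conservation of customers: the output plus the new content of the first \<open>i\<close>
  queues equals their old content plus the output of queue \<open>i\<close>, which is at most the
  service coin of queue \<open>i\<close>.\<close>

lemma queue_row_le:
  assumes "length es = length ds" "queue_row ds es w = (ds', u)" "i < length ds"
  shows "of_bool u + sum_list (take i ds') \<le> of_bool (es ! i) + sum_list (take i ds)"
  using assms
proof (induction ds es w arbitrary: i ds' u rule: queue_row.induct)
  case (1 d ds e es w)
  obtain ds0 u0 where q: "queue_row ds es w = (ds0, u0)" by force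
  show ?case
  proof (cases i)
    case 0
    then show ?thesis using 1 q by (auto simp: Let_def)
  next
    case (Suc j)
    have "of_bool u0 + sum_list (take j ds0) \<le> of_bool (es ! j) + sum_list (take j ds)"
      using 1 q Suc by auto
    then show ?thesis using 1(3) q Suc by (auto simp: Let_def split: if_splits)
  qed
qed auto

text \<open>In the conservation law the output of queue \<open>i\<close> equals its coin unless the
  service is wasted. Then queue \<open>i\<close> is empty and receives nothing, so the balance
  passes unchanged to the next queue, and beyond the last queue to the external arrival.\<close>

lemma queue_row_attained:
  assumes "length es = length ds" "i \<le> length ds"
  shows "\<exists>i'. i \<le> i' \<and> i' \<le> length ds \<and>
    of_bool (snd (queue_row ds es w)) + sum_list (take i (fst (queue_row ds es w))) =
    (if i' < length ds then of_bool (es ! i') else of_bool w) + sum_list (take i' ds)"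
  using assms
proof (induction ds arbitrary: es i)
  case (Cons d ds)
  obtain e es' where es: "es = e # es'" using Cons.prems(1) by (cases es) auto
  define u\<^sub>0 ds\<^sub>0 where "u\<^sub>0 = snd (queue_row ds es' w)" and "ds\<^sub>0 = fst (queue_row ds es' w)"
  define u where "u = (e \<and> (u\<^sub>0 \<or> d > 0))"
  have row: "queue_row (d # ds) es w = ((of_bool u\<^sub>0 + d - of_bool u) # ds\<^sub>0, u)"
    by (simp add: es u_def u\<^sub>0_def ds\<^sub>0_def split_beta Let_def)
  have shift: "\<exists>i'. Suc j \<le> i' \<and> i' \<le> length (d # ds) \<and> of_bool u\<^sub>0 + d + sum_list (take j ds\<^sub>0) =
      (if i' < length (d # ds) then of_bool (es ! i') else of_bool w) + sum_list (take i' (d # ds))"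
    if j: "j \<le> length ds" for j
  proof -
    have "length es' = length ds" using Cons.prems(1) by (simp add: es)
    from Cons.IH[OF this j] obtain i' where i': "j \<le> i'" "i' \<le> length ds"
        "of_bool u\<^sub>0 + sum_list (take j ds\<^sub>0) =
         (if i' < length ds then of_bool (es' ! i') else of_bool w) + sum_list (take i' ds)"
      unfolding u\<^sub>0_def ds\<^sub>0_def by blast
    show ?thesis
      by (rule exI[of _ "Suc i'"]) (use i' in \<open>simp add: es split: if_splits\<close>)
  qed
  show ?case
  proof (cases i)
    case (Suc j)
    have "of_bool u + sum_list (take i ((of_bool u\<^sub>0 + d - of_bool u) # ds\<^sub>0)) =
        of_bool u\<^sub>0 + d + sum_list (take j ds\<^sub>0)"
      by (auto simp: Suc u_def)
    moreover have "j \<le> length ds" using Cons.prems(2) Suc by simp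
    ultimately show ?thesis unfolding row fst_conv snd_conv using shift[of j] Suc by metis
  next
    case 0
    show ?thesis
    proof (cases "u = e")
      case True
      then show ?thesis unfolding row 0 fst_conv snd_conv by (intro exI[of _ 0]) (simp add: es)
    next
      case False
      then have "of_bool u = of_bool u\<^sub>0 + d" by (auto simp: u_def)
      then show ?thesis unfolding row 0 fst_conv snd_conv using shift[of 0] by fastforce
    qed
  qed
qed simp

text \<open>
  The total output is a first-passage value in which the path pays \<open>sum_list (take k ds)\<close> for ending in
  column \<open>k\<close>; only a path through the arrivals can beat all \<open>fpp k\<close>, and it pays \<open>sum_list ds\<close>.
\<close>

lemma queue_output_le:
  assumes "\<And>es w. (es, w) \<in> set rs \<Longrightarrow> length es = length ds" "k < length ds"
  shows "queue_output ds rs \<le> fpp k (map fst rs) + sum_list (take k ds)"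
  using assms
proof (induction rs arbitrary: ds k)
  case (Cons r rs)
  obtain es w where r: "r = (es, w)" by force
  obtain ds' u where q: "queue_row ds es w = (ds', u)" by force
  have len: "length es = length ds" using Cons.prems(1)[of es w] r by simp
  then have len': "length ds' = length ds" using length_queue_row[OF len, of w] q by simp
  obtain k' where k': "k' \<le> k" "fpp k (es # map fst rs) = fpp k' (map fst rs) + of_bool (es ! k')"
    using fpp_attained by blast
  have "queue_output ds' rs \<le> fpp k' (map fst rs) + sum_list (take k' ds')"
    using Cons.prems k' len' by (intro Cons.IH) auto
  moreover have "of_bool u + sum_list (take k' ds') \<le> of_bool (es ! k') + sum_list (take k' ds)"
    using queue_row_le[OF len q] k'(1) Cons.prems(2) by simp
  moreover have "sum_list (take k' ds) \<le> sum_list (take k ds)"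
  proof -
    have "take k ds = take k' ds @ take (k - k') (drop k' ds)"
      using k'(1) by (metis le_add_diff_inverse take_add)
    then show ?thesis by simp
  qed
  ultimately show ?case using k'(2) by (simp add: r q)
qed simp

text \<open>The head of \<open>rs\<close> is the first time step of the queues but the last row of
  \<open>fpp\<close>. Prepending a time step therefore prolongs the path by a row, in a column
  \<open>i \<ge> k\<close>. If \<open>i\<close> runs into the arrivals, only the initial content of
  all queues remains as a lower bound.\<close>

lemma queue_output_ge:
  assumes "\<And>es w. (es, w) \<in> set rs \<Longrightarrow> length es = length ds" "ds \<noteq> []"
  shows "(\<exists>k<length ds. fpp k (map fst rs) + sum_list (take k ds) \<le> queue_output ds rs) \<or>
    sum_list ds \<le> queue_output ds rs"
  using assms
proof (induction rs arbitrary: ds)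
  case Nil
  then show ?case by (auto intro!: exI[of _ 0])
next
  case (Cons r rs)
  obtain es w where r: "r = (es, w)" by force
  obtain ds' u where q: "queue_row ds es w = (ds', u)" by force
  have len: "length es = length ds" using Cons.prems(1)[of es w] r by simp
  then have len': "length ds' = length ds" using length_queue_row[OF len, of w] q by simp
  have out: "queue_output ds (r # rs) = of_bool u + queue_output ds' rs" by (simp add: r q)
  have "(\<exists>k<length ds'. fpp k (map fst rs) + sum_list (take k ds') \<le> queue_output ds' rs) \<or>
    sum_list ds' \<le> queue_output ds' rs"
    using Cons.prems len' by (intro Cons.IH) auto
  then have "\<exists>k\<le>length ds. (if k < length ds then fpp k (map fst rs) else 0) + sum_list (take k ds') \<le> queue_output ds' rs"
  proof (elim disjE exE conjE)
    fix k assume "k < length ds'" "fpp k (map fst rs) + sum_list (take k ds') \<le> queue_output ds' rs"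
    then show ?thesis using len' by (intro exI[of _ k]) simp
  next
    assume "sum_list ds' \<le> queue_output ds' rs"
    then show ?thesis using len' by (intro exI[of _ "length ds"]) simp
  qed
  then obtain k where k: "k \<le> length ds"
      "(if k < length ds then fpp k (map fst rs) else 0) + sum_list (take k ds') \<le> queue_output ds' rs" by blast
  obtain i where i: "k \<le> i" "i \<le> length ds" "of_bool u + sum_list (take k ds') =
      (if i < length ds then of_bool (es ! i) else of_bool w) + sum_list (take i ds)"
    using queue_row_attained[OF len k(1), of w] unfolding q fst_conv snd_conv by blast
  show ?case
  proof (cases "i < length ds")
    case True
    then have "fpp i (map fst (r # rs)) \<le> fpp k (map fst rs) + of_bool (es ! i)"
      using fpp_le[of i es "map fst rs"] fpp_antimono[OF i(1), of "map fst rs"] by (simp add: r)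
    then show ?thesis using True i k out by (intro disjI1 exI[of _ i]) (auto split: if_splits)
  next
    case False
    then show ?thesis using i k out by (intro disjI2) (auto split: if_splits)
  qed
qed

text \<open>Burke's theorem for one queue. A nonempty queue grows with probability v/2 and shrinks
  with probability (1 - v)/2, so the stationary law is geometric with ratio \<rho> = v/(1 - v). The
  joint law factorizes through (1 - v) \<rho> = v: an output that leaves \<open>n\<close> customers
  behind arises from \<open>n\<close> with an arrival or from \<open>Suc n\<close> without
  one.\<close>

lemma queue_step_law:
  assumes v: "0 < v" "v < 1/2"
  defines "G \<equiv> geometric_pmf ((1 - 2 * v) / (1 - v))"
  shows "do {w \<leftarrow> bernoulli_pmf v; d \<leftarrow> G; e \<leftarrow> bernoulli_pmf (1/2);
      let u = (e \<and> (w \<or> d > 0)) in return_pmf (of_bool w + d - of_bool u, u)} =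
    pair_pmf G (bernoulli_pmf v)" (is "?lhs = _")
proof (rule pmf_eqI)
  fix x :: "nat \<times> bool"
  obtain n b where x: "x = (n, b)" by force
  define \<rho> where "\<rho> = v / (1 - v)"
  have p: "0 < (1 - 2 * v) / (1 - v)" "(1 - 2 * v) / (1 - v) \<le> 1" using v by (auto simp: divide_simps)
  have \<rho>: "1 - (1 - 2 * v) / (1 - v) = \<rho>" using v by (simp add: \<rho>_def divide_simps)
  define f :: "bool \<Rightarrow> bool \<Rightarrow> nat \<Rightarrow> nat \<times> bool" where
    "f w e d = (let u = (e \<and> (w \<or> d > 0)) in (of_bool w + d - of_bool u, u))" for w e d
  have "?lhs = do {w \<leftarrow> bernoulli_pmf v; e \<leftarrow> bernoulli_pmf (1/2); map_pmf (f w e) G}"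
    unfolding map_pmf_def f_def Let_def
    by (intro bind_pmf_cong refl bind_commute_pmf)
  then have "pmf ?lhs x = v * (measure_pmf.prob G (f True True -` {x}) + measure_pmf.prob G (f True False -` {x})) / 2
      + (1 - v) * (measure_pmf.prob G (f False True -` {x}) + measure_pmf.prob G (f False False -` {x})) / 2"
    using v by (simp add: pmf_bind pmf_map field_simps)
  also have "\<dots> = pmf G n * (if b then v else 1 - v)"
  proof -
    have g: "pmf G (Suc n) = \<rho> * pmf G n" for n
      unfolding G_def using p \<rho> by (simp add: pmf_geometric)
    have "(1 - v) * \<rho> = v" using v by (simp add: \<rho>_def)
    then have gs: "(1 - v) * pmf G (Suc k) = v * pmf G k" for k
      unfolding g by (metis mult.assoc)
    consider "b" | "\<not> b" "n = 0" | m where "\<not> b" "n = Suc m" by (cases n) auto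
    then show ?thesis
    proof cases
      case 1
      have "f True True -` {x} = {n}" "f True False -` {x} = {}"
        "f False True -` {x} = {Suc n}" "f False False -` {x} = {}"
        using 1 by (auto simp: x f_def Let_def)
      then show ?thesis using 1 by (simp add: measure_pmf_single gs)
    next
      case 2
      have "f True True -` {x} = {}" "f True False -` {x} = {}"
        "f False True -` {x} = {0}" "f False False -` {x} = {0}"
        using 2 by (auto simp: x f_def Let_def)
      then show ?thesis using 2 by (simp add: measure_pmf_single)
    next
      case 3
      have "f True True -` {x} = {}" "f True False -` {x} = {m}"
        "f False True -` {x} = {}" "f False False -` {x} = {n}"
        using 3 by (auto simp: x f_def Let_def)
      then show ?thesis using 3 gs[of m] by (simp add: measure_pmf_single mult.commute)
    qed
  qed
  also have "\<dots> = pmf (pair_pmf G (bernoulli_pmf v)) x"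
    using v by (simp add: x pmf_pair)
  finally show "pmf ?lhs x = pmf (pair_pmf G (bernoulli_pmf v)) x" .
qed

text \<open>Burke's theorem for a series of discrete-time queues with fair service coins.\<close>

lemma queue_row_law:
  assumes v: "0 < v" "v < 1/2"
  defines "G \<equiv> geometric_pmf ((1 - 2 * v) / (1 - v))"
  shows "do {ds \<leftarrow> replicate_pmf n G; es \<leftarrow> replicate_pmf n (bernoulli_pmf (1/2)); w \<leftarrow> bernoulli_pmf v;
      return_pmf (queue_row ds es w)} = pair_pmf (replicate_pmf n G) (bernoulli_pmf v)"
proof (induction n)
  case 0
  show ?case by (simp add: bind_return_pmf pair_pmf_def)
next
  case (Suc n)
  let ?B = "bernoulli_pmf (1/2)" and ?V = "bernoulli_pmf v"
  define h where "h d e q = (let (ds', u) = q; u' = (e \<and> (u \<or> d > 0))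
      in ((of_bool u + d - of_bool u') # ds', u'))" for d e and q :: "nat list \<times> bool"
  have "do {ds \<leftarrow> replicate_pmf (Suc n) G; es \<leftarrow> replicate_pmf (Suc n) ?B; w \<leftarrow> ?V; return_pmf (queue_row ds es w)} =
      do {d \<leftarrow> G; ds \<leftarrow> replicate_pmf n G; e \<leftarrow> ?B; es \<leftarrow> replicate_pmf n ?B; w \<leftarrow> ?V;
        return_pmf (h d e (queue_row ds es w))}"
    by (simp add: bind_assoc_pmf bind_return_pmf h_def)
  also have "\<dots> = do {d \<leftarrow> G; e \<leftarrow> ?B; ds \<leftarrow> replicate_pmf n G; es \<leftarrow> replicate_pmf n ?B; w \<leftarrow> ?V;
        return_pmf (h d e (queue_row ds es w))}"
    by (intro bind_pmf_cong refl bind_commute_pmf)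
  also have "\<dots> = do {d \<leftarrow> G; e \<leftarrow> ?B; q \<leftarrow> do {ds \<leftarrow> replicate_pmf n G; es \<leftarrow> replicate_pmf n ?B; w \<leftarrow> ?V;
        return_pmf (queue_row ds es w)}; return_pmf (h d e q)}"
    by (simp add: bind_assoc_pmf bind_return_pmf)
  \<comment> \<open>By the induction hypothesis the output of the tail is a \<open>v\<close>-coin
    independent of the new tail lengths, so the head queue is a single queue with fresh
    arrivals.\<close>
  also have "\<dots> = do {d \<leftarrow> G; e \<leftarrow> ?B; ds \<leftarrow> replicate_pmf n G; w \<leftarrow> ?V; return_pmf (h d e (ds, w))}"
    unfolding Suc by (simp add: pair_pmf_def bind_assoc_pmf bind_return_pmf)
  also have "\<dots> = do {d \<leftarrow> G; ds \<leftarrow> replicate_pmf n G; e \<leftarrow> ?B; w \<leftarrow> ?V; return_pmf (h d e (ds, w))}"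
    by (intro bind_pmf_cong refl bind_commute_pmf)
  also have "\<dots> = do {ds \<leftarrow> replicate_pmf n G; d \<leftarrow> G; e \<leftarrow> ?B; w \<leftarrow> ?V; return_pmf (h d e (ds, w))}"
    by (rule bind_commute_pmf)
  also have "\<dots> = do {ds \<leftarrow> replicate_pmf n G; d \<leftarrow> G; w \<leftarrow> ?V; e \<leftarrow> ?B; return_pmf (h d e (ds, w))}"
    by (intro bind_pmf_cong refl bind_commute_pmf)
  also have "\<dots> = do {ds \<leftarrow> replicate_pmf n G; w \<leftarrow> ?V; d \<leftarrow> G; e \<leftarrow> ?B; return_pmf (h d e (ds, w))}"
    by (intro bind_pmf_cong refl bind_commute_pmf)
  also have "\<dots> = do {ds \<leftarrow> replicate_pmf n G; (d', u) \<leftarrow> do {w \<leftarrow> ?V; d \<leftarrow> G; e \<leftarrow> ?B;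
        let u = (e \<and> (w \<or> d > 0)) in return_pmf (of_bool w + d - of_bool u, u)}; return_pmf (d' # ds, u)}"
    by (simp add: bind_assoc_pmf bind_return_pmf h_def Let_def)
  also have "\<dots> = do {ds \<leftarrow> replicate_pmf n G; d' \<leftarrow> G; u \<leftarrow> ?V; return_pmf (d' # ds, u)}"
    unfolding G_def queue_step_law[OF v] by (simp add: pair_pmf_def bind_assoc_pmf bind_return_pmf)
  also have "\<dots> = do {d' \<leftarrow> G; ds \<leftarrow> replicate_pmf n G; u \<leftarrow> ?V; return_pmf (d' # ds, u)}"
    by (rule bind_commute_pmf)
  also have "\<dots> = pair_pmf (replicate_pmf (Suc n) G) ?V"
    by (simp add: pair_pmf_def bind_assoc_pmf bind_return_pmf)
  finally show ?case .
qed

text \<open>After a time step the queue lengths have their initial law again, independently of the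
  output, so each step contributes \<open>v\<close>. Nonnegative integrals avoid integrability for
  the unbounded queue lengths.\<close>

lemma nn_integral_queue_output:
  assumes v: "0 < v" "v < 1/2"
  defines "G \<equiv> geometric_pmf ((1 - 2 * v) / (1 - v))"
  shows "(\<integral>\<^sup>+ds. \<integral>\<^sup>+rs. of_nat (queue_output ds rs)
      \<partial>replicate_pmf l (pair_pmf (replicate_pmf n (bernoulli_pmf (1/2))) (bernoulli_pmf v))
      \<partial>replicate_pmf n G) = of_nat l * ennreal v"
proof (induction l)
  case 0
  show ?case by simp
next
  case (Suc l)
  let ?B = "bernoulli_pmf (1/2)" and ?V = "bernoulli_pmf v"
  let ?R = "replicate_pmf l (pair_pmf (replicate_pmf n ?B) ?V)"
  let ?f = "\<lambda>q. (\<integral>\<^sup>+rs. of_bool (snd q) + of_nat (queue_output (fst q) rs) \<partial>?R) :: ennreal"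
  have "(\<integral>\<^sup>+ds. \<integral>\<^sup>+rs. of_nat (queue_output ds rs) \<partial>replicate_pmf (Suc l) (pair_pmf (replicate_pmf n ?B) ?V)
      \<partial>replicate_pmf n G) = (\<integral>\<^sup>+ds. \<integral>\<^sup>+es. \<integral>\<^sup>+w. ?f (queue_row ds es w) \<partial>?V \<partial>replicate_pmf n ?B \<partial>replicate_pmf n G)"
    by (simp add: nn_integral_pair_pmf' split_beta Let_def)
  also have "\<dots> = (\<integral>\<^sup>+q. ?f q \<partial>measure_pmf (do {ds \<leftarrow> replicate_pmf n G; es \<leftarrow> replicate_pmf n ?B; w \<leftarrow> ?V;
      return_pmf (queue_row ds es w)}))"
    by simp
  also have "\<dots> = (\<integral>\<^sup>+ds. \<integral>\<^sup>+w. ?f (ds, w) \<partial>?V \<partial>replicate_pmf n G)"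
    unfolding G_def queue_row_law[OF v] by (simp add: nn_integral_pair_pmf')
  also have "\<dots> = (\<integral>\<^sup>+ds. \<integral>\<^sup>+w. of_bool w + (\<integral>\<^sup>+rs. of_nat (queue_output ds rs) \<partial>?R) \<partial>?V \<partial>replicate_pmf n G)"
    by (simp add: nn_integral_add)
  also have "\<dots> = ennreal v + of_nat l * ennreal v"
    using v Suc by (simp add: nn_integral_add)
  finally show ?case by (simp add: distrib_right add.commute)
qed

section \<open>Exponential moments of queue lengths and of first-passage values\<close>

lemma queue_parameter:
  fixes c :: real
  assumes "0 < c" "c < 1"
  defines "v \<equiv> (1 - c) / 2"
  defines "p \<equiv> (1 - 2 * v) / (1 - v)"
  shows "0 < p" "p \<le> 1" "(1 - c) / (2 * c) = (1 - p) / p"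
proof -
  have "1 - 2 * v = c" "1 - v = (1 + c) / 2" by (simp_all add: v_def field_simps)
  then have "p = c / ((1 + c) / 2)" unfolding p_def by (simp only:)
  then have p: "p = 2 * c / (1 + c)" by simp
  have "1 - p = (1 - c) / (1 + c)" unfolding p using assms(1) by (simp add: divide_simps)
  then show "(1 - c) / (2 * c) = (1 - p) / p" using assms(1) by (simp add: p)
  show "0 < p" "p \<le> 1" using assms(1,2) by (auto simp: p field_simps)
qed

text \<open>The geometric law with mean \<open>m\<close> has Laplace transform 1/(1 + m (1 -
  exp(-t))). The inequality 1/(1 + y) \<le> 1 - y + y^2, applied to y = t and to y = m (1 -
  exp(-t)), keeps the linear term exact and makes the error quadratic in \<open>t\<close>.\<close>

lemma nn_integral_exp_geometric:
  assumes c: "0 < c" "c < 1" and "t \<ge> 0"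
  defines "v \<equiv> (1 - c) / 2" and "m \<equiv> (1 - c) / (2 * c)"
  shows "(\<integral>\<^sup>+d. ennreal (exp (- t * real d)) \<partial>geometric_pmf ((1 - 2 * v) / (1 - v))) \<le>
     ennreal (exp (- t * m + t\<^sup>2 * (m + m\<^sup>2)))"
proof -
  define p where "p = (1 - 2 * v) / (1 - v)"
  have p: "0 < p" "p \<le> 1" and m: "m = (1 - p) / p"
    using queue_parameter[OF c] by (simp_all add: p_def m_def v_def)
  have m0: "m \<ge> 0" using c by (simp add: m_def)
  define z where "z = exp (- t)"
  have z: "0 < z" "z \<le> 1" using \<open>t \<ge> 0\<close> by (auto simp: z_def)
  have pz: "0 \<le> (1 - p) * z" "(1 - p) * z < 1"
    using p z mult_left_mono[of z 1 "1 - p"] by auto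
  have "(\<integral>\<^sup>+d. ennreal (exp (- t * real d)) \<partial>geometric_pmf p) = (\<Sum>d. ennreal (p * ((1 - p) * z) ^ d))"
    unfolding nn_integral_measure_pmf nn_integral_count_space_nat
    using p z by (intro suminf_cong) (simp add: ennreal_mult[symmetric] z_def exp_of_nat_mult[symmetric]
        power_mult_distrib mult_ac)
  also have "\<dots> = ennreal (p * (1 / (1 - (1 - p) * z)))"
    using p pz by (intro suminf_ennreal_eq sums_mult geometric_sums) auto
  also have "p * (1 / (1 - (1 - p) * z)) = 1 / (1 + m * (1 - z))"
    using p pz by (simp add: m field_simps)
  also have "ennreal \<dots> \<le> ennreal (exp (- t * m + t\<^sup>2 * (m + m\<^sup>2)))"
  proof (rule ennreal_leI)
    have inv_le: "1 / (1 + y) \<le> 1 - y + y\<^sup>2" if "y \<ge> 0" for y :: real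
    proof -
      have "(1 - y + y\<^sup>2) * (1 + y) = 1 + y ^ 3" by (simp add: power2_eq_square power3_eq_cube algebra_simps)
      then have "1 \<le> (1 - y + y\<^sup>2) * (1 + y)" using that by simp
      then show ?thesis using that by (simp add: divide_le_eq)
    qed
    define x where "x = m * (1 - z)"
    have x0: "x \<ge> 0" using m0 z by (simp add: x_def)
    have "z \<le> 1 / (1 + t)"
      using exp_ge_add_one_self[of t] \<open>t \<ge> 0\<close> by (simp add: z_def exp_minus divide_simps)
    then have zu: "1 - z \<ge> t - t\<^sup>2" using inv_le[OF \<open>t \<ge> 0\<close>] by linarith
    have zl: "1 - z \<le> t" using exp_ge_add_one_self[of "- t"] by (simp add: z_def)
    have "x \<le> m * t" unfolding x_def using zl m0 by (rule mult_left_mono)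
    then have "x\<^sup>2 \<le> (m * t)\<^sup>2" using x0 by (rule power_mono)
    moreover have "x \<ge> m * t - m * t\<^sup>2"
      unfolding x_def using mult_left_mono[OF zu m0] by (simp add: algebra_simps)
    ultimately have le: "- x + x\<^sup>2 \<le> - t * m + t\<^sup>2 * (m + m\<^sup>2)"
      by (simp add: power_mult_distrib algebra_simps)
    have "1 / (1 + x) \<le> 1 + (- x + x\<^sup>2)" using inv_le[OF x0] by simp
    also have "\<dots> \<le> exp (- x + x\<^sup>2)" by (rule exp_ge_add_one_self)
    also have "\<dots> \<le> exp (- t * m + t\<^sup>2 * (m + m\<^sup>2))" using le by simp
    finally show "1 / (1 + m * (1 - z)) \<le> exp (- t * m + t\<^sup>2 * (m + m\<^sup>2))" unfolding x_def .
  qed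
  finally show ?thesis unfolding p_def .
qed

text \<open>The bounded-difference inequality in exponential form. Averaging out all later
  coordinates leaves a function \<open>g\<close> of the first one whose values lie in an interval of
  length one; Hoeffding's lemma gives the factor exp(t^2/8), and the other coordinates are handled
  by induction.\<close>

lemma mcdiarmid_mgf:
  fixes f :: "'a list \<Rightarrow> real"
  assumes fin: "finite (set_pmf p)" and t: "t > 0"
    and f: "\<And>pre x y post. \<bar>f (pre @ x # post) - f (pre @ y # post)\<bar> \<le> 1"
  shows "measure_pmf.expectation (replicate_pmf n p) (\<lambda>xs. exp (- t * f xs)) \<le>
    exp (- t * measure_pmf.expectation (replicate_pmf n p) f + real n * t\<^sup>2 / 8)"
  using f
proof (induction n arbitrary: f)
  case 0
  show ?case by simp
next
  case (Suc n)
  define g where "g x = measure_pmf.expectation (replicate_pmf n p) (\<lambda>xs. f (x # xs))" for x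
  have fin_n: "finite (set_pmf (replicate_pmf n p))" using fin by (rule finite_set_replicate_pmf)
  have int: "integrable (measure_pmf p) h" "integrable (measure_pmf (replicate_pmf n p)) k"
    for h :: "'a \<Rightarrow> real" and k :: "'a list \<Rightarrow> real"
    using fin fin_n by (auto intro: integrable_measure_pmf_finite)
  have g_diff: "\<bar>g x - g y\<bar> \<le> 1" for x y
  proof -
    have "\<bar>g x - g y\<bar> = \<bar>measure_pmf.expectation (replicate_pmf n p) (\<lambda>xs. f (x # xs) - f (y # xs))\<bar>"
      unfolding g_def using int by simp
    also have "\<dots> \<le> measure_pmf.expectation (replicate_pmf n p) (\<lambda>xs. \<bar>f (x # xs) - f (y # xs)\<bar>)"
      by (rule integral_abs_bound)
    also have "\<dots> \<le> 1"
      by (rule measure_pmf.integral_le_const)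
         (use int Suc.prems[of "[]"] in auto)
    finally show ?thesis .
  qed
  define a where "a = Max (g ` set_pmf p)"
  have a: "g x \<le> a" "a - 1 \<le> g x" if "x \<in> set_pmf p" for x
  proof -
    show "g x \<le> a" unfolding a_def using fin that by (intro Max_ge) auto
    have "a \<in> g ` set_pmf p" unfolding a_def using fin by (intro Max_in) (auto simp: set_pmf_not_empty)
    then obtain y where "a = g y" by blast
    then show "a - 1 \<le> g x" using g_diff[of y x] by linarith
  qed
  \<comment> \<open>The sign is reversed because Hoeffding's lemma is applied with positive
    \<open>t\<close>, whereas the exponent here is \<open>- t * g x\<close>.\<close>
  interpret interval_bounded_random_variable "measure_pmf p" "\<lambda>x. - g x" "- a" "1 - a"
    by unfold_locales (use a in \<open>force simp: AE_measure_pmf_iff\<close>)+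
  have "ennreal (measure_pmf.expectation p (\<lambda>x. exp (t * (- g x - measure_pmf.expectation p (\<lambda>x. - g x))))) \<le>
      ennreal (exp (t\<^sup>2 * (1 - a - - a)\<^sup>2 / 8))"
    using Hoeffdings_lemma_nn_integral[OF t] int by (subst nn_integral_eq_integral[symmetric]) auto
  then have "measure_pmf.expectation p (\<lambda>x. exp (- t * g x) * exp (t * measure_pmf.expectation p g)) \<le> exp (t\<^sup>2 / 8)"
    by (simp add: exp_add[symmetric] algebra_simps)
  then have "measure_pmf.expectation p (\<lambda>x. exp (- t * g x)) * exp (t * measure_pmf.expectation p g) \<le> exp (t\<^sup>2 / 8)"
    by simp
  then have "measure_pmf.expectation p (\<lambda>x. exp (- t * g x)) \<le> exp (t\<^sup>2 / 8) / exp (t * measure_pmf.expectation p g)"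
    by (simp add: field_simps)
  also have "\<dots> = exp (- t * measure_pmf.expectation p g + t\<^sup>2 / 8)"
    by (simp add: exp_diff[symmetric])
  finally have outer: "measure_pmf.expectation p (\<lambda>x. exp (- t * g x)) \<le>
      exp (- t * measure_pmf.expectation p g + t\<^sup>2 / 8)" .
  have inner: "measure_pmf.expectation (replicate_pmf n p) (\<lambda>xs. exp (- t * f (x # xs))) \<le>
      exp (- t * g x) * exp (real n * t\<^sup>2 / 8)" for x
    using Suc.IH[of "\<lambda>xs. f (x # xs)"] Suc.prems[of "x # _"]
    by (simp add: g_def exp_add[symmetric])
  have "measure_pmf.expectation (replicate_pmf (Suc n) p) (\<lambda>xs. exp (- t * f xs)) =
      measure_pmf.expectation p (\<lambda>x. measure_pmf.expectation (replicate_pmf n p) (\<lambda>xs. exp (- t * f (x # xs))))"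
    by (rule expectation_replicate_pmf_Suc[OF fin])
  also have "\<dots> \<le> measure_pmf.expectation p (\<lambda>x. exp (- t * g x) * exp (real n * t\<^sup>2 / 8))"
    by (intro integral_mono int inner)
  also have "\<dots> = measure_pmf.expectation p (\<lambda>x. exp (- t * g x)) * exp (real n * t\<^sup>2 / 8)"
    by simp
  also have "\<dots> \<le> exp (- t * measure_pmf.expectation p g + t\<^sup>2 / 8) * exp (real n * t\<^sup>2 / 8)"
    using outer by (rule mult_right_mono) simp
  also have "\<dots> = exp (- t * measure_pmf.expectation p g + real (Suc n) * t\<^sup>2 / 8)"
    by (simp add: exp_add[symmetric] algebra_simps add_divide_distrib)
  also have "measure_pmf.expectation p g = measure_pmf.expectation (replicate_pmf (Suc n) p) f"
    unfolding g_def by (rule expectation_replicate_pmf_Suc[OF fin, symmetric])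
  finally show ?case .
qed

lemma map_fst_replicate_pmf: "map_pmf (map fst) (replicate_pmf n (pair_pmf p q)) = replicate_pmf n p"
proof (induction n)
  case (Suc n)
  have "map_pmf (map fst) (replicate_pmf (Suc n) (pair_pmf p q)) =
      pair_pmf p q \<bind> (\<lambda>x. map_pmf (map fst) (replicate_pmf n (pair_pmf p q)) \<bind> (\<lambda>xs. return_pmf (fst x # xs)))"
    by (simp add: map_bind_pmf bind_map_pmf)
  also have "\<dots> = map_pmf fst (pair_pmf p q) \<bind> (\<lambda>x. replicate_pmf n p \<bind> (\<lambda>xs. return_pmf (x # xs)))"
    unfolding Suc by (simp add: bind_map_pmf)
  finally show ?case by (simp add: map_fst_pair_pmf)
qed simp

lemma nn_integral_replicate_fst:
  "(\<integral>\<^sup>+rs. f (map fst rs) \<partial>replicate_pmf n (pair_pmf p q)) = (\<integral>\<^sup>+rs. f rs \<partial>replicate_pmf n p)"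
  unfolding map_fst_replicate_pmf[of n p q, symmetric] nn_integral_map_pmf ..

lemma nn_integral_sum_take:
  fixes p :: "nat pmf"
  shows "k \<le> n \<Longrightarrow> (\<integral>\<^sup>+ds. of_nat (sum_list (take k ds)) \<partial>replicate_pmf n p) = of_nat k * (\<integral>\<^sup>+d. of_nat d \<partial>p)"
proof (induction n arbitrary: k)
  case (Suc n)
  show ?case
  proof (cases k)
    case (Suc k')
    then show ?thesis using Suc.IH[of k'] Suc.prems
      by (simp add: nn_integral_add distrib_right)
  qed simp
qed simp

lemma nn_integral_exp_sum_take:
  fixes p :: "nat pmf"
  shows "k \<le> n \<Longrightarrow> (\<integral>\<^sup>+ds. ennreal (exp (- t * real (sum_list (take k ds)))) \<partial>replicate_pmf n p) =
    (\<integral>\<^sup>+d. ennreal (exp (- t * real d)) \<partial>p) ^ k"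
proof (induction n arbitrary: k)
  case (Suc n)
  show ?case
  proof (cases k)
    case (Suc k')
    have "ennreal (exp (- t * real (x + y))) = ennreal (exp (- t * real x)) * ennreal (exp (- t * real y))" for x y :: nat
      by (simp add: ennreal_mult[symmetric] exp_add[symmetric] algebra_simps)
    then show ?thesis using Suc.IH[of k'] Suc.prems Suc
      by (simp add: nn_integral_cmult nn_integral_multc)
  qed simp
qed simp


text \<open>The width \<open>n\<close> stays visible because the stationary series has one queue per
  column, and the number of queues will have to grow with \<open>l\<close>.\<close>

definition mean_fpp :: "nat \<Rightarrow> nat \<Rightarrow> nat \<Rightarrow> real" where
  "mean_fpp n l k = measure_pmf.expectation (replicate_pmf l (replicate_pmf n (bernoulli_pmf (1/2))))
     (\<lambda>rs. real (fpp k rs))"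

lemma finite_coin_rows: "finite (set_pmf (replicate_pmf n (bernoulli_pmf (1/2))))"
  by (rule finite_set_replicate_pmf) simp

lemma nn_integral_fpp:
  "(\<integral>\<^sup>+rs. of_nat (fpp k rs) \<partial>replicate_pmf l (replicate_pmf n (bernoulli_pmf (1/2)))) =
    ennreal (mean_fpp n l k)"
  unfolding mean_fpp_def
  by (subst nn_integral_eq_integral[symmetric])
     (auto simp: ennreal_of_nat_eq_real_of_nat
        intro!: integrable_measure_pmf_finite finite_set_replicate_pmf[OF finite_coin_rows])

lemma nn_integral_exp_fpp:
  assumes "t > 0"
  shows "(\<integral>\<^sup>+rs. ennreal (exp (- t * real (fpp k rs))) \<partial>replicate_pmf l (replicate_pmf n (bernoulli_pmf (1/2)))) \<le>
    ennreal (exp (- t * mean_fpp n l k + real l * t\<^sup>2 / 8))"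
proof -
  have "(\<integral>\<^sup>+rs. ennreal (exp (- t * real (fpp k rs))) \<partial>replicate_pmf l (replicate_pmf n (bernoulli_pmf (1/2)))) =
      ennreal (measure_pmf.expectation (replicate_pmf l (replicate_pmf n (bernoulli_pmf (1/2))))
        (\<lambda>rs. exp (- t * real (fpp k rs))))"
    by (intro nn_integral_eq_integral integrable_measure_pmf_finite
        finite_set_replicate_pmf[OF finite_coin_rows]) auto
  also have "\<dots> \<le> ennreal (exp (- t * mean_fpp n l k + real l * t\<^sup>2 / 8))"
    unfolding mean_fpp_def
    by (intro ennreal_leI mcdiarmid_mgf finite_coin_rows assms fpp_bounded_difference)
  finally show ?thesis .
qed

lemma nn_integral_geometric:
  assumes c: "0 < c" "c < 1"
  defines "v \<equiv> (1 - c) / 2" and "m \<equiv> (1 - c) / (2 * c)"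
  shows "(\<integral>\<^sup>+d. of_nat d \<partial>geometric_pmf ((1 - 2 * v) / (1 - v))) = ennreal m"
proof -
  define p where "p = (1 - 2 * v) / (1 - v)"
  have p: "p \<in> {0<..1}" and m: "m = (1 - p) / p"
    using queue_parameter[OF c] by (simp_all add: p_def m_def v_def)
  have "(\<integral>\<^sup>+d. of_nat d \<partial>geometric_pmf p) = (\<integral>\<^sup>+d. ennreal (real d) \<partial>geometric_pmf p)"
    by (simp add: ennreal_of_nat_eq_real_of_nat)
  also have "\<dots> = ennreal (measure_pmf.expectation (geometric_pmf p) real)"
    using p by (intro nn_integral_eq_integral integrable_real_geometric_pmf) auto
  also have "\<dots> = ennreal m" using expectation_geometric_pmf[OF p] m by simp
  finally show ?thesis unfolding p_def .
qed

section \<open>The stationary series of queues at a fixed rate\<close>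

context
  fixes c :: real and n l :: nat
  assumes c: "0 < c" "c < 1"
begin

text \<open>With c = 1 - 2v as parameter, the rate that is optimal for the slope \<alpha> is simply
  c = sqrt \<alpha>.\<close>

definition "departure_rate \<equiv> (1 - c) / 2"
definition "mean_queue \<equiv> (1 - c) / (2 * c)"
definition "queue_pmf \<equiv> geometric_pmf ((1 - 2 * departure_rate) / (1 - departure_rate))"
definition "service_pmf \<equiv> replicate_pmf l (pair_pmf (replicate_pmf n (bernoulli_pmf (1/2))) (bernoulli_pmf departure_rate))"

lemma departure_rate: "0 < departure_rate" "departure_rate < 1/2" and mean_queue: "mean_queue > 0"
  using c by (auto simp: departure_rate_def mean_queue_def)

lemma lengths:
  assumes "ds \<in> set_pmf (replicate_pmf n queue_pmf)" "rs \<in> set_pmf service_pmf"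
  shows "length ds = n" "(es, w) \<in> set rs \<Longrightarrow> length es = length ds"
proof -
  show "length ds = n" using assms(1) by (simp add: set_replicate_pmf)
  then show "(es, w) \<in> set rs \<Longrightarrow> length es = length ds"
    using assms(2) by (auto simp: service_pmf_def set_replicate_pmf lists_eq_set)
qed

text \<open>The expectation of \<open>queue_output_le\<close>: stationarity fixes the mean output,
  and the first \<open>k\<close> queues have mean content \<open>k * mean_queue\<close>. This is the
  easy half of the duality.\<close>

lemma mean_fpp_lower_bound:
  assumes "k < n"
  shows "real l * departure_rate \<le> mean_fpp n l k + real k * mean_queue"
proof -
  have "of_nat l * ennreal departure_rate = (\<integral>\<^sup>+ds. \<integral>\<^sup>+rs. of_nat (queue_output ds rs) \<partial>service_pmf \<partial>replicate_pmf n queue_pmf)"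
    unfolding queue_pmf_def service_pmf_def by (rule nn_integral_queue_output[OF departure_rate, symmetric])
  also have "\<dots> \<le> (\<integral>\<^sup>+ds. \<integral>\<^sup>+rs. of_nat (fpp k (map fst rs)) + of_nat (sum_list (take k ds)) \<partial>service_pmf \<partial>replicate_pmf n queue_pmf)"
  proof (intro nn_integral_mono_AE, unfold AE_measure_pmf_iff, intro ballI)
    fix ds assume ds: "ds \<in> set_pmf (replicate_pmf n queue_pmf)"
    show "(\<integral>\<^sup>+rs. of_nat (queue_output ds rs) \<partial>service_pmf) \<le>
      (\<integral>\<^sup>+rs. of_nat (fpp k (map fst rs)) + of_nat (sum_list (take k ds)) \<partial>service_pmf)"
    proof (intro nn_integral_mono_AE, unfold AE_measure_pmf_iff, intro ballI)
      fix rs assume rs: "rs \<in> set_pmf service_pmf"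
      have "queue_output ds rs \<le> fpp k (map fst rs) + sum_list (take k ds)"
        using assms lengths[OF ds rs] by (intro queue_output_le) auto
      then show "of_nat (queue_output ds rs) \<le> (of_nat (fpp k (map fst rs)) + of_nat (sum_list (take k ds)) :: ennreal)"
        by (metis of_nat_add of_nat_mono)
    qed
  qed
  also have "\<dots> = ennreal (mean_fpp n l k) + of_nat k * (\<integral>\<^sup>+d. of_nat d \<partial>queue_pmf)"
    unfolding service_pmf_def using assms
    by (simp add: nn_integral_add nn_integral_replicate_fst[where f = "\<lambda>rs. of_nat (fpp k rs)"]
        nn_integral_fpp nn_integral_sum_take)
  also have "(\<integral>\<^sup>+d. of_nat d \<partial>queue_pmf) = ennreal mean_queue"
    unfolding queue_pmf_def departure_rate_def mean_queue_def by (rule nn_integral_geometric[OF c])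
  finally have "ennreal (real l * departure_rate) \<le> ennreal (mean_fpp n l k + real k * mean_queue)"
    using departure_rate mean_queue by (simp add: ennreal_mult ennreal_of_nat_eq_real_of_nat mean_fpp_def)
  moreover have "mean_fpp n l k + real k * mean_queue \<ge> 0" using mean_queue by (simp add: mean_fpp_def)
  ultimately show ?thesis by simp
qed

text \<open>Jensen's inequality, avoiding integrability, through the tangent of the exponential at \<open>l departure_rate\<close>.\<close>

lemma exp_queue_output_lower_bound:
  assumes t: "t > 0"
  shows "ennreal (exp (- t * (real l * departure_rate))) \<le>
    (\<integral>\<^sup>+ds. \<integral>\<^sup>+rs. ennreal (exp (- t * real (queue_output ds rs))) \<partial>service_pmf \<partial>replicate_pmf n queue_pmf)"
proof -
  define a where "a = real l * departure_rate"
  have a: "a \<ge> 0" using departure_rate by (simp add: a_def)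
  define b where "b = exp (- t * a) * t"
  have b: "b \<ge> 0" using t by (simp add: b_def)
  have tangent: "exp (- t * a) * (1 + t * a) \<le> exp (- t * x) + b * x" for x
  proof -
    have "exp (- t * a) * (1 + (- t * (x - a))) \<le> exp (- t * a) * exp (- t * (x - a))"
      by (intro mult_left_mono exp_ge_add_one_self) auto
    also have "\<dots> = exp (- t * x)" by (simp add: exp_add[symmetric] algebra_simps)
    finally show ?thesis by (simp add: b_def algebra_simps)
  qed
  have "ennreal (exp (- t * a) * (1 + t * a)) =
      (\<integral>\<^sup>+ds. \<integral>\<^sup>+rs. ennreal (exp (- t * a) * (1 + t * a)) \<partial>service_pmf \<partial>replicate_pmf n queue_pmf)"
    by simp
  also have "\<dots> \<le> (\<integral>\<^sup>+ds. \<integral>\<^sup>+rs. ennreal (exp (- t * real (queue_output ds rs))) +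
      ennreal b * of_nat (queue_output ds rs) \<partial>service_pmf \<partial>replicate_pmf n queue_pmf)"
  proof (intro nn_integral_mono)
    fix ds rs
    have "ennreal (exp (- t * a) * (1 + t * a)) \<le>
        ennreal (exp (- t * real (queue_output ds rs)) + b * real (queue_output ds rs))"
      by (rule ennreal_leI) (rule tangent)
    also have "\<dots> = ennreal (exp (- t * real (queue_output ds rs))) + ennreal b * of_nat (queue_output ds rs)"
      using b by (simp add: ennreal_mult ennreal_of_nat_eq_real_of_nat)
    finally show "ennreal (exp (- t * a) * (1 + t * a)) \<le> \<dots>" .
  qed
  also have "\<dots> = (\<integral>\<^sup>+ds. \<integral>\<^sup>+rs. ennreal (exp (- t * real (queue_output ds rs))) \<partial>service_pmf \<partial>replicate_pmf n queue_pmf) +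
      ennreal b * (\<integral>\<^sup>+ds. \<integral>\<^sup>+rs. of_nat (queue_output ds rs) \<partial>service_pmf \<partial>replicate_pmf n queue_pmf)"
    by (simp add: nn_integral_add nn_integral_cmult)
  also have "(\<integral>\<^sup>+ds. \<integral>\<^sup>+rs. of_nat (queue_output ds rs) \<partial>service_pmf \<partial>replicate_pmf n queue_pmf) = ennreal a"
    unfolding queue_pmf_def service_pmf_def nn_integral_queue_output[OF departure_rate]
    using departure_rate by (simp add: a_def ennreal_mult ennreal_of_nat_eq_real_of_nat)
  also have "ennreal (exp (- t * a) * (1 + t * a)) = ennreal (exp (- t * a)) + ennreal b * ennreal a"
    using a b t by (simp add: b_def ennreal_mult[symmetric] ennreal_plus[symmetric] algebra_simps del: ennreal_plus)
  finally have "ennreal b * ennreal a + ennreal (exp (- t * a)) \<le> ennreal b * ennreal a +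
      (\<integral>\<^sup>+ds. \<integral>\<^sup>+rs. ennreal (exp (- t * real (queue_output ds rs))) \<partial>service_pmf \<partial>replicate_pmf n queue_pmf)"
    by (simp add: add.commute)
  then show ?thesis
    unfolding a_def[symmetric] by (rule ennreal_add_left_cancel_le[THEN iffD1, THEN disjE])
      (auto simp: ennreal_mult_eq_top_iff)
qed

text \<open>By \<open>queue_output_ge\<close> the exponential of the output is at most the sum of
  the exponentials over all columns, plus a term for the path through the arrivals. Initial lengths
  and coins are independent, so each summand factorizes and the two exponential-moment bounds apply.
  The quadratic error of \<open>k\<close> queues is enlarged to that of \<open>n\<close> queues in
  order to be a common factor.\<close>

lemma exp_queue_output_upper_bound:
  assumes t: "t > 0" and n: "n > 0"
  shows "(\<integral>\<^sup>+ds. \<integral>\<^sup>+rs. ennreal (exp (- t * real (queue_output ds rs))) \<partial>service_pmf \<partial>replicate_pmf n queue_pmf) \<le>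
    ennreal ((\<Sum>k<n. exp (- t * (mean_fpp n l k + real k * mean_queue))) + exp (- t * (real n * mean_queue))) *
    ennreal (exp (t\<^sup>2 * (real l / 8 + real n * (mean_queue + mean_queue\<^sup>2))))"
proof -
  define C where "C = mean_queue + mean_queue\<^sup>2"
  have C: "C \<ge> 0" using mean_queue by (simp add: C_def)
  define E where "E = exp (t\<^sup>2 * (real l / 8 + real n * C))"
  let ?e = "\<lambda>x :: nat. ennreal (exp (- t * real x))"
  have e_add: "?e (x + y) = ?e x * ?e y" for x y
    by (simp add: ennreal_mult[symmetric] exp_add[symmetric] algebra_simps)
  have S: "(\<integral>\<^sup>+ds. ?e (sum_list (take k ds)) \<partial>replicate_pmf n queue_pmf) \<le>
      ennreal (exp (- t * (real k * mean_queue) + t\<^sup>2 * (real n * C)))" if "k \<le> n" for k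
  proof -
    have "(\<integral>\<^sup>+ds. ?e (sum_list (take k ds)) \<partial>replicate_pmf n queue_pmf) = (\<integral>\<^sup>+d. ?e d \<partial>queue_pmf) ^ k"
      using that by (rule nn_integral_exp_sum_take)
    also have "\<dots> \<le> ennreal (exp (- t * mean_queue + t\<^sup>2 * C)) ^ k"
      unfolding queue_pmf_def departure_rate_def mean_queue_def C_def using c t by (intro power_mono nn_integral_exp_geometric) auto
    also have "\<dots> = ennreal (exp (real k * (- t * mean_queue + t\<^sup>2 * C)))"
      by (simp add: ennreal_power exp_of_nat_mult[symmetric])
    also have "\<dots> \<le> ennreal (exp (- t * (real k * mean_queue) + t\<^sup>2 * (real n * C)))"
    proof (intro ennreal_leI)
      have "t\<^sup>2 * (real k * C) \<le> t\<^sup>2 * (real n * C)" using that C by (intro mult_left_mono mult_right_mono) auto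
      then show "exp (real k * (- t * mean_queue + t\<^sup>2 * C)) \<le> exp (- t * (real k * mean_queue) + t\<^sup>2 * (real n * C))"
        by (simp add: algebra_simps)
    qed
    finally show ?thesis .
  qed
  have F: "(\<integral>\<^sup>+rs. ?e (fpp k (map fst rs)) \<partial>service_pmf) \<le> ennreal (exp (- t * mean_fpp n l k + real l * t\<^sup>2 / 8))" for k
    unfolding service_pmf_def nn_integral_replicate_fst[where f = "\<lambda>rs. ?e (fpp k rs)"] by (rule nn_integral_exp_fpp[OF t])
  have "(\<integral>\<^sup>+ds. \<integral>\<^sup>+rs. ?e (queue_output ds rs) \<partial>service_pmf \<partial>replicate_pmf n queue_pmf) \<le>
      (\<integral>\<^sup>+ds. \<integral>\<^sup>+rs. (\<Sum>k<n. ?e (sum_list (take k ds)) * ?e (fpp k (map fst rs))) + ?e (sum_list (take n ds)) \<partial>service_pmf \<partial>replicate_pmf n queue_pmf)"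
  proof (intro nn_integral_mono_AE, unfold AE_measure_pmf_iff, intro ballI)
    fix ds assume ds: "ds \<in> set_pmf (replicate_pmf n queue_pmf)"
    show "(\<integral>\<^sup>+rs. ?e (queue_output ds rs) \<partial>service_pmf) \<le>
      (\<integral>\<^sup>+rs. (\<Sum>k<n. ?e (sum_list (take k ds)) * ?e (fpp k (map fst rs))) + ?e (sum_list (take n ds)) \<partial>service_pmf)"
    proof (intro nn_integral_mono_AE, unfold AE_measure_pmf_iff, intro ballI)
      fix rs assume rs: "rs \<in> set_pmf service_pmf"
      have len: "length ds = n" using lengths(1)[OF ds rs] .
      have mono: "?e x \<le> ?e y" if "y \<le> x" for x y
        using that t by (intro ennreal_leI) auto
      have "(\<exists>k<length ds. fpp k (map fst rs) + sum_list (take k ds) \<le> queue_output ds rs) \<or>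
          sum_list ds \<le> queue_output ds rs"
        using lengths[OF ds rs] n by (intro queue_output_ge) auto
      then show "?e (queue_output ds rs) \<le>
          (\<Sum>k<n. ?e (sum_list (take k ds)) * ?e (fpp k (map fst rs))) + ?e (sum_list (take n ds))"
      proof (elim disjE exE conjE)
        fix k assume k: "k < length ds" "fpp k (map fst rs) + sum_list (take k ds) \<le> queue_output ds rs"
        have "?e (queue_output ds rs) \<le> ?e (sum_list (take k ds)) * ?e (fpp k (map fst rs))"
          unfolding e_add[symmetric] using k(2) by (intro mono) simp
        also have "\<dots> \<le> (\<Sum>k<n. ?e (sum_list (take k ds)) * ?e (fpp k (map fst rs)))"
          using k(1) len by (intro member_le_sum) auto
        finally show ?thesis by (rule order_trans) simp
      next
        assume "sum_list ds \<le> queue_output ds rs"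
        then have "?e (queue_output ds rs) \<le> ?e (sum_list (take n ds))" using len by (intro mono) simp
        then show ?thesis by (rule order_trans) simp
      qed
    qed
  qed
  also have "\<dots> = (\<Sum>k<n. (\<integral>\<^sup>+ds. ?e (sum_list (take k ds)) \<partial>replicate_pmf n queue_pmf) * (\<integral>\<^sup>+rs. ?e (fpp k (map fst rs)) \<partial>service_pmf)) +
      (\<integral>\<^sup>+ds. ?e (sum_list (take n ds)) \<partial>replicate_pmf n queue_pmf)"
    by (simp add: nn_integral_add nn_integral_sum nn_integral_cmult nn_integral_multc)
  also have "\<dots> \<le> (\<Sum>k<n. ennreal (exp (- t * (real k * mean_queue) + t\<^sup>2 * (real n * C))) *
      ennreal (exp (- t * mean_fpp n l k + real l * t\<^sup>2 / 8))) + ennreal (exp (- t * (real n * mean_queue) + t\<^sup>2 * (real n * C)))"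
    by (intro add_mono sum_mono mult_mono S F) auto
  also have "\<dots> \<le> (\<Sum>k<n. ennreal (exp (- t * (mean_fpp n l k + real k * mean_queue)) * E)) + ennreal (exp (- t * (real n * mean_queue)) * E)"
  proof (intro add_mono sum_mono)
    fix k
    show "ennreal (exp (- t * (real k * mean_queue) + t\<^sup>2 * (real n * C))) *
      ennreal (exp (- t * mean_fpp n l k + real l * t\<^sup>2 / 8)) \<le> ennreal (exp (- t * (mean_fpp n l k + real k * mean_queue)) * E)"
      by (simp add: E_def ennreal_mult[symmetric] exp_add[symmetric] algebra_simps)
  next
    show "ennreal (exp (- t * (real n * mean_queue) + t\<^sup>2 * (real n * C))) \<le> ennreal (exp (- t * (real n * mean_queue)) * E)"
      by (intro ennreal_leI) (simp add: E_def exp_add[symmetric] algebra_simps)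
  qed
  also have "\<dots> = ennreal ((\<Sum>k<n. exp (- t * (mean_fpp n l k + real k * mean_queue))) + exp (- t * (real n * mean_queue))) * ennreal E"
    by (subst sum_ennreal) (auto simp: E_def ennreal_mult[symmetric] ennreal_plus[symmetric]
        sum_nonneg sum_distrib_right distrib_right simp del: ennreal_plus)
  finally show ?thesis unfolding E_def C_def .
qed

text \<open>The hard half of the duality. If all \<open>n + 1\<close> alternatives exceeded the mean
  output by more than \<open>err\<close>, the union bound would fall below the Jensen bound. The
  number of alternatives costs \<open>ln (n + 1) / t\<close>, the concentration costs a multiple of
  \<open>t\<close>.\<close>

lemma mean_fpp_upper_bound:
  assumes t: "t > 0" and n: "n > 0"
  defines "err \<equiv> ln (real n + 1) / t + t * (real l / 8 + real n * (mean_queue + mean_queue\<^sup>2))"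
  shows "(\<exists>k<n. mean_fpp n l k + real k * mean_queue \<le> real l * departure_rate + err) \<or> real n * mean_queue \<le> real l * departure_rate + err"
proof (rule ccontr)
  assume neg: "\<not> ?thesis"
  define D where "D = t\<^sup>2 * (real l / 8 + real n * (mean_queue + mean_queue\<^sup>2))"
  define e where "e = exp (- t * (real l * departure_rate + err))"
  have "exp (- t * (mean_fpp n l k + real k * mean_queue)) \<le> e" if "k < n" for k
    using neg that t by (auto simp: e_def not_le)
  then have "(\<Sum>k<n. exp (- t * (mean_fpp n l k + real k * mean_queue))) \<le> (\<Sum>k<n. e)"
    by (intro sum_mono) auto
  moreover have "exp (- t * (real n * mean_queue)) < e"
    using neg t by (auto simp: e_def not_le)
  ultimately have "(\<Sum>k<n. exp (- t * (mean_fpp n l k + real k * mean_queue))) + exp (- t * (real n * mean_queue)) < (real n + 1) * e"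
    by (simp add: algebra_simps)
  then have "((\<Sum>k<n. exp (- t * (mean_fpp n l k + real k * mean_queue))) + exp (- t * (real n * mean_queue))) * exp D < (real n + 1) * e * exp D"
    by simp
  also have "\<dots> = exp (ln (real n + 1) + - t * (real l * departure_rate + err) + D)"
    unfolding exp_add e_def by simp
  also have "ln (real n + 1) + - t * (real l * departure_rate + err) + D = - t * (real l * departure_rate)"
    using t by (simp add: err_def D_def algebra_simps power2_eq_square)
  finally have "((\<Sum>k<n. exp (- t * (mean_fpp n l k + real k * mean_queue))) + exp (- t * (real n * mean_queue))) * exp D <
      exp (- t * (real l * departure_rate))" .
  moreover have "ennreal (exp (- t * (real l * departure_rate))) \<le>
      ennreal (((\<Sum>k<n. exp (- t * (mean_fpp n l k + real k * mean_queue))) + exp (- t * (real n * mean_queue))) * exp D)"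
    using order_trans[OF exp_queue_output_lower_bound[OF t] exp_queue_output_upper_bound[OF t n]]
    by (simp add: ennreal_mult sum_nonneg D_def)
  ultimately show False
    by (subst (asm) ennreal_le_iff) (auto simp: sum_nonneg)
qed

end

section \<open>Asymptotics for fair coins\<close>

lemma mean_fpp_antimono: "k \<le> k' \<Longrightarrow> mean_fpp n l k' \<le> mean_fpp n l k"
  unfolding mean_fpp_def
  by (intro integral_mono integrable_measure_pmf_finite finite_set_replicate_pmf[OF finite_coin_rows])
     (simp add: fpp_antimono)

lemma mean_fpp_ge:
  assumes "0 < c" "c < 1" "k < n"
  shows "real l * ((1 - c) / 2) \<le> mean_fpp n l k + real k * ((1 - c) / (2 * c))"
  using mean_fpp_lower_bound[OF assms(1,2,3), of l] assms
  by (simp add: departure_rate_def mean_queue_def)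

text \<open>Since (1 - x)/(2x) = (1/x - 1)/2, the difference of the two queue terms is I (s -
  c)/(2cs). No order between \<open>c\<close> and \<open>s\<close> is assumed: a negative
  \<open>s - c\<close> later turns the upper bound on \<open>I\<close> into a lower bound.\<close>

lemma rate_comparison:
  fixes L I e :: real
  assumes "0 < c" "0 < s"
    and le: "L * ((1 - s) / 2) - I * ((1 - s) / (2 * s)) \<le> L * ((1 - c) / 2) + e - I * ((1 - c) / (2 * c))"
  shows "I / (c * s) * (s - c) \<le> L * (s - c) + 2 * e"
proof -
  have split: "(1 - x) / (2 * x) = (1 / x - 1) / 2" if "0 < x" for x :: real
    using that by (simp add: field_simps)
  have linear: "I * (b - a) \<le> L * (s - c) + 2 * e"
    if "L * ((1 - s) / 2) - I * ((a - 1) / 2) \<le> L * ((1 - c) / 2) + e - I * ((b - 1) / 2)" for a b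
    using that by (simp add: field_simps)
  have "I * (1 / c - 1 / s) \<le> L * (s - c) + 2 * e"
    by (rule linear) (use le split assms in presburger)
  moreover have "1 / c - 1 / s = (s - c) / (c * s)"
    using assms by (simp add: field_simps)
  ultimately show ?thesis by simp
qed

text \<open>
  The lower bounds at the rates \<open>c'\<close> and \<open>s\<close> on either side of \<open>c\<close> confine the column that is
  optimal at rate \<open>c\<close>.
\<close>

lemma optimal_column_near:
  assumes c: "0 < c'" "c' < c" "c < s" "s < 1" and i: "i < n"
    and opt: "mean_fpp n l i + real i * ((1 - c) / (2 * c)) \<le> real l * ((1 - c) / 2) + e"
  shows "real i \<le> c * s * (real l + 2 * e / (s - c))"
    and "real i \<ge> c * c' * (real l - 2 * e / (c - c'))"
proof -
  have "real l * ((1 - s) / 2) - real i * ((1 - s) / (2 * s)) \<le> real l * ((1 - c) / 2) + e - real i * ((1 - c) / (2 * c))"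
    using mean_fpp_ge[of s i n l] c i opt by simp
  then have "real i / (c * s) * (s - c) \<le> real l * (s - c) + 2 * e"
    using c by (intro rate_comparison) auto
  also have "\<dots> = (real l + 2 * e / (s - c)) * (s - c)"
    using c by (simp add: distrib_right)
  finally have "real i / (c * s) \<le> real l + 2 * e / (s - c)"
    by (rule mult_right_le_imp_le) (use c in simp)
  then show "real i \<le> c * s * (real l + 2 * e / (s - c))"
    using c by (simp add: pos_divide_le_eq mult.commute)
next
  have "real l * ((1 - c') / 2) - real i * ((1 - c') / (2 * c')) \<le> real l * ((1 - c) / 2) + e - real i * ((1 - c) / (2 * c))"
    using mean_fpp_ge[of c' i n l] c i opt by simp
  then have "real i / (c * c') * (c' - c) \<le> real l * (c' - c) + 2 * e"
    using c by (intro rate_comparison) auto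
  then have "real l * (c - c') - 2 * e \<le> real i / (c * c') * (c - c')"
    by (simp only: right_diff_distrib)
  moreover have "real l * (c - c') - 2 * e = (real l - 2 * e / (c - c')) * (c - c')"
    using c by (simp add: left_diff_distrib)
  ultimately have "(real l - 2 * e / (c - c')) * (c - c') \<le> real i / (c * c') * (c - c')"
    by (simp only:)
  then have "real l - 2 * e / (c - c') \<le> real i / (c * c')"
    by (rule mult_right_le_imp_le) (use c in simp)
  then show "real i \<ge> c * c' * (real l - 2 * e / (c - c'))"
    using c by (simp add: pos_le_divide_eq mult.commute)
qed

text \<open>The lower bound is duality at the optimal rate s = sqrt \<alpha>, where (1 - s)/2 - s^2
  (1 - s)/(2s) = (1 - s)^2 / 2. For the upper bound a slightly smaller rate \<open>c\<close> is
  taken. Its optimal column lies near c^2 l, so it stays to the left of \<alpha> l, and monotonicity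
  in the column carries its value over.\<close>

lemma mean_fpp_asymp:
  assumes \<alpha>: "0 < \<alpha>" "\<alpha> < 1" and \<eta>: "\<eta> > 0"
  shows "\<forall>\<^sub>F l in sequentially. \<exists>n > nat \<lfloor>real l * \<alpha>\<rfloor>.
    mean_fpp n l (nat \<lfloor>real l * \<alpha>\<rfloor>) \<in> {real l * ((1 - sqrt \<alpha>)\<^sup>2 / 2) .. real l * ((1 - sqrt \<alpha>)\<^sup>2 / 2 + \<eta>)}"
proof -
  define s where "s = sqrt \<alpha>"
  have s: "0 < s" "s < 1" "s\<^sup>2 = \<alpha>" using \<alpha> by (auto simp: s_def)
  \<comment> \<open>\<open>d \<le> s / 4\<close> keeps \<open>c' = s - 2 * d\<close> positive;
    \<open>8 * d \<le> \<eta>\<close> pays for replacing (1 - c)(1 - c') by (1 - s)^2.\<close>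
  define d where "d = min (s / 4) (\<eta> / 8)"
  have d: "0 < d" "4 * d \<le> s" "8 * d \<le> \<eta>" using s \<eta> by (auto simp: d_def min_def)
  define c c' where "c = s - d" and "c' = s - 2 * d"
  have c: "0 < c'" "c' < c" "c < s" "c < 1" using d s by (auto simp: c_def c'_def)
  define m where "m = (1 - c) / (2 * c)"
  have m: "m > 0" using c by (simp add: m_def)
  define K where "K = m + m\<^sup>2"
  have K: "K > 0" using m by (simp add: K_def add_pos_pos)
  \<comment> \<open>With \<open>n = A * l + 1\<close> queues the mean total content is at least
    \<open>l\<close>, more than the mean output, which rules out the path through the
    arrivals.\<close>
  obtain A :: nat where A: "real A > 1 / m" using reals_Archimedean2 by blast
  have Am: "real A * m \<ge> 1" and A1: "real A \<ge> 1"
    using A m by (auto simp: divide_less_eq mult.commute intro: less_imp_le) (cases A, auto)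
  \<comment> \<open>The error of \<open>mean_fpp_upper_bound\<close> at
    \<open>t = 1 / sqrt l\<close>, where both of its parts are o(l).\<close>
  define err where "err l = ln (real A * l + 2) * sqrt l + (l / 8 + (real A * l + 1) * K) / sqrt l" for l :: real
  \<comment> \<open>The three entries serve, in order, to rule out the arrivals, to keep the optimal
    column left of \<alpha> l, and to keep the final error within \<eta>/2.\<close>
  define \<kappa> where "\<kappa> = min (1/4) (min (d\<^sup>2 / 2) (\<eta> / 2 / (1 + 1 / d)))"
  have \<kappa>: "\<kappa> > 0" "\<kappa> \<le> 1/4" "\<kappa> \<le> d\<^sup>2 / 2" "\<kappa> * (1 + 1 / d) \<le> \<eta> / 2"
  proof -
    have "1 + 1 / d > 0" using d by (simp add: add_pos_pos)
    then show "\<kappa> > 0" using d \<eta> by (simp add: \<kappa>_def)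
    have "\<kappa> \<le> \<eta> / 2 / (1 + 1 / d)" unfolding \<kappa>_def by (intro min.coboundedI2 order_refl)
    then show "\<kappa> * (1 + 1 / d) \<le> \<eta> / 2"
      unfolding pos_le_divide_eq[OF \<open>1 + 1 / d > 0\<close>] .
    show "\<kappa> \<le> 1 / 4" unfolding \<kappa>_def by (rule min.cobounded1)
    show "\<kappa> \<le> d\<^sup>2 / 2" unfolding \<kappa>_def by (rule min.coboundedI2) (rule min.cobounded1)
  qed
  have "(\<lambda>l :: nat. err (real l) / real l) \<longlonglongrightarrow> 0"
    using A1 K unfolding err_def by real_asymp
  then have "\<forall>\<^sub>F l in sequentially. err (real l) / real l < \<kappa>"
    using \<kappa>(1) by (rule order_tendstoD)
  then show ?thesis
    using eventually_gt_at_top[of 0]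
  proof eventually_elim
    case (elim l)
    then have l: "real l > 0" and e: "err (real l) \<le> \<kappa> * real l" by (auto simp: divide_less_eq less_imp_le)
    define n where "n = A * l + 1"
    define k where "k = nat \<lfloor>real l * \<alpha>\<rfloor>"
    have k: "real k \<le> real l * \<alpha>" using l \<alpha> by (simp add: k_def)
    have "real l * \<alpha> \<le> real l * real A" using A1 \<alpha> l by (intro mult_left_mono) auto
    then have "real k < real n" using k by (simp add: n_def mult.commute)
    then have kn: "k < n" by (simp only: of_nat_less_iff)
    have lower: "real l * ((1 - s)\<^sup>2 / 2) \<le> mean_fpp n l k"
    proof -
      have "real k * ((1 - s) / (2 * s)) \<le> (real l * s\<^sup>2) * ((1 - s) / (2 * s))"
        using k s by (intro mult_right_mono) auto
      also have "\<dots> = real l * s * (1 - s) / 2" using s(1) by (simp add: power2_eq_square)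
      finally have "real k * ((1 - s) / (2 * s)) \<le> real l * s * (1 - s) / 2" .
      moreover have "real l * ((1 - s)\<^sup>2 / 2) = real l * ((1 - s) / 2) - real l * s * (1 - s) / 2"
        by (simp add: power2_eq_square field_simps)
      ultimately show ?thesis using mean_fpp_ge[OF s(1,2) kn, of l] by linarith
    qed
    have upper: "mean_fpp n l k \<le> real l * ((1 - s)\<^sup>2 / 2 + \<eta>)"
    proof -
      have err_eq: "ln (real n + 1) / (1 / sqrt l) + 1 / sqrt l * (real l / 8 + real n * (m + m\<^sup>2)) = err (real l)"
        by (simp add: err_def n_def K_def add.commute)
      have "(\<exists>i<n. mean_fpp n l i + real i * m \<le> real l * ((1 - c) / 2) + err (real l)) \<or>
          real n * m \<le> real l * ((1 - c) / 2) + err (real l)"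
        using mean_fpp_upper_bound[of c "1 / sqrt l" n l] c l err_eq
        by (simp add: departure_rate_def mean_queue_def m_def n_def)
      moreover have "\<not> real n * m \<le> real l * ((1 - c) / 2) + err (real l)"
      proof -
        have "1 * real l \<le> real A * m * real l" using Am l by (intro mult_right_mono) auto
        also have "\<dots> \<le> real n * m" using m by (simp add: n_def algebra_simps)
        finally have "real l \<le> real n * m" by simp
        moreover have "real l * ((1 - c) / 2) \<le> real l * (1 / 2)" using l c by (intro mult_left_mono) auto
        moreover have "\<kappa> * real l \<le> 1 / 4 * real l" using \<kappa> l by (intro mult_right_mono) auto
        ultimately show ?thesis using e l by linarith
      qed
      ultimately obtain i where i: "i < n"
        "mean_fpp n l i + real i * m \<le> real l * ((1 - c) / 2) + err (real l)" by blast
      then have opt: "mean_fpp n l i + real i * ((1 - c) / (2 * c)) \<le> real l * ((1 - c) / 2) + \<kappa> * real l"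
        using e by (simp add: m_def)
      have sc: "s - c = d" "c - c' = d" by (auto simp: c_def c'_def)
      note near = optimal_column_near[OF c(1,2,3) s(2) i(1) opt, unfolded sc]
      \<comment> \<open>The gap \<open>d\<close> between \<open>c\<close> and \<open>s\<close>
        absorbs the error term.\<close>
      have "real i \<le> real l * \<alpha>"
      proof -
        have "2 * \<kappa> / d \<le> d" using \<kappa>(3) d by (simp add: divide_le_eq power2_eq_square)
        then have "c * s * (1 + 2 * \<kappa> / d) \<le> c * s * (1 + d)" using c s by (intro mult_left_mono) auto
        also have "\<dots> = s * (c + c * d)" by (simp add: algebra_simps)
        also have "\<dots> \<le> s * (c + 1 * d)" using c s d by (intro mult_left_mono add_left_mono mult_right_mono) auto
        also have "\<dots> = \<alpha>" using s by (simp add: c_def power2_eq_square)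
        finally have "real l * (c * s * (1 + 2 * \<kappa> / d)) \<le> real l * \<alpha>" using l by (intro mult_left_mono) auto
        then show ?thesis using near(1) by (simp add: algebra_simps)
      qed
      then have "i \<le> k" unfolding k_def using l \<alpha> by (simp add: le_nat_floor)
      then have "mean_fpp n l k \<le> mean_fpp n l i" by (rule mean_fpp_antimono)
      also have "\<dots> \<le> real l * ((1 - c) / 2) + \<kappa> * real l - real i * ((1 - c) / (2 * c))"
        using opt by simp
      \<comment> \<open>The lower confinement of \<open>i\<close> enters here: subtracting c c' l (1
        - c)/(2c) from l (1 - c)/2 leaves l (1 - c)(1 - c')/2.\<close>
      also have "\<dots> \<le> real l * ((1 - c) / 2) + \<kappa> * real l -
          (c * c' * (real l - 2 * (\<kappa> * real l) / d)) * ((1 - c) / (2 * c))"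
        using near(2) c by (intro diff_left_mono mult_right_mono) auto
      also have "\<dots> = real l * ((1 - c) * (1 - c') / 2 + \<kappa> + c' * (1 - c) * (\<kappa> / d))"
        using c d by (simp add: field_simps)
      also have "\<dots> \<le> real l * ((1 - c) * (1 - c') / 2 + \<kappa> + 1 * 1 * (\<kappa> / d))"
        using l c d \<kappa>(1) s by (intro mult_left_mono add_left_mono mult_right_mono mult_mono) auto
      also have "\<dots> \<le> real l * ((1 - s)\<^sup>2 / 2 + \<eta>)"
      proof (intro mult_left_mono)
        have "(1 - c) * (1 - c') = (1 - s)\<^sup>2 + 3 * d * (1 - s) + 2 * d\<^sup>2"
          by (simp add: c_def c'_def power2_eq_square algebra_simps)
        also have "\<dots> \<le> (1 - s)\<^sup>2 + 3 * d * 1 + 2 * (d * 1)"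
          using d s unfolding power2_eq_square by (intro add_mono mult_left_mono) auto
        also have "\<dots> \<le> (1 - s)\<^sup>2 + \<eta>" using d by simp
        finally have "(1 - c) * (1 - c') \<le> (1 - s)\<^sup>2 + \<eta>" .
        moreover have "\<kappa> * (1 + 1 / d) = \<kappa> + \<kappa> / d" by (simp add: distrib_left)
        ultimately show "(1 - c) * (1 - c') / 2 + \<kappa> + 1 * 1 * (\<kappa> / d) \<le> (1 - s)\<^sup>2 / 2 + \<eta>"
          using \<kappa>(4) by linarith
      qed (use l in auto)
      finally show ?thesis .
    qed
    show ?case using kn lower upper unfolding k_def s_def by (intro exI[of _ n]) auto
  qed
qed

section \<open>The joint law of environment and weights\<close>

lemma env_spaceD:
  assumes "F \<in> space env_space"
  shows "prob_space (F j)" "sets (F j) = sets borel" "space (F j) = UNIV"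
proof -
  show "prob_space (F j)" "sets (F j) = sets borel"
    using assms by (auto simp: env_space_def space_PiM space_prob_algebra)
  then show "space (F j) = UNIV" using sets_eq_imp_space_eq[of "F j" borel] by simp
qed

lemma iid_envD:
  assumes "iid_env P"
  shows "prob_space P" "sets P = sets env_space" "space P = space env_space"
    "prob_space.indep_vars P (\<lambda>_. prob_algebra borel) (\<lambda>j F. F j) UNIV"
    "distr P (prob_algebra borel) (\<lambda>F. F j) = distr P (prob_algebra borel) (\<lambda>F. F 0)"
proof -
  show sets: "sets P = sets env_space" using assms unfolding iid_env_def by (elim conjE)
  show "space P = space env_space" using sets by (rule sets_eq_imp_space_eq)
qed (use assms in \<open>unfold iid_env_def, blast+\<close>)

lemma weight_law_eq: "weight_law F = (\<Pi>\<^sub>M z\<in>UNIV. F (snd z))"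
  by (simp add: weight_law_def split_beta')

lemma sets_weight_law: "F \<in> space env_space \<Longrightarrow> sets (weight_law F) = sets weight_space"
  unfolding weight_law_def weight_space_def by (rule sets_PiM_cong) (auto simp: env_spaceD)

lemma prob_space_weight_law: "F \<in> space env_space \<Longrightarrow> prob_space (weight_law F)"
  unfolding weight_law_def by (rule prob_space_PiM) (auto simp: env_spaceD split: prod.splits)

lemma measurable_env_component [measurable]: "(\<lambda>F. F j) \<in> env_space \<rightarrow>\<^sub>M prob_algebra borel"
  unfolding env_space_def by (rule measurable_component_singleton) simp

lemma measurable_weight_component [measurable]: "(\<lambda>X. X z) \<in> weight_space \<rightarrow>\<^sub>M borel"
  unfolding weight_space_def by (rule measurable_component_singleton) simp

lemma weight_law_component:
  assumes "F \<in> space env_space"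
  shows "distr (weight_law F) borel (\<lambda>X. X z) = F (snd z)"
proof -
  have "distr (weight_law F) (case z of (i, j) \<Rightarrow> F j) (\<lambda>X. X z) = (case z of (i, j) \<Rightarrow> F j)"
    unfolding weight_law_def
    by (rule distr_PiM_component) (auto simp: env_spaceD[OF assms] split: prod.splits)
  moreover have "distr (weight_law F) (case z of (i, j) \<Rightarrow> F j) (\<lambda>X. X z) = distr (weight_law F) borel (\<lambda>X. X z)"
    by (rule distr_cong) (auto simp: env_spaceD[OF assms] split: prod.splits)
  ultimately show ?thesis by (simp add: split_beta)
qed

lemma weight_law_row:
  assumes "F \<in> space env_space"
  shows "distr (weight_law F) (\<Pi>\<^sub>M i\<in>UNIV. borel) (\<lambda>X i. X (i, j)) = (\<Pi>\<^sub>M i\<in>UNIV. F j)"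
proof -
  have "distr (weight_law F) (\<Pi>\<^sub>M i\<in>UNIV. F (snd (i, j))) (\<lambda>\<omega>. \<lambda>i\<in>UNIV. \<omega> (i, j)) =
      (\<Pi>\<^sub>M i\<in>UNIV. F (snd (i, j)))"
    unfolding weight_law_eq
    by (rule distr_PiM_reindex) (auto simp: env_spaceD[OF assms] inj_on_def)
  moreover have "distr (weight_law F) (\<Pi>\<^sub>M i\<in>UNIV. F j) (\<lambda>X i. X (i, j)) = distr (weight_law F) (\<Pi>\<^sub>M i\<in>UNIV. borel) (\<lambda>X i. X (i, j))"
    by (rule distr_cong[OF refl _ refl], rule sets_PiM_cong) (simp_all add: env_spaceD[OF assms])
  ultimately show ?thesis by (simp add: restrict_def)
qed

lemma indep_vars_weight_law:
  assumes "F \<in> space env_space"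
  shows "prob_space.indep_vars (weight_law F) (\<lambda>_. borel) (\<lambda>z X. X z) UNIV"
proof -
  interpret prob_space "weight_law F" using assms by (rule prob_space_weight_law)
  have meas: "(\<lambda>X. X z) \<in> borel_measurable (weight_law F)" for z
    by (subst measurable_cong_sets[OF sets_weight_law[OF assms] refl]) measurable
  have "distr (weight_law F) (\<Pi>\<^sub>M z\<in>UNIV. borel) (\<lambda>X. X) = weight_law F"
    by (rule distr_id2) (rule sets_weight_law[OF assms, unfolded weight_space_def, symmetric])
  then have "distr (weight_law F) (\<Pi>\<^sub>M z\<in>UNIV. borel) (\<lambda>X. \<lambda>z\<in>UNIV. X z) = weight_law F"
    by (simp add: restrict_def)
  also have "\<dots> = (\<Pi>\<^sub>M z\<in>UNIV. distr (weight_law F) borel (\<lambda>X. X z))"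
    unfolding weight_law_component[OF assms] by (simp add: weight_law_def split_beta')
  finally show ?thesis
    by (subst indep_vars_iff_distr_eq_PiM') (use meas in auto)
qed

lemma sets_joint_law:
  assumes "iid_env P"
  shows "sets (joint_law P) = sets (env_space \<Otimes>\<^sub>M weight_space)"
proof -
  interpret prob_space P by (rule iid_envD(1)[OF assms])
  show ?thesis
    unfolding joint_law_def by (rule sets_bind) (simp_all add: not_empty)
qed

lemma measurable_joint_kernel_subprob:
  assumes "iid_env P"
  shows "(\<lambda>F. distr (weight_law F) (env_space \<Otimes>\<^sub>M weight_space) (\<lambda>X. (F, X))) \<in> P \<rightarrow>\<^sub>M subprob_algebra (env_space \<Otimes>\<^sub>M weight_space)"
  unfolding measurable_cong_sets[OF iid_envD(2)[OF assms] refl]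
  by (rule measurable_prob_algebraD[OF measurable_joint_kernel])

lemma measurable_Pair_weight:
  "F \<in> space env_space \<Longrightarrow> (\<lambda>X. (F, X)) \<in> weight_law F \<rightarrow>\<^sub>M env_space \<Otimes>\<^sub>M weight_space"
  by (subst measurable_cong_sets[OF sets_weight_law refl]) auto

lemma nn_integral_joint_law:
  assumes P: "iid_env P" and f: "f \<in> borel_measurable (env_space \<Otimes>\<^sub>M weight_space)"
  shows "(\<integral>\<^sup>+\<omega>. f \<omega> \<partial>joint_law P) = (\<integral>\<^sup>+F. \<integral>\<^sup>+X. f (F, X) \<partial>weight_law F \<partial>P)"
  unfolding joint_law_def nn_integral_bind[OF f measurable_joint_kernel_subprob[OF P]]
  by (intro nn_integral_cong nn_integral_distr measurable_Pair_weight) (simp_all add: iid_envD(3)[OF P] f)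

lemma integral_joint_law:
  fixes f :: "env \<times> weights \<Rightarrow> real"
  assumes P: "iid_env P" and f: "f \<in> borel_measurable (env_space \<Otimes>\<^sub>M weight_space)"
    and bdd: "\<And>\<omega>. \<bar>f \<omega>\<bar> \<le> B"
  shows "(\<integral>\<omega>. f \<omega> \<partial>joint_law P) = (\<integral>F. \<integral>X. f (F, X) \<partial>weight_law F \<partial>P)"
proof -
  interpret prob_space P by (rule iid_envD(1)[OF P])
  have "(\<integral>\<omega>. f \<omega> \<partial>joint_law P) = (\<integral>F. integral\<^sup>L (distr (weight_law F) (env_space \<Otimes>\<^sub>M weight_space) (\<lambda>X. (F, X))) f \<partial>P)"
    unfolding joint_law_def
  proof (rule integral_bind[OF f _ measurable_joint_kernel_subprob[OF P]])
    show "AE F in P. emeasure (distr (weight_law F) (env_space \<Otimes>\<^sub>M weight_space) (\<lambda>X. (F, X)))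
        (space (distr (weight_law F) (env_space \<Otimes>\<^sub>M weight_space) (\<lambda>X. (F, X)))) \<le> ennreal 1"
    proof (rule AE_I2)
      fix F assume "F \<in> space P"
      then have "F \<in> space env_space" by (simp add: iid_envD(3)[OF P])
      then have "prob_space (distr (weight_law F) (env_space \<Otimes>\<^sub>M weight_space) (\<lambda>X. (F, X)))"
        by (intro prob_space.prob_space_distr prob_space_weight_law measurable_Pair_weight)
      then show "emeasure (distr (weight_law F) (env_space \<Otimes>\<^sub>M weight_space) (\<lambda>X. (F, X)))
        (space (distr (weight_law F) (env_space \<Otimes>\<^sub>M weight_space) (\<lambda>X. (F, X)))) \<le> ennreal 1"
        using prob_space.emeasure_space_1 by fastforce
    qed
  qed (use bdd finite_measure_axioms in auto)
  also have "\<dots> = (\<integral>F. \<integral>X. f (F, X) \<partial>weight_law F \<partial>P)"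
    by (intro Bochner_Integration.integral_cong refl integral_distr measurable_Pair_weight f)
       (simp add: iid_envD(3)[OF P])
  finally show ?thesis .
qed

text \<open>The Bochner integral takes the default value 0 when the identity is not integrable, so
  the measurable positive and negative parts are combined by a case distinction.\<close>

lemma measurable_mean_of [measurable]: "mean_of \<in> borel_measurable (prob_algebra borel)"
proof -
  have [measurable]: "(\<lambda>N. \<integral>\<^sup>+x. f x \<partial>N) \<in> borel_measurable (prob_algebra borel)"
    if "f \<in> borel_measurable borel" for f :: "real \<Rightarrow> ennreal"
    by (rule measurable_compose[OF measurable_prob_algebraD[OF measurable_ident]
          nn_integral_measurable_subprob_algebra, unfolded id_def]) (use that in auto)
  have eq: "mean_of N = (if (\<integral>\<^sup>+x. ennreal \<bar>x\<bar> \<partial>N) < \<infinity> then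
      enn2real (\<integral>\<^sup>+x. ennreal x \<partial>N) - enn2real (\<integral>\<^sup>+x. ennreal (- x) \<partial>N) else 0)"
    if "N \<in> space (prob_algebra borel)" for N
  proof -
    have [measurable]: "(\<lambda>x. x) \<in> borel_measurable N"
      by (rule measurable_ident_sets) (use that in \<open>simp add: space_prob_algebra\<close>)
    show ?thesis
    proof (cases "(\<integral>\<^sup>+x. ennreal \<bar>x\<bar> \<partial>N) < \<infinity>")
      case True
      then have "integrable N (\<lambda>x. x)" by (simp add: integrable_iff_bounded)
      then show ?thesis using True by (simp add: mean_of_def real_lebesgue_integral_def)
    next
      case False
      then have "\<not> integrable N (\<lambda>x. x)" by (simp add: integrable_iff_bounded)
      then show ?thesis using False by (simp add: mean_of_def not_integrable_integral_eq)
    qed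
  qed
  show ?thesis by (subst measurable_cong[OF eq]) measurable
qed

text \<open>For a nonnegative integrand no case distinction arises: \<open>enn2real\<close> sends
  infinity to 0, the default of the Bochner integral.\<close>

lemma measurable_variance_of [measurable]: "variance_of \<in> borel_measurable (prob_algebra borel)"
proof -
  have eq: "variance_of N = enn2real (\<integral>\<^sup>+x. ennreal ((x - mean_of N)\<^sup>2) \<partial>N)"
    if "N \<in> space (prob_algebra borel)" for N
  proof -
    have [measurable]: "(\<lambda>x. x) \<in> borel_measurable N"
      by (rule measurable_ident_sets) (use that in \<open>simp add: space_prob_algebra\<close>)
    show ?thesis unfolding variance_of_def by (rule integral_eq_nn_integral) auto
  qed
  have "(\<lambda>N. \<integral>\<^sup>+x. ennreal ((x - mean_of N)\<^sup>2) \<partial>N) \<in> borel_measurable (prob_algebra borel)"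
    by (rule nn_integral_measurable_subprob_algebra2[where N = borel])
       (auto intro: measurable_prob_algebraD[OF measurable_ident, unfolded id_def])
  then show ?thesis by (subst measurable_cong[OF eq]) measurable
qed

text \<open>Clipping changes the weights on a null set only and makes them bounded everywhere.\<close>

definition clip :: "real \<Rightarrow> real \<Rightarrow> real" where
  "clip M x = max (- M) (min M x)"

lemma abs_clip_le: "M \<ge> 0 \<Longrightarrow> \<bar>clip M x\<bar> \<le> M"
  by (auto simp: clip_def)

lemma clip_eq: "\<bar>x\<bar> \<le> M \<Longrightarrow> clip M x = x"
  by (auto simp: clip_def)

lemma measurable_clip [measurable]: "clip M \<in> borel_measurable borel"
  unfolding clip_def by measurable

text \<open>The mean is clipped as well, so that the bound \<open>2 * M\<close> holds at every
  point, even where a row law is unbounded.\<close>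

definition centered_weights :: "real \<Rightarrow> nat \<Rightarrow> env \<times> weights \<Rightarrow> nat \<Rightarrow> real" where
  "centered_weights M j \<omega> i = clip M (snd \<omega> (i, j)) - clip M (mean_of (fst \<omega> j))"

abbreviation row_space :: "(nat \<Rightarrow> real) measure" where
  "row_space \<equiv> \<Pi>\<^sub>M i\<in>UNIV. borel"

lemma abs_centered_weights_le: "M \<ge> 0 \<Longrightarrow> \<bar>centered_weights M j \<omega> i\<bar> \<le> 2 * M"
  using abs_clip_le[of M "snd \<omega> (i, j)"] abs_clip_le[of M "mean_of (fst \<omega> j)"]
  by (simp add: centered_weights_def)

lemma measurable_mean_component [measurable]: "(\<lambda>F. mean_of (F j)) \<in> borel_measurable env_space"
  by (rule measurable_compose[OF measurable_env_component measurable_mean_of])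

lemma measurable_centered_weights [measurable]:
  "centered_weights M j \<in> env_space \<Otimes>\<^sub>M weight_space \<rightarrow>\<^sub>M row_space"
proof -
  have [measurable]: "(\<lambda>\<omega>. snd \<omega> z) \<in> borel_measurable (env_space \<Otimes>\<^sub>M weight_space)" for z
    by (rule measurable_compose[OF measurable_snd measurable_weight_component])
  have [measurable]: "(\<lambda>\<omega>. mean_of (fst \<omega> j)) \<in> borel_measurable (env_space \<Otimes>\<^sub>M weight_space)"
    by (rule measurable_compose[OF measurable_fst measurable_mean_component])
  have "(\<lambda>\<omega> i. centered_weights M j \<omega> i) \<in> env_space \<Otimes>\<^sub>M weight_space \<rightarrow>\<^sub>M row_space"
    by (rule measurable_abs_UNIV) (unfold centered_weights_def, measurable)
  then show ?thesis by simp
qed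

text \<open>The conditional probability that a centered row lies in \<open>B\<close>, given its law
  \<open>N\<close>. It depends on the environment through a single row law only, whence the
  independence of the rows.\<close>

definition row_kernel :: "real \<Rightarrow> (nat \<Rightarrow> real) set \<Rightarrow> real measure \<Rightarrow> ennreal" where
  "row_kernel M B N = (\<integral>\<^sup>+x. indicator B (\<lambda>i. clip M (x i) - clip M (mean_of N)) \<partial>(\<Pi>\<^sub>M i\<in>UNIV. N))"

lemma nn_integral_row:
  assumes F: "F \<in> space env_space" and B [measurable]: "B \<in> sets row_space"
  shows "(\<integral>\<^sup>+X. indicator B (centered_weights M j (F, X)) \<partial>weight_law F) = row_kernel M B (F j)"
proof -
  have [measurable]: "(\<lambda>x i. clip M (x i) - c) \<in> row_space \<rightarrow>\<^sub>M row_space" for c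
    by (rule measurable_abs_UNIV) measurable
  have "(\<lambda>X i. X (i, j)) \<in> weight_space \<rightarrow>\<^sub>M row_space"
    by (rule measurable_abs_UNIV) measurable
  then have meas: "(\<lambda>X i. X (i, j)) \<in> weight_law F \<rightarrow>\<^sub>M row_space"
    by (subst measurable_cong_sets[OF sets_weight_law[OF F] refl])
  have "row_kernel M B (F j) = (\<integral>\<^sup>+x. indicator B (\<lambda>i. clip M (x i) - clip M (mean_of (F j)))
      \<partial>distr (weight_law F) row_space (\<lambda>X i. X (i, j)))"
    unfolding row_kernel_def weight_law_row[OF F] ..
  also have "\<dots> = (\<integral>\<^sup>+X. indicator B (\<lambda>i. clip M (X (i, j)) - clip M (mean_of (F j))) \<partial>weight_law F)"
    by (subst nn_integral_distr[OF meas]) auto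
  finally show ?thesis by (simp add: centered_weights_def[abs_def])
qed

text \<open>Measurability is pulled back along the map from \<open>N\<close> to the constant
  environment, where that of \<open>weight_law\<close> is known.\<close>

lemma measurable_row_kernel [measurable]:
  assumes [measurable]: "B \<in> sets row_space"
  shows "row_kernel M B \<in> borel_measurable (prob_algebra borel)"
proof -
  have const: "(\<lambda>N. (\<lambda>_. N)) \<in> prob_algebra borel \<rightarrow>\<^sub>M env_space"
    unfolding env_space_def by (rule measurable_abs_UNIV) simp
  have "(\<lambda>F. \<integral>\<^sup>+X. indicator B (centered_weights M 0 (F, X)) \<partial>weight_law F) \<in> borel_measurable env_space"
    by (rule nn_integral_measurable_subprob_algebra2[where N = weight_space])
       (measurable, rule measurable_prob_algebraD[OF measurable_weight_law])
  from measurable_compose[OF const this]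
  have "(\<lambda>N. \<integral>\<^sup>+X. indicator B (centered_weights M 0 ((\<lambda>_. N), X)) \<partial>weight_law (\<lambda>_. N)) \<in> borel_measurable (prob_algebra borel)" .
  moreover have "(\<integral>\<^sup>+X. indicator B (centered_weights M 0 ((\<lambda>_. N), X)) \<partial>weight_law (\<lambda>_. N)) = row_kernel M B N"
    if "N \<in> space (prob_algebra borel)" for N
    using nn_integral_row[of "\<lambda>_. N" B M 0] measurable_space[OF const that] by simp
  ultimately show ?thesis by (simp cong: measurable_cong)
qed

text \<open>Given the environment, different rows read disjoint blocks of independent weights, so
  the conditional probability of a product event is a product of row kernels. These are functions of
  the independent \<open>F j\<close>, so the product survives averaging over
  \<open>P\<close>.\<close>

lemma indep_vars_centered_weights:
  assumes P: "iid_env P"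
  shows "prob_space.indep_vars (joint_law P) (\<lambda>_. row_space) (centered_weights M) UNIV"
proof -
  interpret prob_space "joint_law P" using P by (rule prob_space_joint_law)
  interpret env: prob_space P by (rule iid_envD(1)[OF P])
  have rv: "random_variable row_space (centered_weights M j)" for j
    by (subst measurable_cong_sets[OF sets_joint_law[OF P] refl]) measurable
  have joint: "(\<integral>\<^sup>+\<omega>. (\<Prod>j\<in>J. indicator (B j) (centered_weights M j \<omega>)) \<partial>joint_law P) =
      (\<Prod>j\<in>J. \<integral>\<^sup>+\<omega>. indicator (B j) (centered_weights M j \<omega>) \<partial>joint_law P)"
    if J: "finite J" and B: "\<And>j. j \<in> J \<Longrightarrow> B j \<in> sets row_space" for J B
  proof -
    have ind [measurable]: "(\<lambda>\<omega>. indicator (B j) (centered_weights M j \<omega>) :: ennreal)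
        \<in> borel_measurable (env_space \<Otimes>\<^sub>M weight_space)" if "j \<in> J" for j
      using B[OF that] by measurable
    have single: "(\<integral>\<^sup>+\<omega>. indicator (B j) (centered_weights M j \<omega>) \<partial>joint_law P) = (\<integral>\<^sup>+F. row_kernel M (B j) (F j) \<partial>P)"
      if "j \<in> J" for j
      unfolding nn_integral_joint_law[OF P ind[OF that]]
      by (intro nn_integral_cong nn_integral_row B that) (simp add: iid_envD(3)[OF P])
    have "(\<integral>\<^sup>+\<omega>. (\<Prod>j\<in>J. indicator (B j) (centered_weights M j \<omega>)) \<partial>joint_law P) =
        (\<integral>\<^sup>+F. \<integral>\<^sup>+X. (\<Prod>j\<in>J. indicator (B j) (centered_weights M j (F, X))) \<partial>weight_law F \<partial>P)"
      by (rule nn_integral_joint_law[OF P]) measurable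
    also have "\<dots> = (\<integral>\<^sup>+F. (\<Prod>j\<in>J. row_kernel M (B j) (F j)) \<partial>P)"
    proof (intro nn_integral_cong)
      fix F assume "F \<in> space P"
      then have F: "F \<in> space env_space" by (simp add: iid_envD(3)[OF P])
      interpret W: prob_space "weight_law F" using F by (rule prob_space_weight_law)
      have "W.indep_vars (\<lambda>j. \<Pi>\<^sub>M z\<in>UNIV \<times> {j}. borel) (\<lambda>j X. restrict (\<lambda>z. X z) (UNIV \<times> {j})) J"
        by (rule W.indep_vars_restrict[OF indep_vars_weight_law[OF F]]) (auto simp: disjoint_family_on_def)
      then have "W.indep_vars (\<lambda>_. borel) (\<lambda>j X. indicator (B j)
          (\<lambda>i. clip M (restrict (\<lambda>z. X z) (UNIV \<times> {j}) (i, j)) - clip M (mean_of (F j))) :: ennreal) J"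
      proof (rule W.indep_vars_compose2)
        fix j assume "j \<in> J"
        have "(\<lambda>x i. clip M (x (i, j)) - clip M (mean_of (F j))) \<in> (\<Pi>\<^sub>M z\<in>UNIV \<times> {j}. borel) \<rightarrow>\<^sub>M row_space"
        proof (rule measurable_abs_UNIV)
          fix i
          have [measurable]: "(\<lambda>x. x (i, j)) \<in> borel_measurable (\<Pi>\<^sub>M z\<in>UNIV \<times> {j}. borel)"
            by (rule measurable_component_singleton) simp
          show "(\<lambda>x. clip M (x (i, j)) - clip M (mean_of (F j))) \<in> borel_measurable (\<Pi>\<^sub>M z\<in>UNIV \<times> {j}. borel)"
            by measurable
        qed
        then show "(\<lambda>x. indicator (B j) (\<lambda>i. clip M (x (i, j)) - clip M (mean_of (F j))) :: ennreal)
            \<in> borel_measurable (\<Pi>\<^sub>M z\<in>UNIV \<times> {j}. borel)"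
          using B[OF \<open>j \<in> J\<close>] by measurable
      qed
      then have "W.indep_vars (\<lambda>_. borel) (\<lambda>j X. indicator (B j) (centered_weights M j (F, X)) :: ennreal) J"
        by (simp add: centered_weights_def[abs_def])
      then have "(\<integral>\<^sup>+X. (\<Prod>j\<in>J. indicator (B j) (centered_weights M j (F, X))) \<partial>weight_law F) =
          (\<Prod>j\<in>J. \<integral>\<^sup>+X. indicator (B j) (centered_weights M j (F, X)) \<partial>weight_law F)"
        using J by (intro W.indep_vars_nn_integral) auto
      also have "\<dots> = (\<Prod>j\<in>J. row_kernel M (B j) (F j))"
        by (intro prod.cong refl nn_integral_row F B)
      finally show "(\<integral>\<^sup>+X. (\<Prod>j\<in>J. indicator (B j) (centered_weights M j (F, X))) \<partial>weight_law F) =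
          (\<Prod>j\<in>J. row_kernel M (B j) (F j))" .
    qed
    also have "\<dots> = (\<Prod>j\<in>J. \<integral>\<^sup>+F. row_kernel M (B j) (F j) \<partial>P)"
    proof (rule env.indep_vars_nn_integral)
      have "env.indep_vars (\<lambda>_. prob_algebra borel) (\<lambda>j F. F j) J"
        by (rule env.indep_vars_subset[OF iid_envD(4)[OF P]]) simp
      then show "env.indep_vars (\<lambda>_. borel) (\<lambda>j F. row_kernel M (B j) (F j)) J"
        by (rule env.indep_vars_compose2) (use B in measurable)
    qed (use J in auto)
    also have "\<dots> = (\<Prod>j\<in>J. \<integral>\<^sup>+\<omega>. indicator (B j) (centered_weights M j \<omega>) \<partial>joint_law P)"
      by (intro prod.cong refl single[symmetric])
    finally show ?thesis .
  qed
  show ?thesis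
    unfolding indep_vars_def2
  proof (intro conjI ballI rv indep_setsI)
    fix j show "{centered_weights M j -` A \<inter> space (joint_law P) |A. A \<in> sets row_space} \<subseteq> events"
      using measurable_sets[OF rv] by auto
  next
    fix A J assume J: "finite J" "\<forall>j\<in>J. A j \<in> {centered_weights M j -` A \<inter> space (joint_law P) |A. A \<in> sets row_space}"
      and "J \<noteq> {}"
    then obtain B where B: "\<And>j. j \<in> J \<Longrightarrow> B j \<in> sets row_space"
        "\<And>j. j \<in> J \<Longrightarrow> A j = centered_weights M j -` B j \<inter> space (joint_law P)"
      by simp metis
    have ev: "A j \<in> events" if "j \<in> J" for j
      unfolding B(2)[OF that] by (rule measurable_sets[OF rv B(1)[OF that]])
    then have inter: "(\<Inter>j\<in>J. A j) \<in> events" using J \<open>J \<noteq> {}\<close> by (intro sets.finite_INT) auto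
    have "emeasure (joint_law P) (\<Inter>j\<in>J. A j) = (\<integral>\<^sup>+\<omega>. indicator (\<Inter>j\<in>J. A j) \<omega> \<partial>joint_law P)"
      using inter by simp
    also have "\<dots> = (\<integral>\<^sup>+\<omega>. (\<Prod>j\<in>J. indicator (B j) (centered_weights M j \<omega>)) \<partial>joint_law P)"
    proof (intro nn_integral_cong)
      fix \<omega> assume "\<omega> \<in> space (joint_law P)"
      then have "indicator (B j) (centered_weights M j \<omega>) = (indicator (A j) \<omega> :: ennreal)" if "j \<in> J" for j
        by (simp add: B(2)[OF that] indicator_def)
      then have "(\<Prod>j\<in>J. indicator (B j) (centered_weights M j \<omega>)) = (\<Prod>j\<in>J. indicator (A j) \<omega> :: ennreal)"
        by simp
      also have "\<dots> = indicator (\<Inter>j\<in>J. A j) \<omega>"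
        using J by (cases "\<omega> \<in> (\<Inter>j\<in>J. A j)") (auto simp: indicator_def)
      finally show "indicator (\<Inter>j\<in>J. A j) \<omega> = (\<Prod>j\<in>J. indicator (B j) (centered_weights M j \<omega>) :: ennreal)" ..
    qed
    also have "\<dots> = (\<Prod>j\<in>J. \<integral>\<^sup>+\<omega>. indicator (B j) (centered_weights M j \<omega>) \<partial>joint_law P)"
      by (rule joint[OF J(1) B(1)])
    also have "\<dots> = (\<Prod>j\<in>J. emeasure (joint_law P) (A j))"
    proof (intro prod.cong refl)
      fix j assume j: "j \<in> J"
      have "(\<integral>\<^sup>+\<omega>. indicator (B j) (centered_weights M j \<omega>) \<partial>joint_law P) = (\<integral>\<^sup>+\<omega>. indicator (A j) \<omega> \<partial>joint_law P)"
        by (intro nn_integral_cong) (simp add: B(2)[OF j] indicator_def)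
      then show "(\<integral>\<^sup>+\<omega>. indicator (B j) (centered_weights M j \<omega>) \<partial>joint_law P) = emeasure (joint_law P) (A j)"
        using ev[OF j] by simp
    qed
    finally have "ennreal (prob (\<Inter>j\<in>J. A j)) = ennreal (\<Prod>j\<in>J. prob (A j))"
      by (simp add: emeasure_eq_measure prod_ennreal)
    then show "prob (\<Inter>j\<in>J. A j) = (\<Prod>j\<in>J. prob (A j))"
      by (simp add: prod_nonneg)
  qed
qed

section \<open>Moments of bounded row laws\<close>

definition bounded_law :: "real \<Rightarrow> real measure \<Rightarrow> bool" where
  "bounded_law M N \<longleftrightarrow> prob_space N \<and> sets N = sets borel \<and> (AE x in N. \<bar>x\<bar> \<le> M)"

lemma bounded_lawI:
  assumes N: "prob_space N" "sets N = sets borel" and cdf: "cdf N (- M) = 0" "cdf N M = 1"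
  shows "bounded_law M N"
proof -
  interpret prob_space N by (rule N(1))
  have ev: "{..M} \<in> events" "{..- M} \<in> events" using N(2) by simp_all
  have "prob {..M} = 1" "prob {..- M} = 0" using cdf by (simp_all add: cdf_def)
  then have "AE x in N. x \<in> {..M}" "AE x in N. x \<notin> {..- M}"
    unfolding prob_eq_1[OF ev(1)] prob_eq_0[OF ev(2)] .
  then have "AE x in N. \<bar>x\<bar> \<le> M" by eventually_elim auto
  then show ?thesis using N by (simp add: bounded_law_def)
qed

lemma bounded_law_moments:
  assumes N: "bounded_law M N" and M: "M \<ge> 0"
  shows "\<bar>mean_of N\<bar> \<le> M" "(\<integral>x. clip M x - clip M (mean_of N) \<partial>N) = 0"
    "(\<integral>x. (clip M x - clip M (mean_of N))\<^sup>2 \<partial>N) = variance_of N"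
    "variance_of N \<in> {0..4 * M\<^sup>2}"
proof -
  interpret prob_space N using N by (simp add: bounded_law_def)
  have [measurable]: "(\<lambda>x. x) \<in> borel_measurable N"
    by (rule measurable_ident_sets) (use N in \<open>simp add: bounded_law_def\<close>)
  have bdd: "AE x in N. \<bar>x\<bar> \<le> M" using N by (simp add: bounded_law_def)
  have int: "integrable N (\<lambda>x. x)" by (rule integrable_const_bound[of _ M]) (use bdd in auto)
  have "\<bar>\<integral>x. x \<partial>N\<bar> \<le> (\<integral>x. \<bar>x\<bar> \<partial>N)" by (rule integral_abs_bound)
  also have "\<dots> \<le> M" by (rule integral_le_const) (use bdd int in auto)
  finally show mean: "\<bar>mean_of N\<bar> \<le> M" by (simp add: mean_of_def)
  have clip: "AE x in N. clip M x = x" using bdd by eventually_elim (rule clip_eq)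
  have "(\<integral>x. clip M x - clip M (mean_of N) \<partial>N) = (\<integral>x. x - mean_of N \<partial>N)"
    by (rule integral_cong_AE) (use clip mean in \<open>auto simp: clip_eq elim: eventually_mono\<close>)
  also have "\<dots> = 0" using int by (simp add: mean_of_def prob_space)
  finally show "(\<integral>x. clip M x - clip M (mean_of N) \<partial>N) = 0" .
  have "(\<integral>x. (clip M x - clip M (mean_of N))\<^sup>2 \<partial>N) = (\<integral>x. (x - mean_of N)\<^sup>2 \<partial>N)"
    by (rule integral_cong_AE) (use clip mean in \<open>auto simp: clip_eq elim: eventually_mono\<close>)
  then show "(\<integral>x. (clip M x - clip M (mean_of N))\<^sup>2 \<partial>N) = variance_of N"
    by (simp add: variance_of_def)
  have le: "AE x in N. (x - mean_of N)\<^sup>2 \<le> 4 * M\<^sup>2"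
    using bdd
  proof eventually_elim
    case (elim x)
    then have "\<bar>x - mean_of N\<bar> \<le> 2 * M" using mean by linarith
    then have "\<bar>x - mean_of N\<bar>\<^sup>2 \<le> (2 * M)\<^sup>2" by (intro power_mono) auto
    then show ?case by (simp add: power_mult_distrib)
  qed
  have "integrable N (\<lambda>x. (x - mean_of N)\<^sup>2)"
    by (rule integrable_const_bound[of _ "4 * M\<^sup>2"]) (use le in auto)
  then have "variance_of N \<le> 4 * M\<^sup>2"
    unfolding variance_of_def by (rule integral_le_const) (rule le)
  then show "variance_of N \<in> {0..4 * M\<^sup>2}" by (simp add: variance_of_def)
qed

text \<open>Assumptions are made on row 0 only; equal marginal laws carry them to row
  \<open>j\<close>.\<close>

lemma AE_env_component:
  assumes P: "iid_env P" and Q: "{N \<in> space (prob_algebra borel). Q N} \<in> sets (prob_algebra borel)"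
    and "AE F in P. Q (F 0)"
  shows "AE F in P. Q (F j)"
proof -
  have meas: "(\<lambda>F. F j) \<in> P \<rightarrow>\<^sub>M prob_algebra borel" for j
    by (subst measurable_cong_sets[OF iid_envD(2)[OF P] refl]) measurable
  have "AE N in distr P (prob_algebra borel) (\<lambda>F. F 0). Q N"
    unfolding AE_distr_iff[OF meas Q] by (rule assms(3))
  then have "AE N in distr P (prob_algebra borel) (\<lambda>F. F j). Q N"
    unfolding iid_envD(5)[OF P, of j] .
  then show ?thesis unfolding AE_distr_iff[OF meas Q] .
qed

lemma integral_env_component:
  fixes f :: "real measure \<Rightarrow> real"
  assumes P: "iid_env P" and f: "f \<in> borel_measurable (prob_algebra borel)"
  shows "(\<integral>F. f (F j) \<partial>P) = (\<integral>F. f (F 0) \<partial>P)"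
proof -
  have meas: "(\<lambda>F. F j) \<in> P \<rightarrow>\<^sub>M prob_algebra borel" for j
    by (subst measurable_cong_sets[OF iid_envD(2)[OF P] refl]) measurable
  show ?thesis
    unfolding integral_distr[OF meas f, symmetric] iid_envD(5)[OF P, of j] ..
qed

lemma AE_bounded_law:
  assumes P: "iid_env P" and bdd: "AE F in P. cdf (F 0) (- M) = 0 \<and> cdf (F 0) M = 1"
  shows "AE F in P. bounded_law M (F j)"
proof -
  have [measurable]: "(\<lambda>N. cdf N x) \<in> borel_measurable (prob_algebra borel)" for x
    unfolding cdf_def
    by (rule measurable_compose[OF measurable_prob_algebraD[OF measurable_ident, unfolded id_def]
          measurable_measure_subprob_algebra]) simp
  have "AE F in P. cdf (F j) (- M) = 0 \<and> cdf (F j) M = 1"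
    by (rule AE_env_component[OF P _ bdd]) measurable
  moreover have "AE F in P. F \<in> space env_space"
    using iid_envD(3)[OF P] by (intro AE_I2) simp
  ultimately show ?thesis
    by eventually_elim (auto intro: bounded_lawI simp: env_spaceD)
qed

lemma integral_weight_component:
  fixes f :: "real \<Rightarrow> real"
  assumes "F \<in> space env_space" "f \<in> borel_measurable borel"
  shows "(\<integral>X. f (X z) \<partial>weight_law F) = (\<integral>x. f x \<partial>F (snd z))"
proof -
  have "(\<lambda>X. X z) \<in> borel_measurable (weight_law F)"
    by (subst measurable_cong_sets[OF sets_weight_law[OF assms(1)] refl]) measurable
  from integral_distr[OF this assms(2)] show ?thesis
    unfolding weight_law_component[OF assms(1)] ..
qed

lemma integral_weight_product:
  fixes f :: "real \<Rightarrow> real"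
  assumes F: "F \<in> space env_space" and f: "f \<in> borel_measurable borel" "\<And>x. \<bar>f x\<bar> \<le> B" and "z \<noteq> z'"
  shows "(\<integral>X. f (X z) * f (X z') \<partial>weight_law F) = (\<integral>x. f x \<partial>F (snd z)) * (\<integral>x. f x \<partial>F (snd z'))"
proof -
  interpret prob_space "weight_law F" using F by (rule prob_space_weight_law)
  have meas: "(\<lambda>X. f (X z)) \<in> borel_measurable (weight_law F)" for z
    by (subst measurable_cong_sets[OF sets_weight_law[OF F] refl])
       (rule measurable_compose[OF measurable_weight_component f(1)])
  have "indep_vars (\<lambda>_. borel) (\<lambda>z X. X z) {z, z'}"
    by (rule indep_vars_subset[OF indep_vars_weight_law[OF F]]) simp
  then have "indep_vars (\<lambda>_. borel) (\<lambda>z X. f (X z)) {z, z'}"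
    by (rule indep_vars_compose2) (rule f(1))
  then have "(\<integral>X. (\<Prod>z\<in>{z, z'}. f (X z)) \<partial>weight_law F) = (\<Prod>z\<in>{z, z'}. \<integral>X. f (X z) \<partial>weight_law F)"
    by (intro indep_vars_lebesgue_integral integrable_const_bound[of _ B]) (use f meas in auto)
  then show ?thesis
    using \<open>z \<noteq> z'\<close> by (simp add: integral_weight_component[OF F f(1)])
qed

lemma measurable_clipped_variance:
  "(\<lambda>N. \<integral>x. (clip M x - clip M (mean_of N))\<^sup>2 \<partial>N) \<in> borel_measurable (prob_algebra borel)"
proof -
  have eq: "(\<integral>x. (clip M x - clip M (mean_of N))\<^sup>2 \<partial>N) =
      enn2real (\<integral>\<^sup>+x. ennreal ((clip M x - clip M (mean_of N))\<^sup>2) \<partial>N)"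
    if "N \<in> space (prob_algebra borel)" for N
  proof -
    have [measurable]: "(\<lambda>x. x) \<in> borel_measurable N"
      by (rule measurable_ident_sets) (use that in \<open>simp add: space_prob_algebra\<close>)
    show ?thesis by (rule integral_eq_nn_integral) auto
  qed
  have "(\<lambda>N. \<integral>\<^sup>+x. ennreal ((clip M x - clip M (mean_of N))\<^sup>2) \<partial>N) \<in> borel_measurable (prob_algebra borel)"
    by (rule nn_integral_measurable_subprob_algebra2[where N = borel])
       (auto intro: measurable_prob_algebraD[OF measurable_ident, unfolded id_def])
  then show ?thesis by (subst measurable_cong[OF eq]) measurable
qed

text \<open>Given the environment, two entries of a row are independent and centered, so their mixed
  moment vanishes already conditionally. Without subtraction of the row mean, the covariance would
  be the variance of the random mean.\<close>

lemma centered_row_joint_law: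
  assumes P: "iid_env P" and M: "M \<ge> 0" and bdd: "\<And>j. AE F in P. bounded_law M (F j)"
  shows "centered_row (distr (joint_law P) row_space (centered_weights M j)) (\<lambda>i r. r i) k (2 * M)
    (\<integral>F. variance_of (F 0) \<partial>P)"
proof -
  interpret prob_space "joint_law P" using P by (rule prob_space_joint_law)
  have rv [measurable]: "centered_weights M j \<in> joint_law P \<rightarrow>\<^sub>M row_space"
    by (subst measurable_cong_sets[OF sets_joint_law[OF P] refl]) measurable
  have comp [measurable]: "(\<lambda>r. r i) \<in> borel_measurable row_space" for i :: nat
    by (rule measurable_component_singleton) simp
  have meas [measurable]: "(\<lambda>\<omega>. centered_weights M j \<omega> i) \<in> borel_measurable (env_space \<Otimes>\<^sub>M weight_space)" for i
    by (rule measurable_compose[OF measurable_centered_weights comp])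
  have cmeas: "(\<lambda>x. clip M x - c) \<in> borel_measurable borel" for c by measurable
  have cbdd: "\<bar>clip M x - clip M y\<bar> \<le> 2 * M" for x y
    using abs_clip_le[OF M, of x] abs_clip_le[OF M, of y] by linarith
  have mean_0: "(\<integral>\<omega>. centered_weights M j \<omega> i \<partial>joint_law P) = 0" for i
  proof -
    have "(\<integral>\<omega>. centered_weights M j \<omega> i \<partial>joint_law P) =
        (\<integral>F. \<integral>X. centered_weights M j (F, X) i \<partial>weight_law F \<partial>P)"
      by (rule integral_joint_law[OF P meas, of _ "2 * M"]) (rule abs_centered_weights_le[OF M])
    also have "\<dots> = (\<integral>F. \<integral>x. clip M x - clip M (mean_of (F j)) \<partial>F j \<partial>P)"
      by (intro Bochner_Integration.integral_cong refl)
         (simp add: centered_weights_def integral_weight_component[OF _ cmeas] iid_envD(3)[OF P])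
    also have "\<dots> = 0"
      by (rule integral_eq_zero_AE) (use bdd[of j] in \<open>auto elim: eventually_mono simp: bounded_law_moments[OF _ M]\<close>)
    finally show ?thesis .
  qed
  have cov: "(\<integral>\<omega>. centered_weights M j \<omega> i * centered_weights M j \<omega> i' \<partial>joint_law P) =
      (if i = i' then (\<integral>F. variance_of (F 0) \<partial>P) else 0)" for i i'
  proof -
    have "(\<integral>\<omega>. centered_weights M j \<omega> i * centered_weights M j \<omega> i' \<partial>joint_law P) =
        (\<integral>F. \<integral>X. centered_weights M j (F, X) i * centered_weights M j (F, X) i' \<partial>weight_law F \<partial>P)"
    proof (rule integral_joint_law[OF P, of _ "2 * M * (2 * M)"])
      show "\<bar>centered_weights M j \<omega> i * centered_weights M j \<omega> i'\<bar> \<le> 2 * M * (2 * M)" for \<omega>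
        unfolding abs_mult by (intro mult_mono abs_centered_weights_le M) (use M in auto)
    qed measurable
    also have "\<dots> = (if i = i' then (\<integral>F. variance_of (F j) \<partial>P) else 0)"
    proof (cases "i = i'")
      case True
      have "(\<integral>F. \<integral>X. centered_weights M j (F, X) i * centered_weights M j (F, X) i' \<partial>weight_law F \<partial>P) =
          (\<integral>F. \<integral>x. (clip M x - clip M (mean_of (F j)))\<^sup>2 \<partial>F j \<partial>P)"
      proof (intro Bochner_Integration.integral_cong refl)
        fix F assume "F \<in> space P"
        then have F: "F \<in> space env_space" by (simp add: iid_envD(3)[OF P])
        have "(\<lambda>x. (clip M x - clip M (mean_of (F j)))\<^sup>2) \<in> borel_measurable borel" by measurable
        from integral_weight_component[OF F this, of "(i, j)"]
        show "(\<integral>X. centered_weights M j (F, X) i * centered_weights M j (F, X) i' \<partial>weight_law F) =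
            (\<integral>x. (clip M x - clip M (mean_of (F j)))\<^sup>2 \<partial>F j)"
          by (simp add: True centered_weights_def power2_eq_square)
      qed
      also have "\<dots> = (\<integral>F. variance_of (F j) \<partial>P)"
      proof (rule integral_cong_AE)
        have env: "(\<lambda>F. F j) \<in> P \<rightarrow>\<^sub>M prob_algebra borel"
          by (subst measurable_cong_sets[OF iid_envD(2)[OF P] refl]) measurable
        show "(\<lambda>F. \<integral>x. (clip M x - clip M (mean_of (F j)))\<^sup>2 \<partial>F j) \<in> borel_measurable P"
          by (rule measurable_compose[OF env measurable_clipped_variance])
        show "(\<lambda>F. variance_of (F j)) \<in> borel_measurable P"
          by (rule measurable_compose[OF env measurable_variance_of])
        show "AE F in P. (\<integral>x. (clip M x - clip M (mean_of (F j)))\<^sup>2 \<partial>F j) = variance_of (F j)"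
          using bdd[of j] by eventually_elim (rule bounded_law_moments(3)[OF _ M])
      qed
      finally show ?thesis using True by simp
    next
      case False
      have "(\<integral>F. \<integral>X. centered_weights M j (F, X) i * centered_weights M j (F, X) i' \<partial>weight_law F \<partial>P) =
          (\<integral>F. (\<integral>x. clip M x - clip M (mean_of (F j)) \<partial>F j) * (\<integral>x. clip M x - clip M (mean_of (F j)) \<partial>F j) \<partial>P)"
      proof (intro Bochner_Integration.integral_cong refl)
        fix F assume "F \<in> space P"
        then have F: "F \<in> space env_space" by (simp add: iid_envD(3)[OF P])
        show "(\<integral>X. centered_weights M j (F, X) i * centered_weights M j (F, X) i' \<partial>weight_law F) =
            (\<integral>x. clip M x - clip M (mean_of (F j)) \<partial>F j) * (\<integral>x. clip M x - clip M (mean_of (F j)) \<partial>F j)"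
          using integral_weight_product[OF F cmeas cbdd, of "(i, j)" "(i', j)"] False
          by (simp add: centered_weights_def)
      qed
      also have "\<dots> = 0"
        by (rule integral_eq_zero_AE) (use bdd[of j] in \<open>auto elim: eventually_mono simp: bounded_law_moments[OF _ M]\<close>)
      finally show ?thesis using False by simp
    qed
    also have "(\<integral>F. variance_of (F j) \<partial>P) = (\<integral>F. variance_of (F 0) \<partial>P)"
      by (rule integral_env_component[OF P measurable_variance_of])
    finally show ?thesis .
  qed
  show ?thesis
    unfolding centered_row_def
  proof (intro conjI allI impI)
    show "prob_space (distr (joint_law P) row_space (centered_weights M j))"
      by (rule prob_space_distr) (rule rv)
    fix i
    show "(\<lambda>r. r i) \<in> borel_measurable (distr (joint_law P) row_space (centered_weights M j))"
      by simp
    show "AE r in distr (joint_law P) row_space (centered_weights M j). \<bar>r i\<bar> \<le> 2 * M"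
      by (subst AE_distr_iff[OF rv]) (auto simp: abs_centered_weights_le[OF M])
    show "(\<integral>r. r i \<partial>distr (joint_law P) row_space (centered_weights M j)) = 0"
      using mean_0 by (simp add: integral_distr[OF rv])
    fix i'
    show "(\<integral>r. r i * r i' \<partial>distr (joint_law P) row_space (centered_weights M j)) =
        (if i = i' then (\<integral>F. variance_of (F 0) \<partial>P) else 0)"
      using cov by (simp add: integral_distr[OF rv])
  qed
qed

section \<open>Comparison of the environment with fair coins\<close>

lemma coin_mean:
  "i < n \<Longrightarrow> measure_pmf.expectation (replicate_pmf n (bernoulli_pmf (1/2)))
     (\<lambda>r. 1 - 2 * of_bool (r ! i) :: real) = 0"
proof (induction n arbitrary: i)
  case (Suc n)
  then show ?case by (cases i) (simp_all add: expectation_replicate_pmf_Suc del: replicate_pmf.simps)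
qed simp

lemma coin_covariance:
  "i < n \<Longrightarrow> i' < n \<Longrightarrow> measure_pmf.expectation (replicate_pmf n (bernoulli_pmf (1/2)))
     (\<lambda>r. (1 - 2 * of_bool (r ! i)) * (1 - 2 * of_bool (r ! i')) :: real) = (if i = i' then 1 else 0)"
proof (induction n arbitrary: i i')
  case (Suc n)
  show ?case
  proof (cases i; cases i')
    assume "i = 0" "i' = 0"
    then show ?thesis by (simp add: expectation_replicate_pmf_Suc del: replicate_pmf.simps)
  next
    fix m assume "i = 0" "i' = Suc m"
    then show ?thesis using Suc.prems coin_mean[of m n]
      by (simp add: expectation_replicate_pmf_Suc del: replicate_pmf.simps)
  next
    fix m assume "i = Suc m" "i' = 0"
    then show ?thesis using Suc.prems coin_mean[of m n]
      by (simp add: expectation_replicate_pmf_Suc del: replicate_pmf.simps)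
  next
    fix m m' assume "i = Suc m" "i' = Suc m'"
    then show ?thesis using Suc.prems Suc.IH[of m m']
      by (simp add: expectation_replicate_pmf_Suc del: replicate_pmf.simps)
  qed
qed simp

lemma centered_row_coins:
  assumes "k < n" and \<sigma>: "0 \<le> \<sigma>" "\<sigma> \<le> B"
  shows "centered_row (measure_pmf (replicate_pmf n (bernoulli_pmf (1/2))))
    (\<lambda>i r. \<sigma> * (1 - 2 * of_bool (r ! i))) k B (\<sigma>\<^sup>2)"
  unfolding centered_row_def
proof (intro conjI allI impI)
  fix i assume i: "i \<le> k"
  show "measure_pmf.expectation (replicate_pmf n (bernoulli_pmf (1/2))) (\<lambda>r. \<sigma> * (1 - 2 * of_bool (r ! i))) = 0"
    using coin_mean[of i n] i \<open>k < n\<close> by simp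
  fix i' assume i': "i' \<le> k"
  have "(\<lambda>r. \<sigma> * (1 - 2 * of_bool (r ! i)) * (\<sigma> * (1 - 2 * of_bool (r ! i')))) =
      (\<lambda>r. \<sigma>\<^sup>2 * ((1 - 2 * of_bool (r ! i)) * (1 - 2 * of_bool (r ! i')) :: real))"
    by (auto simp: power2_eq_square)
  then show "measure_pmf.expectation (replicate_pmf n (bernoulli_pmf (1/2)))
      (\<lambda>r. \<sigma> * (1 - 2 * of_bool (r ! i)) * (\<sigma> * (1 - 2 * of_bool (r ! i')))) = (if i = i' then \<sigma>\<^sup>2 else 0)"
    using coin_covariance[of i n i'] i i' \<open>k < n\<close> by simp
qed (use \<sigma> in \<open>auto simp: AE_measure_pmf_iff of_bool_def measure_pmf.prob_space_axioms\<close>)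

lemma measurable_swl [measurable (raw)]:
  assumes "\<And>j i. (\<lambda>\<omega>. a \<omega> j i) \<in> borel_measurable N"
  shows "(\<lambda>\<omega>. swl (a \<omega>) k l) \<in> borel_measurable N"
proof (induction k arbitrary: l)
  case 0
  show ?case by (induction l) (use assms in auto)
next
  case (Suc k)
  show ?case by (induction l) (use assms Suc in auto)
qed

lemma measurable_partition_fun [measurable (raw)]:
  assumes "\<And>j i. (\<lambda>\<omega>. a \<omega> j i) \<in> borel_measurable N"
  shows "(\<lambda>\<omega>. partition_fun (a \<omega>) k l) \<in> borel_measurable N"
proof (induction k arbitrary: l)
  case 0
  show ?case
  proof (induction l)
    case (Suc l)
    then show ?case using assms by simp
  qed simp
next
  case (Suc k)
  show ?case
  proof (induction l)
    case (Suc l')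
    then show ?case using assms Suc.IH \<open>\<And>l. (\<lambda>\<omega>. partition_fun (a \<omega>) k l) \<in> borel_measurable N\<close> by simp
  qed simp
qed

lemma measurable_passage_time [measurable (raw)]:
  assumes "\<And>z. (\<lambda>\<omega>. X \<omega> z) \<in> borel_measurable N"
  shows "(\<lambda>\<omega>. passage_time (X \<omega>) k l) \<in> borel_measurable N"
proof (induction k arbitrary: l)
  case 0
  show ?case by (induction l) (use assms in \<open>auto simp: passage_time_simps\<close>)
next
  case (Suc k)
  show ?case by (induction l) (use assms Suc in \<open>auto simp: passage_time_simps\<close>)
qed

lemma abs_ln_partition_fun_le:
  assumes q: "0 < q" "q < 1" and a: "\<And>j i. \<bar>a j i\<bar> \<le> B"
  shows "\<bar>ln (partition_fun a k l)\<bar> \<le> real l * B + k * ln (1 / q) + l * ln (1 / (1 - q))"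
proof -
  have "k * ln (1 / q) \<ge> 0" "l * ln (1 / (1 - q)) \<ge> 0"
    using q by (auto intro!: mult_nonneg_nonneg ln_ge_zero)
  then show ?thesis
    using ln_partition_fun[OF q, of a k l] abs_swl_le[of a B k l, OF a] by linarith
qed

section \<open>Expected passage times in a bounded environment\<close>

locale bounded_environment =
  fixes P :: "env measure" and M \<sigma> :: real
  assumes P: "iid_env P" and M: "M \<ge> 0" and bdd: "\<And>j. AE F in P. bounded_law M (F j)"
    and \<sigma>_def: "\<sigma> = env_sd P"
begin

sublocale joint: prob_space "joint_law P"
  using P by (rule prob_space_joint_law)

sublocale env: prob_space P
  by (rule iid_envD(1)[OF P])

lemma measurable_joint_law [measurable]:
  "(\<lambda>\<omega>. snd \<omega> z) \<in> borel_measurable (joint_law P)"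
  "(\<lambda>\<omega>. mean_of (fst \<omega> j)) \<in> borel_measurable (joint_law P)"
  "(\<lambda>\<omega>. centered_weights M j \<omega> i) \<in> borel_measurable (joint_law P)"
proof -
  show 1: "(\<lambda>\<omega>. snd \<omega> z) \<in> borel_measurable (joint_law P)" for z
    by (subst measurable_cong_sets[OF sets_joint_law[OF P] refl])
       (rule measurable_compose[OF measurable_snd measurable_weight_component])
  show 2: "(\<lambda>\<omega>. mean_of (fst \<omega> j)) \<in> borel_measurable (joint_law P)"
    by (subst measurable_cong_sets[OF sets_joint_law[OF P] refl])
       (rule measurable_compose[OF measurable_fst measurable_mean_component])
  show "(\<lambda>\<omega>. centered_weights M j \<omega> i) \<in> borel_measurable (joint_law P)"
    unfolding centered_weights_def using 1 2 by measurable
qed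

lemma measurable_centered_weights_row: "centered_weights M j \<in> joint_law P \<rightarrow>\<^sub>M row_space"
  by (subst measurable_cong_sets[OF sets_joint_law[OF P] refl]) measurable

text \<open>The crude bound on \<sigma> puts the coins under the same bound \<open>2 * M\<close> as
  the centered weights, as the row exchange requires.\<close>

lemma integral_variance: "(\<integral>F. variance_of (F 0) \<partial>P) = \<sigma>\<^sup>2" and \<sigma>: "0 \<le> \<sigma>" "\<sigma> \<le> 2 * M"
proof -
  have AE: "AE F in P. variance_of (F 0) \<in> {0..4 * M\<^sup>2}"
    using bdd[of 0] by eventually_elim (rule bounded_law_moments(4)[OF _ M])
  have AE_nonneg: "AE F in P. 0 \<le> variance_of (F 0)"
    and AE_le: "AE F in P. variance_of (F 0) \<le> 4 * M\<^sup>2"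
    and AE_norm: "AE F in P. norm (variance_of (F 0)) \<le> 4 * M\<^sup>2"
    using AE by (eventually_elim, simp)+
  have "(\<lambda>F. variance_of (F 0)) \<in> borel_measurable P"
    by (subst measurable_cong_sets[OF iid_envD(2)[OF P] refl])
       (rule measurable_compose[OF measurable_env_component measurable_variance_of])
  then have int: "integrable P (\<lambda>F. variance_of (F 0))"
    using AE_norm by (intro env.integrable_const_bound)
  have nonneg: "(\<integral>F. variance_of (F 0) \<partial>P) \<ge> 0"
    using AE_nonneg by (rule integral_nonneg_AE)
  show var: "(\<integral>F. variance_of (F 0) \<partial>P) = \<sigma>\<^sup>2"
    unfolding \<sigma>_def env_sd_def using nonneg by (rule real_sqrt_pow2[symmetric])
  show "0 \<le> \<sigma>"
    unfolding \<sigma>_def env_sd_def using nonneg by (rule real_sqrt_ge_zero)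
  have "\<sigma>\<^sup>2 \<le> 4 * M\<^sup>2"
    unfolding var[symmetric] using AE_le by (rule env.integral_le_const[OF int])
  also have "\<dots> = (2 * M)\<^sup>2" by (simp only: power_mult_distrib) simp
  finally show "\<sigma> \<le> 2 * M" by (rule power2_le_imp_le) (use M in simp)
qed

lemma free_energy_comparison:
  assumes "k < n" and \<beta>: "\<beta> \<ge> 0" "\<beta> * (2 * M) \<le> 1/4"
  shows "\<bar>(\<integral>\<omega>. ln (partition_fun (\<lambda>j i. \<beta> * centered_weights M j \<omega> i) k l) \<partial>joint_law P) -
     measure_pmf.expectation (replicate_pmf l (replicate_pmf n (bernoulli_pmf (1/2))))
       (\<lambda>rs. ln (partition_fun (\<lambda>j i. \<beta> * (\<sigma> * (1 - 2 * of_bool (rev rs ! j ! i)))) k l))\<bar>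
     \<le> real l * (60 * (\<beta> * (2 * M)) ^ 3)"
proof (cases "l = 0")
  \<comment> \<open>The product form of independence used below needs a nonempty set of
    rows.\<close>
  case True
  then show ?thesis by simp
next
  case False
  obtain ps where ps: "ps \<noteq> []" "\<forall>s\<in>set ps. \<forall>j. s j \<le> k"
      "\<And>a. partition_fun a k l = (\<Sum>s\<leftarrow>ps. exp (\<Sum>j<l. a j (s j)))"
    using partition_fun_as_sum[of k l] by blast
  define N where "N j = distr (joint_law P) row_space (centered_weights M j)" for j
  \<comment> \<open>Choices are indexed by their position in \<open>ps\<close>, so repetitions are
    harmless and all coefficients are 1.\<close>
  have pf: "ln (partition_fun (\<lambda>j i. \<beta> * a j i) k l) =
      ln (\<Sum>s\<in>{..<length ps}. 1 * exp (\<beta> * (\<Sum>j<l. a j ((ps ! s) j))))" for a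
    unfolding ps(3) by (simp add: sum_list_sum_nth atLeast0LessThan sum_distrib_left)
  have comp [measurable]: "(\<lambda>x. x j i) \<in> borel_measurable (\<Pi>\<^sub>M j\<in>{..<l}. row_space)" if "j < l" for j i
  proof -
    have 1: "(\<lambda>x. x j) \<in> (\<Pi>\<^sub>M j\<in>{..<l}. row_space) \<rightarrow>\<^sub>M row_space"
      using that by (intro measurable_component_singleton) simp
    have 2: "(\<lambda>r. r i) \<in> borel_measurable row_space"
      by (rule measurable_component_singleton) simp
    from measurable_compose[OF 1 2] show ?thesis .
  qed
  have "joint.indep_vars (\<lambda>_. row_space) (centered_weights M) {..<l}"
    by (rule joint.indep_vars_subset[OF indep_vars_centered_weights[OF P]]) simp
  then have law: "distr (joint_law P) (\<Pi>\<^sub>M j\<in>{..<l}. row_space) (\<lambda>\<omega>. \<lambda>j\<in>{..<l}. centered_weights M j \<omega>) =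
      (\<Pi>\<^sub>M j\<in>{..<l}. N j)"
    unfolding N_def using False measurable_centered_weights_row
    by (subst (asm) joint.indep_vars_iff_distr_eq_PiM') auto
  have rows: "(\<lambda>\<omega>. \<lambda>j\<in>{..<l}. centered_weights M j \<omega>) \<in> joint_law P \<rightarrow>\<^sub>M (\<Pi>\<^sub>M j\<in>{..<l}. row_space)"
    by (intro measurable_restrict measurable_centered_weights_row)
  let ?f = "\<lambda>x. ln (\<Sum>s\<in>{..<length ps}. 1 * exp (\<beta> * (\<Sum>j<l. x j ((ps ! s) j))))"
  have "?f \<in> borel_measurable (\<Pi>\<^sub>M j\<in>{..<l}. row_space)" by measurable
  from integral_distr[OF rows this]
  have left: "(\<integral>\<omega>. ln (partition_fun (\<lambda>j i. \<beta> * centered_weights M j \<omega> i) k l) \<partial>joint_law P) =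
      (\<integral>x. ?f x \<partial>(\<Pi>\<^sub>M j\<in>{..<l}. N j))"
    unfolding law pf by simp
  show ?thesis
    unfolding left unfolding pf
  proof (rule partition_comparison)
    show "sets (N j) = sets row_space" for j by (simp add: N_def)
    show "centered_row (N j) (\<lambda>i r. r i) k (2 * M) (\<sigma>\<^sup>2)" for j
      unfolding N_def integral_variance[symmetric] by (rule centered_row_joint_law[OF P M bdd])
    show "centered_row (measure_pmf (replicate_pmf n (bernoulli_pmf (1/2))))
        (\<lambda>i r. \<sigma> * (1 - 2 * of_bool (r ! i))) k (2 * M) (\<sigma>\<^sup>2)"
      using \<open>k < n\<close> \<sigma> by (rule centered_row_coins)
    show "finite (set_pmf (replicate_pmf n (bernoulli_pmf (1/2))))" by (rule finite_coin_rows)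
  qed (use ps \<beta> in auto)
qed

text \<open>In both models the free energy exceeds \<beta> times the maximum by an amount between 0
  and the same entropy. The two excesses have the same sign, so the entropy is paid only
  once.\<close>

lemma mean_swl:
  assumes "k < n" and \<beta>: "\<beta> > 0" "\<beta> * (2 * M) \<le> 1/4" and q: "0 < q" "q < 1"
  shows "\<bar>(\<integral>\<omega>. swl (\<lambda>j i. centered_weights M j \<omega> i) k l \<partial>joint_law P) - \<sigma> * (real l - 2 * mean_fpp n l k)\<bar>
    \<le> (k * ln (1 / q) + l * ln (1 / (1 - q)) + real l * (60 * (\<beta> * (2 * M)) ^ 3)) / \<beta>"
proof -
  define H where "H = k * ln (1 / q) + l * ln (1 / (1 - q))"
  define A where "A = (\<integral>\<omega>. swl (\<lambda>j i. centered_weights M j \<omega> i) k l \<partial>joint_law P)"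
  define Z where "Z \<omega> = ln (partition_fun (\<lambda>j i. \<beta> * centered_weights M j \<omega> i) k l)" for \<omega>
  let ?q = "replicate_pmf l (replicate_pmf n (bernoulli_pmf (1/2)))"
  define Z' where "Z' rs = ln (partition_fun (\<lambda>j i. \<beta> * (\<sigma> * (1 - 2 * of_bool (rev rs ! j ! i)))) k l)" for rs
  have int_A: "integrable (joint_law P) (\<lambda>\<omega>. swl (\<lambda>j i. centered_weights M j \<omega> i) k l)"
    by (rule joint.integrable_const_bound[of _ "real l * (2 * M)"])
       (auto intro!: abs_swl_le abs_centered_weights_le M)
  have int_Z: "integrable (joint_law P) Z"
  proof (rule joint.integrable_const_bound)
    show "AE \<omega> in joint_law P. norm (Z \<omega>) \<le> real l * (\<beta> * (2 * M)) + k * ln (1 / q) + l * ln (1 / (1 - q))"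
      unfolding Z_def real_norm_def
      by (intro AE_I2 abs_ln_partition_fun_le q)
         (use \<beta> in \<open>auto simp: abs_mult intro!: mult_left_mono abs_centered_weights_le M\<close>)
    show "Z \<in> borel_measurable (joint_law P)" unfolding Z_def by measurable
  qed
  have Z: "\<beta> * swl (\<lambda>j i. centered_weights M j \<omega> i) k l \<le> Z \<omega>"
      "Z \<omega> \<le> \<beta> * swl (\<lambda>j i. centered_weights M j \<omega> i) k l + H" for \<omega>
    using ln_partition_fun[OF q, of "\<lambda>j i. \<beta> * centered_weights M j \<omega> i" k l] \<beta>
    by (simp_all add: swl_mult Z_def H_def)
  have "\<beta> * A \<le> (\<integral>\<omega>. Z \<omega> \<partial>joint_law P)"
    unfolding A_def integral_mult_right_zero[symmetric]
    by (intro integral_mono int_Z integrable_mult_right int_A Z)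
  moreover have "(\<integral>\<omega>. Z \<omega> \<partial>joint_law P) \<le> (\<integral>\<omega>. \<beta> * swl (\<lambda>j i. centered_weights M j \<omega> i) k l + H \<partial>joint_law P)"
    by (intro integral_mono int_Z Bochner_Integration.integrable_add integrable_mult_right int_A Z
        joint.integrable_const)
  then have "(\<integral>\<omega>. Z \<omega> \<partial>joint_law P) \<le> \<beta> * A + H"
    using int_A by (simp add: A_def joint.prob_space)
  moreover
  have int: "integrable (measure_pmf ?q) f" for f :: "bool list list \<Rightarrow> real"
    by (intro integrable_measure_pmf_finite finite_set_replicate_pmf finite_coin_rows)
  have Z': "\<beta> * (\<sigma> * (real l - 2 * real (fpp k rs))) \<le> Z' rs"
      "Z' rs \<le> \<beta> * (\<sigma> * (real l - 2 * real (fpp k rs))) + H" if "rs \<in> set_pmf ?q" for rs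
  proof -
    have len: "length rs = l" using that by (simp add: set_replicate_pmf)
    have "swl (\<lambda>j i. \<beta> * (\<sigma> * (1 - 2 * of_bool (rev rs ! j ! i)))) k l = \<beta> * (\<sigma> * (real l - 2 * real (fpp k rs)))"
      using swl_coins[OF \<sigma>(1), of rs k] \<beta> by (simp add: swl_mult len)
    then show "\<beta> * (\<sigma> * (real l - 2 * real (fpp k rs))) \<le> Z' rs"
        "Z' rs \<le> \<beta> * (\<sigma> * (real l - 2 * real (fpp k rs))) + H"
      using ln_partition_fun[OF q, of "\<lambda>j i. \<beta> * (\<sigma> * (1 - 2 * of_bool (rev rs ! j ! i)))" k l]
      by (simp_all add: Z'_def H_def)
  qed
  have E: "measure_pmf.expectation ?q (\<lambda>rs. \<beta> * (\<sigma> * (real l - 2 * real (fpp k rs)))) =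
      \<beta> * (\<sigma> * (real l - 2 * mean_fpp n l k))"
    using int by (simp add: mean_fpp_def)
  have "\<beta> * (\<sigma> * (real l - 2 * mean_fpp n l k)) \<le> measure_pmf.expectation ?q Z'"
    unfolding E[symmetric] by (intro integral_mono_AE int) (use Z' in \<open>auto simp: AE_measure_pmf_iff\<close>)
  moreover have "measure_pmf.expectation ?q Z' \<le>
      measure_pmf.expectation ?q (\<lambda>rs. \<beta> * (\<sigma> * (real l - 2 * real (fpp k rs))) + H)"
    by (intro integral_mono_AE int) (use Z' in \<open>auto simp: AE_measure_pmf_iff\<close>)
  then have "measure_pmf.expectation ?q Z' \<le> \<beta> * (\<sigma> * (real l - 2 * mean_fpp n l k)) + H"
    unfolding E[symmetric] using int by simp
  moreover have "\<bar>(\<integral>\<omega>. Z \<omega> \<partial>joint_law P) - measure_pmf.expectation ?q Z'\<bar> \<le> real l * (60 * (\<beta> * (2 * M)) ^ 3)"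
    unfolding Z_def Z'_def using \<open>k < n\<close> \<beta> by (intro free_energy_comparison) auto
  ultimately have "\<bar>\<beta> * A - \<beta> * (\<sigma> * (real l - 2 * mean_fpp n l k))\<bar> \<le> H + real l * (60 * (\<beta> * (2 * M)) ^ 3)"
    by linarith
  also have "\<bar>\<beta> * A - \<beta> * (\<sigma> * (real l - 2 * mean_fpp n l k))\<bar> = \<bar>A - \<sigma> * (real l - 2 * mean_fpp n l k)\<bar> * \<beta>"
    using \<beta> by (simp add: right_diff_distrib[symmetric] abs_mult)
  finally have "\<bar>A - \<sigma> * (real l - 2 * mean_fpp n l k)\<bar> \<le> (H + real l * (60 * (\<beta> * (2 * M)) ^ 3)) / \<beta>"
    using \<beta> by (simp add: pos_le_divide_eq)
  then show ?thesis unfolding A_def H_def .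
qed

lemma AE_weights_bounded: "AE \<omega> in joint_law P. \<forall>z. \<bar>snd \<omega> z\<bar> \<le> M"
  unfolding AE_all_countable
proof
  fix z
  have [measurable]: "{x. \<not> \<bar>x\<bar> \<le> M} \<in> sets borel" by measurable
  have [measurable]: "(\<lambda>\<omega>. snd \<omega> z) \<in> borel_measurable (env_space \<Otimes>\<^sub>M weight_space)"
    by (rule measurable_compose[OF measurable_snd measurable_weight_component])
  have "(\<integral>\<^sup>+\<omega>. indicator {x. \<not> \<bar>x\<bar> \<le> M} (snd \<omega> z) \<partial>joint_law P) =
      (\<integral>\<^sup>+F. \<integral>\<^sup>+X. indicator {x. \<not> \<bar>x\<bar> \<le> M} (X z) \<partial>weight_law F \<partial>P)"
    by (subst nn_integral_joint_law[OF P]) auto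
  also have "\<dots> = (\<integral>\<^sup>+F. 0 \<partial>P)"
  proof (rule nn_integral_cong_AE)
    have "AE F in P. F \<in> space env_space" using iid_envD(3)[OF P] by (intro AE_I2) simp
    then show "AE F in P. (\<integral>\<^sup>+X. indicator {x. \<not> \<bar>x\<bar> \<le> M} (X z) \<partial>weight_law F) = 0"
      using bdd[of "snd z"]
    proof eventually_elim
      case (elim F)
      have meas: "(\<lambda>X. X z) \<in> borel_measurable (weight_law F)"
        by (subst measurable_cong_sets[OF sets_weight_law[OF elim(1)] refl]) measurable
      have "(\<integral>\<^sup>+X. indicator {x. \<not> \<bar>x\<bar> \<le> M} (X z) \<partial>weight_law F) =
          (\<integral>\<^sup>+x. indicator {x. \<not> \<bar>x\<bar> \<le> M} x \<partial>F (snd z))"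
        unfolding weight_law_component[OF elim(1), of z, symmetric]
        by (subst nn_integral_distr[OF meas]) auto
      also have "\<dots> = (\<integral>\<^sup>+x. 0 \<partial>F (snd z))"
        by (rule nn_integral_cong_AE)
           (use elim(2) in \<open>auto simp: bounded_law_def elim!: eventually_mono\<close>)
      finally show ?case by simp
    qed
  qed
  finally have "(\<integral>\<^sup>+\<omega>. indicator {x. \<not> \<bar>x\<bar> \<le> M} (snd \<omega> z) \<partial>joint_law P) = 0" by simp
  then have "AE \<omega> in joint_law P. indicator {x. \<not> \<bar>x\<bar> \<le> M} (snd \<omega> z) = (0 :: ennreal)"
    by (subst (asm) nn_integral_0_iff_AE) measurable
  then show "AE \<omega> in joint_law P. \<bar>snd \<omega> z\<bar> \<le> M"
    by eventually_elim (auto simp: indicator_def split: if_splits)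
qed

lemma integrable_passage_time: "integrable (joint_law P) (\<lambda>\<omega>. passage_time (snd \<omega>) k l)"
proof (rule joint.integrable_const_bound)
  show "AE \<omega> in joint_law P. norm (passage_time (snd \<omega>) k l) \<le> real l * M + real k * M"
    using AE_weights_bounded
  proof eventually_elim
    case (elim \<omega>)
    then have "\<bar>passage_time (snd \<omega>) k l - swl (\<lambda>j i. snd \<omega> (i, j)) k l\<bar> \<le> real k * M"
      by (intro passage_time_near_swl) blast
    moreover have "\<bar>swl (\<lambda>j i. snd \<omega> (i, j)) k l\<bar> \<le> real l * M"
      using elim by (intro abs_swl_le) simp
    ultimately show ?case by (simp add: abs_le_iff)
  qed
qed measurable

lemma mean_clipped: "(\<integral>\<omega>. clip M (mean_of (fst \<omega> j)) \<partial>joint_law P) = env_mean P"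
proof -
  have meas: "(\<lambda>F. mean_of (F j)) \<in> borel_measurable P"
    by (subst measurable_cong_sets[OF iid_envD(2)[OF P] refl]) measurable
  have "(\<lambda>\<omega>. clip M (mean_of (fst \<omega> j))) \<in> borel_measurable (env_space \<Otimes>\<^sub>M weight_space)"
    by (intro measurable_compose[OF _ measurable_clip]
        measurable_compose[OF measurable_fst measurable_mean_component])
  then have "(\<integral>\<omega>. clip M (mean_of (fst \<omega> j)) \<partial>joint_law P) =
      (\<integral>F. \<integral>X. clip M (mean_of (fst (F, X) j)) \<partial>weight_law F \<partial>P)"
    by (rule integral_joint_law[OF P, of _ M]) (rule abs_clip_le[OF M])
  also have "\<dots> = (\<integral>F. clip M (mean_of (F j)) \<partial>P)"
  proof (intro Bochner_Integration.integral_cong refl)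
    fix F assume "F \<in> space P"
    then interpret W: prob_space "weight_law F"
      by (intro prob_space_weight_law) (simp add: iid_envD(3)[OF P])
    show "(\<integral>X. clip M (mean_of (fst (F, X) j)) \<partial>weight_law F) = clip M (mean_of (F j))"
      by (simp add: W.prob_space)
  qed
  also have "\<dots> = (\<integral>F. mean_of (F j) \<partial>P)"
  proof (rule integral_cong_AE)
    show "AE F in P. clip M (mean_of (F j)) = mean_of (F j)"
      using bdd[of j] by eventually_elim (rule clip_eq, rule bounded_law_moments(1)[OF _ M])
  qed (use meas in measurable)
  also have "\<dots> = env_mean P"
    unfolding env_mean_def by (rule integral_env_component[OF P measurable_mean_of])
  finally show ?thesis .
qed

text \<open>The horizontal steps cost \<open>k * M\<close>; the row means leave the maximum and
  contribute \<open>l * env_mean P\<close> in expectation.\<close>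

lemma mean_passage_time:
  assumes "k < n" and \<beta>: "\<beta> > 0" "\<beta> * (2 * M) \<le> 1/4" and q: "0 < q" "q < 1"
  shows "\<bar>(\<integral>\<omega>. passage_time (snd \<omega>) k l \<partial>joint_law P) -
      (real l * env_mean P + \<sigma> * (real l - 2 * mean_fpp n l k))\<bar>
    \<le> real k * M + (k * ln (1 / q) + l * ln (1 / (1 - q)) + real l * (60 * (\<beta> * (2 * M)) ^ 3)) / \<beta>"
proof -
  let ?T = "\<lambda>\<omega>. passage_time (snd \<omega>) k l"
  let ?W = "\<lambda>\<omega>. swl (\<lambda>j i. centered_weights M j \<omega> i) k l"
  let ?S = "\<lambda>\<omega>. \<Sum>j<l. clip M (mean_of (fst \<omega> j))"
  have int_W: "integrable (joint_law P) ?W"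
    by (rule joint.integrable_const_bound[of _ "real l * (2 * M)"])
       (auto intro!: abs_swl_le abs_centered_weights_le M)
  have int_m: "integrable (joint_law P) (\<lambda>\<omega>. clip M (mean_of (fst \<omega> j)))" for j
    by (rule joint.integrable_const_bound[of _ M])
       (auto intro!: abs_clip_le M measurable_compose[OF _ measurable_clip])
  have near: "AE \<omega> in joint_law P. \<bar>?T \<omega> - (?W \<omega> + ?S \<omega>)\<bar> \<le> real k * M"
    using AE_weights_bounded
  proof eventually_elim
    case (elim \<omega>)
    have "swl (\<lambda>j i. snd \<omega> (i, j)) k l = swl (\<lambda>j i. centered_weights M j \<omega> i + clip M (mean_of (fst \<omega> j))) k l"
      by (rule swl_cong) (use elim in \<open>simp add: centered_weights_def clip_eq\<close>)
    also have "\<dots> = ?W \<omega> + ?S \<omega>" by (rule swl_add_row)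
    finally show ?case using passage_time_near_swl[of "snd \<omega>" M k l] elim by simp
  qed
  have int: "integrable (joint_law P) (\<lambda>\<omega>. ?T \<omega> - (?W \<omega> + ?S \<omega>))"
    by (intro Bochner_Integration.integrable_diff Bochner_Integration.integrable_add
        Bochner_Integration.integrable_sum integrable_passage_time int_W int_m)
  have "(\<integral>\<omega>. ?T \<omega> - (?W \<omega> + ?S \<omega>) \<partial>joint_law P) =
      (\<integral>\<omega>. ?T \<omega> \<partial>joint_law P) - ((\<integral>\<omega>. ?W \<omega> \<partial>joint_law P) + real l * env_mean P)"
    using integrable_passage_time[of k l] int_W int_m
    by (simp add: Bochner_Integration.integral_diff Bochner_Integration.integral_add
        Bochner_Integration.integral_sum mean_clipped)
  moreover have "\<bar>\<integral>\<omega>. ?T \<omega> - (?W \<omega> + ?S \<omega>) \<partial>joint_law P\<bar> \<le> real k * M"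
  proof -
    have "\<bar>\<integral>\<omega>. ?T \<omega> - (?W \<omega> + ?S \<omega>) \<partial>joint_law P\<bar> \<le> (\<integral>\<omega>. \<bar>?T \<omega> - (?W \<omega> + ?S \<omega>)\<bar> \<partial>joint_law P)"
      by (rule integral_abs_bound)
    also have "\<dots> \<le> real k * M"
      using near by (intro joint.integral_le_const integrable_abs int)
    finally show ?thesis .
  qed
  ultimately show ?thesis using mean_swl[OF assms, of l] by linarith
qed

text \<open>Convergence in L1 identifies the limit shape with the limit of expectations, so
  estimates of means suffice. The term \<open>\<sigma> * \<alpha>\<close> is the difference between
  the coin value \<sigma> (2 sqrt \<alpha> - \<alpha>) and 2 \<sigma> sqrt \<alpha>.\<close>

lemma limit_shape_bound:
  assumes \<Psi>: "limit_shape P \<Psi>" and \<alpha>: "0 < \<alpha>" "\<alpha> < 1" and \<beta>: "\<beta> > 0" "\<beta> * (2 * M) \<le> 1/4"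
  shows "\<bar>\<Psi> \<alpha> 1 - (env_mean P + 2 * \<sigma> * sqrt \<alpha>)\<bar> \<le>
    \<alpha> * M + \<sigma> * \<alpha> + (\<alpha> * ln (1 / \<alpha>) + ln (1 / (1 - \<alpha>)) + 60 * (\<beta> * (2 * M)) ^ 3) / \<beta>" (is "_ \<le> ?E")
proof (rule field_le_epsilon)
  fix \<delta> :: real assume \<delta>: "\<delta> > 0"
  \<comment> \<open>The L1 distance contributes \<eta> and the coin asymptotics contribute 2
    \<sigma> \<eta>; together they make \<delta>.\<close>
  define \<eta> where "\<eta> = \<delta> / (1 + 2 * \<sigma>)"
  have pos: "1 + 2 * \<sigma> > 0" using \<sigma>(1) by simp
  then have "\<eta> * (1 + 2 * \<sigma>) = \<delta>" by (simp add: \<eta>_def)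
  then have \<eta>: "\<eta> > 0" "\<eta> + 2 * \<sigma> * \<eta> = \<delta>"
    using \<delta> pos by (simp add: \<eta>_def, simp only: distrib_left mult_1_right mult.commute)
  let ?k = "\<lambda>n. nat \<lfloor>real n * \<alpha>\<rfloor>"
  have "(\<lambda>n. \<integral>\<^sup>+(F, X). ennreal \<bar>scaled_passage_time X \<alpha> 1 n - \<Psi> \<alpha> 1\<bar> \<partial>joint_law P) \<longlonglongrightarrow> 0"
    using \<Psi> \<alpha> by (simp add: limit_shape_def)
  then have "\<forall>\<^sub>F n in sequentially.
      (\<integral>\<^sup>+(F, X). ennreal \<bar>scaled_passage_time X \<alpha> 1 n - \<Psi> \<alpha> 1\<bar> \<partial>joint_law P) < ennreal \<eta>"
    using \<eta>(1) by (intro order_tendstoD) auto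
  moreover note mean_fpp_asymp[OF \<alpha> \<eta>(1)]
  ultimately have "\<forall>\<^sub>F n in sequentially. \<bar>\<Psi> \<alpha> 1 - (env_mean P + 2 * \<sigma> * sqrt \<alpha>)\<bar> \<le> ?E + \<delta>"
    using eventually_gt_at_top[of 0]
  proof eventually_elim
    case (elim n)
    then have n: "real n > 0" by simp
    define k where "k = ?k n"
    obtain n' where n': "k < n'" "mean_fpp n' n k \<in> {real n * ((1 - sqrt \<alpha>)\<^sup>2 / 2) .. real n * ((1 - sqrt \<alpha>)\<^sup>2 / 2 + \<eta>)}"
      using elim(2) unfolding k_def by blast
    have k: "real k \<le> real n * \<alpha>" using n \<alpha> by (simp add: k_def)
    define T where "T = (\<integral>\<omega>. passage_time (snd \<omega>) k n \<partial>joint_law P)"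
    have spt: "scaled_passage_time X \<alpha> 1 n = passage_time X k n / real n" for X
      by (simp add: scaled_passage_time_def k_def)
    have 1: "\<bar>T / n - \<Psi> \<alpha> 1\<bar> \<le> \<eta>"
    proof -
      have int: "integrable (joint_law P) (\<lambda>\<omega>. passage_time (snd \<omega>) k n / real n - \<Psi> \<alpha> 1)"
        using integrable_passage_time[of k n] by simp
      have "T / n - \<Psi> \<alpha> 1 = (\<integral>\<omega>. passage_time (snd \<omega>) k n / real n - \<Psi> \<alpha> 1 \<partial>joint_law P)"
        using integrable_passage_time[of k n] by (simp add: T_def joint.prob_space)
      then have "ennreal \<bar>T / n - \<Psi> \<alpha> 1\<bar> \<le> (\<integral>\<^sup>+\<omega>. ennreal \<bar>passage_time (snd \<omega>) k n / real n - \<Psi> \<alpha> 1\<bar> \<partial>joint_law P)"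
        using integral_norm_bound_ennreal[OF int] by simp
      also have "\<dots> < ennreal \<eta>"
        using elim(1) by (simp add: spt split_beta')
      finally show ?thesis using \<eta>(1) by (simp add: ennreal_less_iff)
    qed
    define t where "t = mean_fpp n' n k / real n"
    have t: "(1 - sqrt \<alpha>)\<^sup>2 / 2 \<le> t" "t \<le> (1 - sqrt \<alpha>)\<^sup>2 / 2 + \<eta>"
      using n'(2) n by (auto simp: t_def field_simps)
    have 2: "\<bar>T / n - (env_mean P + \<sigma> * (1 - 2 * t))\<bar> \<le>
        \<alpha> * M + (\<alpha> * ln (1 / \<alpha>) + ln (1 / (1 - \<alpha>)) + 60 * (\<beta> * (2 * M)) ^ 3) / \<beta>"
    proof -
      have "T / n - (env_mean P + \<sigma> * (1 - 2 * t)) = (T - (real n * env_mean P + \<sigma> * (real n - 2 * mean_fpp n' n k))) / n"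
        using n by (simp add: t_def field_simps)
      then have "\<bar>T / n - (env_mean P + \<sigma> * (1 - 2 * t))\<bar> =
          \<bar>T - (real n * env_mean P + \<sigma> * (real n - 2 * mean_fpp n' n k))\<bar> / n"
        using n by simp
      \<comment> \<open>The entropy parameter \<open>q\<close> is set to \<alpha>, the number of
        horizontal steps per row.\<close>
      also have "\<dots> \<le> (real k * M + (k * ln (1 / \<alpha>) + n * ln (1 / (1 - \<alpha>)) + real n * (60 * (\<beta> * (2 * M)) ^ 3)) / \<beta>) / n"
        using n mean_passage_time[OF n'(1) \<beta> \<alpha>, of n] unfolding T_def by (intro divide_right_mono) auto
      also have "\<dots> \<le> (real n * \<alpha> * M + (real n * \<alpha> * ln (1 / \<alpha>) + n * ln (1 / (1 - \<alpha>)) + real n * (60 * (\<beta> * (2 * M)) ^ 3)) / \<beta>) / n"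
        using k n \<alpha> \<beta> M by (intro divide_right_mono add_mono mult_right_mono) auto
      also have "\<dots> = \<alpha> * M + (\<alpha> * ln (1 / \<alpha>) + ln (1 / (1 - \<alpha>)) + 60 * (\<beta> * (2 * M)) ^ 3) / \<beta>"
      proof -
        have "(real n * \<alpha> * M + (real n * \<alpha> * u + n * v + real n * w) / \<beta>) / n = \<alpha> * M + (\<alpha> * u + v + w) / \<beta>" for u v w :: real
          using n \<beta>(1) by (simp add: field_simps)
        then show ?thesis .
      qed
      finally show ?thesis .
    qed
    have 3: "\<bar>\<sigma> * (1 - 2 * t) - 2 * \<sigma> * sqrt \<alpha>\<bar> \<le> \<sigma> * \<alpha> + 2 * \<sigma> * \<eta>"
    proof -
      have "(sqrt \<alpha>)\<^sup>2 = \<alpha>" using \<alpha> by simp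
      then have "(1 - sqrt \<alpha>)\<^sup>2 = 1 - 2 * sqrt \<alpha> + \<alpha>" by (simp add: power2_diff)
      then have "\<bar>1 - 2 * t - 2 * sqrt \<alpha>\<bar> \<le> \<alpha> + 2 * \<eta>"
        using t \<alpha> \<eta>(1) unfolding abs_le_iff by (intro conjI; linarith)
      then have "\<sigma> * \<bar>1 - 2 * t - 2 * sqrt \<alpha>\<bar> \<le> \<sigma> * (\<alpha> + 2 * \<eta>)" using \<sigma>(1) by (rule mult_left_mono)
      moreover have "\<sigma> * (1 - 2 * t) - 2 * \<sigma> * sqrt \<alpha> = \<sigma> * (1 - 2 * t - 2 * sqrt \<alpha>)"
        by (simp add: algebra_simps)
      then have "\<bar>\<sigma> * (1 - 2 * t) - 2 * \<sigma> * sqrt \<alpha>\<bar> = \<sigma> * \<bar>1 - 2 * t - 2 * sqrt \<alpha>\<bar>"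
        using \<sigma>(1) by (simp only: abs_mult abs_of_nonneg)
      moreover have "\<sigma> * (\<alpha> + 2 * \<eta>) = \<sigma> * \<alpha> + 2 * \<sigma> * \<eta>" by (simp add: algebra_simps)
      ultimately show ?thesis by linarith
    qed
    show ?case using 1 2 3 \<eta>(2) by linarith
  qed
  then show "\<bar>\<Psi> \<alpha> 1 - (env_mean P + 2 * \<sigma> * sqrt \<alpha>)\<bar> \<le> ?E + \<delta>"
    by (simp add: eventually_const_iff)
qed

end

theorem theorem4p1p2:
  fixes P :: "env measure" and \<Psi> :: "real \<Rightarrow> real \<Rightarrow> real" and M \<epsilon> :: real
  assumes "iid_env P"
    and "tail_assumptions P"
    and "AE F in P. cdf (F 0) (- M) = 0 \<and> cdf (F 0) M = 1"
    and "limit_shape P \<Psi>"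
    and "\<epsilon> > 0"
  shows "(\<lambda>\<alpha>. \<Psi> \<alpha> 1 - (env_mean P + 2 * env_sd P * sqrt \<alpha>))
           \<in> o[at_right 0](\<lambda>\<alpha>. \<alpha> powr (3/5 - \<epsilon>))"
proof -
  interpret prob_space P by (rule iid_envD(1)[OF assms(1)])
  \<comment> \<open>For negative \<open>M\<close> the row laws would be carried by the empty
    set.\<close>
  have M: "M \<ge> 0"
  proof (rule ccontr)
    assume "\<not> M \<ge> 0"
    have "AE F in P. False"
      using assms(3) AE_bounded_law[OF assms(1,3), of 0]
    proof eventually_elim
      case (elim F)
      then interpret N: prob_space "F 0" by (simp add: bounded_law_def)
      have "AE x in F 0. False"
      proof -
        have "AE x in F 0. \<bar>x\<bar> \<le> M" using elim(2) by (simp add: bounded_law_def)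
        then show ?thesis by eventually_elim (use \<open>\<not> M \<ge> 0\<close> in linarith)
      qed
      then show False by simp
    qed
    then show False by simp
  qed
  interpret bounded_environment P M "env_sd P"
    by unfold_locales (use assms M AE_bounded_law in auto)
  define s where "s = env_sd P"
  \<comment> \<open>At \<open>\<beta> = \<alpha> powr (1/3)\<close> the two competing errors
    \<alpha>/\<beta> and \<beta>^2 have the same order.\<close>
  define E where "E \<alpha> = \<alpha> * M + s * \<alpha> + (\<alpha> * ln (1 / \<alpha>) + ln (1 / (1 - \<alpha>)) +
      60 * (\<alpha> powr (1/3) * (2 * M)) ^ 3) / \<alpha> powr (1/3)" for \<alpha>
  have small: "\<forall>\<^sub>F \<alpha> in at_right 0. \<alpha> \<in> {0<..<1::real}"
    by (rule eventually_at_right_real) simp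
  have "\<forall>\<^sub>F \<alpha> in at_right 0. \<alpha> powr (1/3) * (2 * M) < 1/4"
  proof (rule order_tendstoD)
    show "((\<lambda>\<alpha>. \<alpha> powr (1/3) * (2 * M)) \<longlongrightarrow> 0) (at_right 0)" by real_asymp
  qed simp
  then have "\<forall>\<^sub>F \<alpha> in at_right 0. norm (\<Psi> \<alpha> 1 - (env_mean P + 2 * env_sd P * sqrt \<alpha>)) \<le> norm (E \<alpha>)"
    using small
  proof eventually_elim
    case (elim \<alpha>)
    then have "\<bar>\<Psi> \<alpha> 1 - (env_mean P + 2 * env_sd P * sqrt \<alpha>)\<bar> \<le> E \<alpha>"
      unfolding E_def s_def by (intro limit_shape_bound[OF assms(4)]) auto
    then show ?case by simp
  qed
  then have "(\<lambda>\<alpha>. \<Psi> \<alpha> 1 - (env_mean P + 2 * env_sd P * sqrt \<alpha>)) \<in> O[at_right 0](E)"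
    by (intro landau_o.bigI[of 1]) auto
  also have "E \<in> o[at_right 0](\<lambda>\<alpha>. \<alpha> powr (3/5))"
  proof -
    have E_eq: "E = (\<lambda>\<alpha>. (M + s) * \<alpha> + (\<alpha> * ln (1 / \<alpha>) + ln (1 / (1 - \<alpha>))) / \<alpha> powr (1/3) +
        60 * (2 * M) ^ 3 * ((\<alpha> powr (1/3)) ^ 3 / \<alpha> powr (1/3)))"
      by (simp add: E_def fun_eq_iff power_mult_distrib add_divide_distrib algebra_simps)
    \<comment> \<open>The three summands are of order \<alpha>, \<alpha>^(2/3) ln(1/\<alpha>) and
      \<alpha>^(2/3), and 2/3 exceeds 3/5.\<close>
    have "(\<lambda>\<alpha>. \<alpha>) \<in> o[at_right 0](\<lambda>\<alpha>. \<alpha> powr (3/5) :: real)"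
      "(\<lambda>\<alpha>. (\<alpha> * ln (1 / \<alpha>) + ln (1 / (1 - \<alpha>))) / \<alpha> powr (1/3)) \<in> o[at_right 0](\<lambda>\<alpha>. \<alpha> powr (3/5) :: real)"
      "(\<lambda>\<alpha>. (\<alpha> powr (1/3)) ^ 3 / \<alpha> powr (1/3)) \<in> o[at_right 0](\<lambda>\<alpha>. \<alpha> powr (3/5) :: real)"
      by real_asymp+
    then show ?thesis
      unfolding E_eq by (intro sum_in_smallo) (simp_all only: cmult_in_smallo_iff simp_thms)
  qed
  also have "(\<lambda>\<alpha>. \<alpha> powr (3/5)) \<in> O[at_right 0](\<lambda>\<alpha>. \<alpha> powr (3/5 - \<epsilon>))"
  proof (rule landau_o.bigI[of 1])
    show "\<forall>\<^sub>F \<alpha> in at_right 0. norm (\<alpha> powr (3/5)) \<le> 1 * norm (\<alpha> powr (3/5 - \<epsilon>))"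
      using small by eventually_elim (use \<open>\<epsilon> > 0\<close> in \<open>auto intro!: powr_mono'\<close>)
  qed simp
  finally show ?thesis .
qed

end
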